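(* For each $(t,x)\in\mathbb R_+\times\mathbb R$, as $\varepsilon\to0$, $$u^\varepsilon(t,x)\ \longrightarrow\ u(t,x):=\mathbb E\left[g(x+B_t)\exp\left(\int_0^tW(ds,x+B_s)\right)\right]$$ in $P$-law, i.e. the random variables $u^\varepsilon(t,x)$ on $(\mathcal S,\mathcal A,P)$ converge in distribution to the random variable $u(t,x)$ on $(\mathcal S,\mathcal A,P)$.
   Context: Setting. $(\mathcal S,\mathcal A,P)$ and $(\Omega,\mathcal F,\mathbb P)$ are probability spaces with expectations $E$ and $\mathbb E$; everything lives on the product space, so objects on $\mathcal S$ are independent of objects on $\Omega$, and $\mathbb E$ applied to a function on the product integrates only over $\Omega$. $B$ is a standard Brownian motion on $(\Omega,\mathcal F,\mathbb P)$. $c=\{c(t,x):t\in\mathbb R_+,x\in\mathbb R\}$ is a stationary (jointly measurable) real random field on $(\mathcal S,\mathcal A,P)$ with $E\,c(t,x)=0$, uniformly bounded in $(t,x,s)\in\mathbb R_+\times\mathbb R\times\mathcal S$. $\Phi(t,x):=E[c(s,y)c(s+t,y+x)]$ (for $t<0$ take $s\ge -t$), assumed in $L^1(\mathbb R\times\mathbb R)$. Assumptions. (Hölder) There are a deterministic exponent $\theta>0$ and a deterministic constant $C_0$ such that for each $s$, a.s., $|c(s,y_1)-c(s,y_2)|\le C_0|y_1-y_2|^\theta$ for all $y_1,y_2\in\mathbb R$. (Mixing) For $A\subset\mathbb R_+\times\mathbb R$ let $\mathcal F_A=\sigma\{c(t,x):(t,x)\in A\}$ and $$\alpha_{\rm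 um}(r)=\sup_{A_1,A_2:\ \mathrm{dist}(A_1,A_2)\ge r}\ \ \sup_{S_1\in\mathcal F_{A_1},\,S_2\in\mathcal F_{A_2},\,P(S_2)\ne0}|P(S_1|S_2)-P(S_1)|.$$ There exist $C,\delta>0$ such that $\alpha_{\rm um}(r)\le C(1+r)^{-(q(\theta)+\delta)}$ for all $r\ge0$, where $q(\theta)=3$ if $\theta>1/3$ and $q(\theta)=k+1$ if $\theta\in(1/(k+1),1/k]$, $k\ge3$, $k\in\mathbb N$. The equation. $g\in L^2(\mathbb R)\cap C(\mathbb R)$ and $u^\varepsilon$ is the solution of $\partial_tu^\varepsilon=\frac12\partial_{xx}u^\varepsilon+\varepsilon^{-1/2}c\left(\frac t\varepsilon,x\right)u^\varepsilon$, $u^\varepsilon(0,x)=g(x)$, given by the Feynman–Kac formula $$u^\varepsilon(t,x)=\mathbb E\left[g(x+B_t)\exp\left(\varepsilon^{-1/2}\int_0^tc\left(\frac s\varepsilon,x+B_s\right)ds\right)\right].$$ The limiting noise. $R(x)=\int_{\mathbb R}\Phi(r,x)dr$; $W=\{W(t,x):t\ge0,x\in\mathbb R\}$ is a continuous centered Gaussian process on $(\mathcal S,\mathcal A,P)$ with covariance $E(W(t,x)W(t',x'))=(t\wedge t')R(x-x')$. For $f\in C(\mathbb R_+)$, $\int_0^tW(ds,f(s))$ denotes the limit in $P$-probability, as $n\to\infty$, of $\sum_{k=1}^{[t2^n]}\left[W(k2^{-n},f(k2^{-n}))-W((k-1)2^{-n},f(k2^{-n}))\right]$; it is applied with $f(s)=x+B_s$,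 using independence of $W$ and $B$. *)

theory Defs
  imports "HOL-Probability.Probability"
begin

text \<open>
  Processes indexed by $\mathbb{R}_+$ or $\mathbb{R}_+ \times \mathbb{R}$ are total functions on the
  reals; only their values at times $t \ge 0$ are constrained or used.
\<close>

definition brownian_motion :: "'w measure \<Rightarrow> (real \<Rightarrow> 'w \<Rightarrow> real) \<Rightarrow> bool" where
  "brownian_motion M B \<longleftrightarrow>
     (\<forall>t\<ge>0. B t \<in> borel_measurable M) \<and>
     (AE w in M. B 0 w = 0) \<and>
     (\<forall>w\<in>space M. continuous_on {0..} (\<lambda>t. B t w)) \<and>
     (\<forall>s t. 0 \<le> s \<and> s < t \<longrightarrow>
        distributed M lborel (\<lambda>w. B t w - B s w) (normal_density 0 (sqrt (t - s)))) \<and>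
     (\<forall>(n::nat) \<tau>. 0 \<le> \<tau> 0 \<and> (\<forall>i<n. \<tau> i < \<tau> (Suc i)) \<longrightarrow>
        prob_space.indep_vars M (\<lambda>_. borel) (\<lambda>i w. B (\<tau> (Suc i)) w - B (\<tau> i) w) {..<n})"


subsection \<open>The random field\<close>

definition jointly_measurable_field :: "'s measure \<Rightarrow> (real \<Rightarrow> real \<Rightarrow> 's \<Rightarrow> real) \<Rightarrow> bool" where
  "jointly_measurable_field M c \<longleftrightarrow>
     (\<lambda>(t, x, s). c t x s) \<in> borel_measurable (restrict_space borel {0..} \<Otimes>\<^sub>M (borel \<Otimes>\<^sub>M M))"

definition stationary_field :: "'s measure \<Rightarrow> (real \<Rightarrow> real \<Rightarrow> 's \<Rightarrow> real) \<Rightarrow> bool" where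
  "stationary_field M c \<longleftrightarrow>
     (\<forall>I h y. finite I \<and> I \<subseteq> {0..} \<times> UNIV \<and> 0 \<le> h \<longrightarrow>
        distr M (\<Pi>\<^sub>M p\<in>I. borel) (\<lambda>s. \<lambda>p\<in>I. c (fst p + h) (snd p + y) s) =
        distr M (\<Pi>\<^sub>M p\<in>I. borel) (\<lambda>s. \<lambda>p\<in>I. c (fst p) (snd p) s))"

text \<open>
  $\Phi(t,x) = E[c(s,y)\,c(s+t,y+x)]$, evaluated at the base point $s = \max(0,-t)$, $y = 0$; for a
  stationary field the value does not depend on the choice of $y$ and of $s \ge \max(0,-t)$.
\<close>

definition cov_fun :: "'s measure \<Rightarrow> (real \<Rightarrow> real \<Rightarrow> 's \<Rightarrow> real) \<Rightarrow> real \<Rightarrow> real \<Rightarrow> real" where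
  "cov_fun M c t x = (\<integral>s. c (max 0 (-t)) 0 s * c (max 0 (-t) + t) x s \<partial>M)"

definition limit_cov :: "'s measure \<Rightarrow> (real \<Rightarrow> real \<Rightarrow> 's \<Rightarrow> real) \<Rightarrow> real \<Rightarrow> real" where
  "limit_cov M c x = (\<integral>r. cov_fun M c r x \<partial>lborel)"

definition field_sigma :: "'s measure \<Rightarrow> (real \<Rightarrow> real \<Rightarrow> 's \<Rightarrow> real) \<Rightarrow> (real \<times> real) set \<Rightarrow> 's set set" where
  "field_sigma M c A =
     sigma_sets (space M) {c t x -` D \<inter> space M | t x D. (t, x) \<in> A \<and> D \<in> sets borel}"

text \<open>
  The values over which the supremum is taken lie in $[0,1]$. The library convention that
  \<^term>\<open>setdist\<close> vanishes on the empty set is harmless, since the sigma-algebra of the empty index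
  set is trivial and contributes only the value 0.
\<close>

definition alpha_um :: "'s measure \<Rightarrow> (real \<Rightarrow> real \<Rightarrow> 's \<Rightarrow> real) \<Rightarrow> real \<Rightarrow> real" where
  "alpha_um M c r =
     Sup {\<bar>measure M (S1 \<inter> S2) / measure M S2 - measure M S1\<bar> | A1 A2 S1 S2.
            A1 \<subseteq> {0..} \<times> UNIV \<and> A2 \<subseteq> {0..} \<times> UNIV \<and> r \<le> setdist A1 A2 \<and>
            S1 \<in> field_sigma M c A1 \<and> S2 \<in> field_sigma M c A2 \<and> measure M S2 \<noteq> 0}"

definition mixing_exponent :: "real \<Rightarrow> real" where
  "mixing_exponent \<theta> =
     (if \<theta> > 1/3 then 3
      else real (THE k::nat. 3 \<le> k \<and> 1 / (real k + 1) < \<theta> \<and> \<theta> \<le> 1 / real k) + 1)"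

definition u_eps ::
  "'w measure \<Rightarrow> (real \<Rightarrow> 'w \<Rightarrow> real) \<Rightarrow> (real \<Rightarrow> real \<Rightarrow> 's \<Rightarrow> real) \<Rightarrow> (real \<Rightarrow> real) \<Rightarrow>
   real \<Rightarrow> real \<Rightarrow> real \<Rightarrow> 's \<Rightarrow> real" where
  "u_eps Om B c g \<epsilon> t x s =
     (\<integral>w. g (x + B t w) *
          exp (\<epsilon> powr (-1/2) * (LINT r:{0..t}|lborel. c (r / \<epsilon>) (x + B r w) s)) \<partial>Om)"


subsection \<open>The limiting noise\<close>

text \<open>Normal random variables of variance 0, i.e. almost surely constant ones, are included.\<close>

definition gaussian_var :: "'s measure \<Rightarrow> ('s \<Rightarrow> real) \<Rightarrow> bool" where
  "gaussian_var M X \<longleftrightarrow> X \<in> borel_measurable M \<and>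
     ((\<exists>m. AE s in M. X s = m) \<or>
      (\<exists>m \<sigma>. 0 < \<sigma> \<and> distributed M lborel X (normal_density m \<sigma>)))"

definition gaussian_field :: "'s measure \<Rightarrow> (real \<Rightarrow> real \<Rightarrow> 's \<Rightarrow> real) \<Rightarrow> bool" where
  "gaussian_field M W \<longleftrightarrow>
     (\<forall>I a. finite I \<and> I \<subseteq> {0..} \<times> UNIV \<longrightarrow>
        gaussian_var M (\<lambda>s. \<Sum>p\<in>I. a p * W (fst p) (snd p) s))"

definition conv_in_prob :: "'s measure \<Rightarrow> (nat \<Rightarrow> 's \<Rightarrow> real) \<Rightarrow> ('s \<Rightarrow> real) \<Rightarrow> bool" where
  "conv_in_prob M X Y \<longleftrightarrow>
     (\<forall>\<eta>>0. (\<lambda>n. measure M {s \<in> space M. \<eta> < \<bar>X n s - Y s\<bar>}) \<longlonglongrightarrow> 0)"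

definition W_sum :: "(real \<Rightarrow> real \<Rightarrow> 's \<Rightarrow> real) \<Rightarrow> real \<Rightarrow> (real \<Rightarrow> real) \<Rightarrow> nat \<Rightarrow> 's \<Rightarrow> real" where
  "W_sum W t f n s =
     (\<Sum>k = 1..nat \<lfloor>t * 2 ^ n\<rfloor>.
        W (real k / 2 ^ n) (f (real k / 2 ^ n)) s - W ((real k - 1) / 2 ^ n) (f (real k / 2 ^ n)) s)"

text \<open>\<open>X\<close> is a version of the random variable $\int_0^t W(ds, f(s))$.\<close>

definition is_W_integral ::
  "'s measure \<Rightarrow> (real \<Rightarrow> real \<Rightarrow> 's \<Rightarrow> real) \<Rightarrow> real \<Rightarrow> (real \<Rightarrow> real) \<Rightarrow> ('s \<Rightarrow> real) \<Rightarrow> bool" where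
  "is_W_integral M W t f X \<longleftrightarrow> X \<in> borel_measurable M \<and> conv_in_prob M (W_sum W t f) X"

text \<open>
  $\int_0^t W(ds, x + B_s)$ as a random variable on the product space. For each path of $B$ the
  integral is a limit in probability, hence determined only up to a null set depending on the path;
  to be integrated over the paths, these versions must be selected jointly measurably. Any two
  such selections agree almost everywhere on the product space, so the choice made by
  \<open>SOME\<close> changes \<open>u_lim\<close> below only on a null set.
\<close>

definition W_integral_BM ::
  "'s measure \<Rightarrow> 'w measure \<Rightarrow> (real \<Rightarrow> real \<Rightarrow> 's \<Rightarrow> real) \<Rightarrow> (real \<Rightarrow> 'w \<Rightarrow> real) \<Rightarrow>
   real \<Rightarrow> real \<Rightarrow> 's \<times> 'w \<Rightarrow> real" where
  "W_integral_BM M Om W B t x =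
     (SOME J. J \<in> borel_measurable (M \<Otimes>\<^sub>M Om) \<and>
        (AE w in Om. is_W_integral M W t (\<lambda>r. x + B r w) (\<lambda>s. J (s, w))))"

definition u_lim ::
  "'s measure \<Rightarrow> 'w measure \<Rightarrow> (real \<Rightarrow> real \<Rightarrow> 's \<Rightarrow> real) \<Rightarrow> (real \<Rightarrow> 'w \<Rightarrow> real) \<Rightarrow> (real \<Rightarrow> real) \<Rightarrow>
   real \<Rightarrow> real \<Rightarrow> 's \<Rightarrow> real" where
  "u_lim M Om W B g t x s =
     (\<integral>w. g (x + B t w) * exp (W_integral_BM M Om W B t x (s, w)) \<partial>Om)"

end

theory Submission
  imports Defs "HOL-Real_Asymp.Real_Asymp"
begin

text \<open>
  Condition on the Brownian path. For fixed paths \<open>B^1, ..., B^N\<close> the exponents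
  \<open>\<epsilon>\<^sup>-\<^sup>1\<^sup>/\<^sup>2 \<integral>\<^sub>0\<^sup>t c(s/\<epsilon>, x + B^i\<^sub>s) ds\<close> are normalised integrals over the long
  time interval \<open>[0, t/\<epsilon>]\<close> of bounded centred random variables that are uniformly mixing in time, so
  Bernstein's method of big blocks separated by gaps gives a central limit theorem, with limiting
  covariances \<open>\<integral>\<^sub>0\<^sup>t R(B^i\<^sub>s - B^j\<^sub>s) ds\<close>, which are those of \<open>\<integral>\<^sub>0\<^sup>t W(ds, x + B^i\<^sub>s)\<close>. The same
  blocks bound exponential moments uniformly in the paths and in \<open>\<epsilon>\<close>. The exponential in the
  Feynman-Kac formula can therefore be replaced, up to a small error in mean, by a bounded
  trigonometric polynomial; by Fubini, the \<open>N\<close>-th moment of the resulting bounded Feynman-Kac average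
  is an average over \<open>N\<close> Brownian paths of joint characteristic functions, which converge by the
  central limit theorem. Bounded random variables with convergent moments converge in law.
\<close>

section \<open>Covariances under uniform mixing\<close>

text \<open>The limit is an average of log-normal variables. Its moments may grow like exp(c N^2)
  and need not determine its law, so moments are taken only after the exponential has been replaced
  by a bounded function. Trigonometric polynomials are the right bounded class: products of them,
  along several paths, expand into exponentials of linear combinations of path integrals, so that a
  scalar central limit theorem suffices.

  The shape of the mixing hypothesis matters. Since it divides by the probability of the
  conditioning event, separating a past variable U from the future costs a multiple of E|U| and not
  of sup|U|. In a product of many block exponentials the errors then multiply along with the factors
  and the exponential moments stay bounded; the suprema of such products grow exponentially with the
  number of blocks.

  The decay exponent is at least 3. A cubic rate leaves covariances with total mass of order
  (1+g)^-2 beyond a gap g, and it allows about T^0.6 blocks to be decoupled by gaps of length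
  T^0.3.\<close>

lemma discretise_error:
  fixes u :: real
  assumes "0 \<le> u" "u \<le> 1" "0 < n"
  shows "\<bar>u - (\<Sum>k=1..n. of_bool (real k / n \<le> u)) / real n\<bar> \<le> 1 / real n"
proof -
  \<comment> \<open>Exactly floor(n u) grid levels lie at or below u. Averages of indicators of
    level sets thus approximate a function within 1/n, which turns bounds on events into bounds on
    expectations.\<close>
  have "{k\<in>{1..n}. real k / n \<le> u} = {1..nat \<lfloor>real n * u\<rfloor>}"
  proof (intro set_eqI iffI)
    fix k assume "k \<in> {k\<in>{1..n}. real k / n \<le> u}"
    then show "k \<in> {1..nat \<lfloor>real n * u\<rfloor>}"
      using assms by (auto simp: field_simps le_nat_floor)
  next
    fix k assume k: "k \<in> {1..nat \<lfloor>real n * u\<rfloor>}"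
    then have "real k \<le> real n * u"
      using assms by (auto simp: le_nat_iff le_floor_iff)
    moreover have "real n * u \<le> n" using assms by (simp add: mult_left_le)
    ultimately have "k \<le> n" by linarith
    with \<open>real k \<le> real n * u\<close> show "k \<in> {k\<in>{1..n}. real k / n \<le> u}"
      using k assms by (auto simp: field_simps)
  qed
  then have "(\<Sum>k=1..n. of_bool (real k / n \<le> u)) = real (nat \<lfloor>real n * u\<rfloor>)"
    by (simp add: sum_of_bool_eq Int_def)
  moreover have "\<bar>real n * u - real (nat \<lfloor>real n * u\<rfloor>)\<bar> \<le> 1"
    using assms by (simp add: of_nat_nat) linarith
  moreover have "\<bar>u - real (nat \<lfloor>real n * u\<rfloor>) / real n\<bar> = \<bar>real n * u - real (nat \<lfloor>real n * u\<rfloor>)\<bar> / n"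
    using assms(3) by (simp add: field_simps flip: abs_of_pos)
  ultimately show ?thesis using assms(3) by (simp add: divide_right_mono)
qed

context prob_space
begin

text \<open>The inequality |P(T|S) - P(T)| \<le> \<phi> multiplied by P(S), which avoids division
  and covers null events. The factor \<open>prob S\<close> makes the notion asymmetric:
  \<open>F1\<close> carries the conditioning events, here always the past.\<close>

definition mixing_le :: "'a measure \<Rightarrow> 'a measure \<Rightarrow> real \<Rightarrow> bool" where
  "mixing_le F1 F2 \<phi> \<longleftrightarrow> subalgebra M F1 \<and> subalgebra M F2 \<and> 0 \<le> \<phi> \<and>
     (\<forall>S\<in>sets F1. \<forall>T\<in>sets F2. \<bar>prob (S \<inter> T) - prob S * prob T\<bar> \<le> \<phi> * prob S)"

text \<open>Layer-cake argument: both functions are averages of indicators of their upper level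
  sets, and the bound on pairs of events sums to \<phi> times the average of the probabilities of
  the level sets of U, which is again an expectation of U.\<close>

lemma covariance_unit:
  assumes mix: "mixing_le F1 F2 \<phi>"
    and U[measurable]: "U \<in> borel_measurable F1" and V[measurable]: "V \<in> borel_measurable F2"
    and U01: "\<And>s. s \<in> space M \<Longrightarrow> 0 \<le> U s \<and> U s \<le> 1"
    and V01: "\<And>s. s \<in> space M \<Longrightarrow> 0 \<le> V s \<and> V s \<le> 1"
  shows "\<bar>expectation (\<lambda>s. U s * V s) - expectation U * expectation V\<bar> \<le> \<phi> * expectation U"
proof -
  have sub: "subalgebra M F1" "subalgebra M F2" using mix by (auto simp: mixing_le_def)
  have [measurable]: "U \<in> borel_measurable M" "V \<in> borel_measurable M"
    using sub U V by (auto intro: measurable_from_subalg)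
  have sp: "space F1 = space M" "space F2 = space M" using sub by (auto simp: subalgebra_def)
  define A where "A n k = {s\<in>space M. real k / real n \<le> U s}" for n k :: nat
  define B where "B n k = {s\<in>space M. real k / real n \<le> V s}" for n k :: nat
  have A: "A n k \<in> sets F1" for n k
    unfolding A_def sp(1)[symmetric] by measurable
  have B: "B n k \<in> sets F2" for n k
    unfolding B_def sp(2)[symmetric] by measurable
  have [measurable]: "A n k \<in> sets M" "B n k \<in> sets M" for n k
    using A B sub by (auto simp: subalgebra_def)
  define Uq where "Uq n s = (\<Sum>k=1..n. indicator (A n k) s) / real n" for n s
  define Vq where "Vq n s = (\<Sum>k=1..n. indicator (B n k) s) / real n" for n s
  \<comment> \<open>Quantisation errors: 2/n from the expected product, 2/n from the product of
    expectations, and \<phi>/n from returning to the expectation of \<open>U\<close> on the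
    right-hand side.\<close>
  have bnd: "\<bar>expectation (\<lambda>s. U s * V s) - expectation U * expectation V\<bar>
      \<le> \<phi> * expectation U + (4 + \<phi>) * (1 / real n)" if n: "0 < n" for n
  proof -
    have dU: "\<bar>U s - Uq n s\<bar> \<le> 1 / n" if "s \<in> space M" for s
      using discretise_error[of "U s" n] U01[OF that] n that by (simp add: Uq_def A_def indicator_def of_bool_def)
    have dV: "\<bar>V s - Vq n s\<bar> \<le> 1 / n" if "s \<in> space M" for s
      using discretise_error[of "V s" n] V01[OF that] n that by (simp add: Vq_def B_def indicator_def of_bool_def)
    have Un01: "0 \<le> Uq n s" "Uq n s \<le> 1" and Vn01: "0 \<le> Vq n s" "Vq n s \<le> 1" for s
    proof -
      have "(\<Sum>k=1..n. indicator (A n k) s) \<le> (\<Sum>k=1..n. 1::real)"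
        "(\<Sum>k=1..n. indicator (B n k) s) \<le> (\<Sum>k=1..n. 1::real)"
        by (intro sum_mono; simp add: indicator_def)+
      then show "Uq n s \<le> 1" "Vq n s \<le> 1" using n by (auto simp: Uq_def Vq_def divide_simps)
    qed (auto simp: Uq_def Vq_def sum_nonneg)
    have [measurable]: "Uq n \<in> borel_measurable M" "Vq n \<in> borel_measurable M"
      unfolding Uq_def[abs_def] Vq_def[abs_def] by measurable
    have iU: "integrable M U" "integrable M V" "integrable M (Uq n)" "integrable M (Vq n)"
      using U01 V01 Un01 Vn01 by (auto intro!: integrable_const_bound[where B=1])
    have iUV: "integrable M (\<lambda>s. U s * V s)" "integrable M (\<lambda>s. Uq n s * Vq n s)"
      using U01 V01 Un01 Vn01 by (auto intro!: integrable_const_bound[where B=1] simp: abs_mult mult_le_one)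
    have EU: "expectation (Uq n) = (\<Sum>k=1..n. prob (A n k)) / n"
      unfolding Uq_def[abs_def]
      by (simp add: Bochner_Integration.integral_sum integrable_real_indicator emeasure_eq_measure)
    have EV: "expectation (Vq n) = (\<Sum>k=1..n. prob (B n k)) / n"
      unfolding Vq_def[abs_def]
      by (simp add: Bochner_Integration.integral_sum integrable_real_indicator emeasure_eq_measure)
    have "Uq n s * Vq n s = (\<Sum>k=1..n. \<Sum>l=1..n. indicator (A n k \<inter> B n l) s) / (real n * real n)" for s
      unfolding Uq_def Vq_def by (simp add: sum_product indicator_inter_arith)
    then have EUV: "expectation (\<lambda>s. Uq n s * Vq n s) = (\<Sum>k=1..n. \<Sum>l=1..n. prob (A n k \<inter> B n l)) / (real n * real n)"
      by (simp add: Bochner_Integration.integral_sum Bochner_Integration.integrable_sum integrable_real_indicator emeasure_eq_measure)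
    have "\<bar>expectation (\<lambda>s. Uq n s * Vq n s) - expectation (Uq n) * expectation (Vq n)\<bar>
       = \<bar>\<Sum>k=1..n. \<Sum>l=1..n. prob (A n k \<inter> B n l) - prob (A n k) * prob (B n l)\<bar> / (real n * real n)"
      unfolding EU EV EUV by (simp add: sum_product sum_subtractf abs_divide flip: diff_divide_distrib)
    also have "\<dots> \<le> (\<Sum>k=1..n. \<Sum>l=1..n. \<phi> * prob (A n k)) / (real n * real n)"
      using mix A B by (intro divide_right_mono order_trans[OF sum_abs] sum_mono) (auto simp: mixing_le_def)
    also have "\<dots> = \<phi> * expectation (Uq n)"
      using n by (simp add: EU sum_distrib_left field_simps)
    finally have 1: "\<bar>expectation (\<lambda>s. Uq n s * Vq n s) - expectation (Uq n) * expectation (Vq n)\<bar> \<le> \<phi> * expectation (Uq n)" .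
    have cm: "\<bar>expectation f - expectation h\<bar> \<le> b"
      if "integrable M f" "integrable M h" "\<And>s. s \<in> space M \<Longrightarrow> \<bar>f s - h s\<bar> \<le> b" for f h :: "'a \<Rightarrow> real" and b
    proof -
      have "\<bar>expectation f - expectation h\<bar> = \<bar>expectation (\<lambda>s. f s - h s)\<bar>"
        using that by simp
      also have "\<dots> \<le> expectation (\<lambda>s. \<bar>f s - h s\<bar>)" by (rule integral_abs_bound)
      also have "\<dots> \<le> b" using that by (intro integral_le_const) (auto intro!: AE_I2)
      finally show ?thesis .
    qed
    have 2: "\<bar>expectation U - expectation (Uq n)\<bar> \<le> 1/n" by (rule cm) (use iU dU in auto)
    have 3: "\<bar>expectation V - expectation (Vq n)\<bar> \<le> 1/n" by (rule cm) (use iU dV in auto)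
    have 4: "\<bar>expectation (\<lambda>s. U s * V s) - expectation (\<lambda>s. Uq n s * Vq n s)\<bar> \<le> 2/n"
    proof (rule cm)
      fix s assume s: "s \<in> space M"
      have "\<bar>U s * V s - Uq n s * Vq n s\<bar> = \<bar>U s * (V s - Vq n s) + (U s - Uq n s) * Vq n s\<bar>"
        by (simp add: algebra_simps)
      also have "\<dots> \<le> 1 * (1/n) + (1/n) * 1"
        by (intro order_trans[OF abs_triangle_ineq] add_mono; unfold abs_mult; intro mult_mono)
           (use U01[OF s] Vn01 dU[OF s] dV[OF s] in auto)
      finally show "\<bar>U s * V s - Uq n s * Vq n s\<bar> \<le> 2 / n" by simp
    qed (use iUV in auto)
    have E01: "0 \<le> expectation U" "expectation U \<le> 1" "0 \<le> expectation (Vq n)" "expectation (Vq n) \<le> 1"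
      using U01 Vn01 iU by (auto intro!: integral_nonneg_AE integral_le_const AE_I2)
    have "\<bar>expectation U * expectation V - expectation (Uq n) * expectation (Vq n)\<bar>
      = \<bar>expectation U * (expectation V - expectation (Vq n)) + (expectation U - expectation (Uq n)) * expectation (Vq n)\<bar>"
      by (simp add: algebra_simps)
    also have "\<dots> \<le> 1 * (1/n) + (1/n) * 1"
      by (intro order_trans[OF abs_triangle_ineq] add_mono; unfold abs_mult; intro mult_mono)
         (use E01 2 3 in auto)
    finally have 5: "\<bar>expectation U * expectation V - expectation (Uq n) * expectation (Vq n)\<bar> \<le> 2/n" by simp
    have "\<phi> * expectation (Uq n) \<le> \<phi> * (expectation U + 1/n)"
      using 2 mix by (intro mult_left_mono) (auto simp: mixing_le_def)
    then have "\<phi> * expectation (Uq n) \<le> \<phi> * expectation U + \<phi> * (1/n)" by (simp add: algebra_simps)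
    moreover have "(4 + \<phi>) * (1/n) = 2/n + 2/n + \<phi> * (1/n)" by (simp add: add_divide_distrib)
    ultimately show ?thesis using 1 4 5 by linarith
  qed
  have "(\<lambda>n. \<phi> * expectation U + (4 + \<phi>) * (1 / real n)) \<longlonglongrightarrow> \<phi> * expectation U + (4 + \<phi>) * 0"
    by (intro tendsto_intros lim_1_over_n)
  then show ?thesis
    by (intro tendsto_lowerbound[of _ _ sequentially])
       (use bnd in \<open>auto intro!: eventually_sequentiallyI[of 1]\<close>)
qed

text \<open>The sigma-algebras generated by the field are not completed, while time integrals of the
  field are measurable with respect to them only up to a null set. Covariance bounds do not notice
  the difference.\<close>

definition ae_measurable :: "'a measure \<Rightarrow> ('a \<Rightarrow> 'c::topological_space) \<Rightarrow> bool" where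
  "ae_measurable F U \<longleftrightarrow> (\<exists>U'\<in>borel_measurable F. AE s in M. U s = U' s)"

lemma ae_measurableI: "U \<in> borel_measurable F \<Longrightarrow> ae_measurable F U"
  by (auto simp: ae_measurable_def)

lemma ae_measurable_compose:
  "ae_measurable F U \<Longrightarrow> f \<in> borel_measurable borel \<Longrightarrow> ae_measurable F (\<lambda>s. f (U s))"
  unfolding ae_measurable_def by (auto intro!: bexI[of _ "\<lambda>s. f (_ s)"])

lemma ae_measurable_prod:
  fixes U :: "'i \<Rightarrow> 'a \<Rightarrow> 'c::{second_countable_topology, real_normed_field}"
  assumes "finite I" "\<And>i. i \<in> I \<Longrightarrow> ae_measurable F (U i)"
  shows "ae_measurable F (\<lambda>s. \<Prod>i\<in>I. U i s)"
proof -
  have "\<forall>i\<in>I. \<exists>U'\<in>borel_measurable F. AE s in M. U i s = U' s"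
    using assms by (auto simp: ae_measurable_def)
  then obtain V where V: "\<And>i. i \<in> I \<Longrightarrow> V i \<in> borel_measurable F" "\<And>i. i \<in> I \<Longrightarrow> AE s in M. U i s = V i s"
    by metis
  have "AE s in M. \<forall>i\<in>I. U i s = V i s" using V assms(1) by (simp add: AE_finite_all)
  then have "AE s in M. (\<Prod>i\<in>I. U i s) = (\<Prod>i\<in>I. V i s)"
    by eventually_elim (auto intro: prod.cong)
  then show ?thesis using V(1) unfolding ae_measurable_def
    by (intro bexI[of _ "\<lambda>s. \<Prod>i\<in>I. V i s"]) auto
qed

text \<open>\<open>U\<close> is split into its positive and negative part, so that the two error
  terms add up to a multiple of E|U|. \<open>V\<close> is mapped affinely onto [0,1]; the slope of
  the inverse map gives the factor 2 b and its shift cancels in the covariance. The bound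
  \<open>b'\<close> serves for scaling and integrability and is absent from the result.\<close>

lemma covariance_real:
  assumes mix: "mixing_le F1 F2 \<phi>" and "0 \<le> b" "0 \<le> b'"
    and U: "ae_measurable F1 U" "U \<in> borel_measurable M" "AE s in M. \<bar>U s\<bar> \<le> b'"
    and V: "ae_measurable F2 V" "V \<in> borel_measurable M" "AE s in M. \<bar>V s\<bar> \<le> b"
  shows "\<bar>expectation (\<lambda>s. U s * V s) - expectation U * expectation V\<bar> \<le> 2 * b * \<phi> * expectation (\<lambda>s. \<bar>U s\<bar>)"
proof -
  note [measurable] = U(2) V(2)
  have sub: "subalgebra M F1" "subalgebra M F2" using mix by (auto simp: mixing_le_def)
  obtain U1 where [measurable]: "U1 \<in> borel_measurable F1" and U1: "AE s in M. U s = U1 s"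
    using U by (auto simp: ae_measurable_def)
  obtain V1 where [measurable]: "V1 \<in> borel_measurable F2" and V1: "AE s in M. V s = V1 s"
    using V by (auto simp: ae_measurable_def)
  have [measurable]: "U1 \<in> borel_measurable M" "V1 \<in> borel_measurable M"
    using sub by (auto intro: measurable_from_subalg)
  define d where "d = b + 1"
  \<comment> \<open>A scale that stays positive when \<open>b' = 0\<close>; it cancels at the
    end.\<close>
  define d' where "d' = b' + 1"
  have d: "0 < d" "0 < d'" using assms by (auto simp: d_def d'_def)
  \<comment> \<open>The bounds on \<open>U\<close> and \<open>V\<close> hold almost surely, those of
    \<open>covariance_unit\<close> everywhere. Clamping the versions changes them on a null
    set.\<close>
  define Up where "Up s = min 1 (max 0 (U1 s) / d')" for s
  define Um where "Um s = min 1 (max 0 (- U1 s) / d')" for s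
  \<comment> \<open>Working with \<open>e\<close> above \<open>b\<close> allows division even for
    \<open>b = 0\<close>; afterwards \<open>e\<close> decreases to \<open>b\<close>.\<close>
  have core: "\<bar>expectation (\<lambda>s. U s * V s) - expectation U * expectation V\<bar> \<le> 2 * e * \<phi> * expectation (\<lambda>s. \<bar>U s\<bar>)"
    if e: "b < e" for e
  proof -
    have e0: "0 < e" using e assms by simp
    define V' where "V' s = max 0 (min 1 ((V1 s / e + 1) / 2))" for s
    have m[measurable]: "Up \<in> borel_measurable F1" "Um \<in> borel_measurable F1" "V' \<in> borel_measurable F2"
      unfolding Up_def[abs_def] Um_def[abs_def] V'_def[abs_def] by measurable
    have [measurable]: "Up \<in> borel_measurable M" "Um \<in> borel_measurable M" "V' \<in> borel_measurable M"
      using m sub by (auto intro: measurable_from_subalg)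
    have cp: "\<bar>expectation (\<lambda>s. Up s * V' s) - expectation Up * expectation V'\<bar> \<le> \<phi> * expectation Up"
      by (rule covariance_unit[OF mix]) (use d in \<open>auto simp: Up_def V'_def\<close>)
    have cm: "\<bar>expectation (\<lambda>s. Um s * V' s) - expectation Um * expectation V'\<bar> \<le> \<phi> * expectation Um"
      by (rule covariance_unit[OF mix]) (use d in \<open>auto simp: Um_def V'_def\<close>)
    have i: "integrable M Up" "integrable M Um" "integrable M V'" "integrable M (\<lambda>s. Up s * V' s)" "integrable M (\<lambda>s. Um s * V' s)"
      using d by (auto intro!: integrable_const_bound[where B=1] AE_I2 simp: abs_mult Up_def Um_def V'_def mult_le_one)
    have eU: "AE s in M. U s = d' * (Up s - Um s)" "AE s in M. \<bar>U s\<bar> = d' * (Up s + Um s)"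
    proof -
      have *: "u = d' * (min 1 (max 0 u / d') - min 1 (max 0 (- u) / d')) \<and>
          \<bar>u\<bar> = d' * (min 1 (max 0 u / d') + min 1 (max 0 (- u) / d'))" if "\<bar>u\<bar> \<le> b'" for u
      proof -
        have "max 0 u / d' \<le> 1" "max 0 (- u) / d' \<le> 1" using that d by (auto simp: d'_def)
        then have "min 1 (max 0 u / d') = max 0 u / d'" "min 1 (max 0 (- u) / d') = max 0 (- u) / d'" by auto
        then show ?thesis using d by (auto simp: right_diff_distrib distrib_left)
      qed
      show "AE s in M. U s = d' * (Up s - Um s)"
        using U1 U(3) by eventually_elim (use * in \<open>simp add: Up_def Um_def\<close>)
      show "AE s in M. \<bar>U s\<bar> = d' * (Up s + Um s)"
        using U1 U(3) by eventually_elim (use * in \<open>simp add: Up_def Um_def\<close>)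
    qed
    have eV: "AE s in M. V s = 2 * e * V' s - e"
      using V1 V(3) 
    proof eventually_elim
      case (elim s)
      have "\<bar>V1 s / e\<bar> \<le> 1" using elim e e0 by (auto simp: abs_if field_simps split: if_splits)
      then have "-1 \<le> V1 s / e" "V1 s / e \<le> 1" by (simp_all only: abs_le_iff) linarith
      then have "V' s = (V1 s / e + 1) / 2" unfolding V'_def by (auto simp: min_def max_def field_simps)
      then show ?case using elim e0 by (simp add: field_simps)
    qed
    have "AE s in M. U s * V s = d' * (2 * e * (Up s * V' s - Um s * V' s) - e * (Up s - Um s))"
      using eU(1) eV by eventually_elim (simp only:, simp add: algebra_simps)
    then have "expectation (\<lambda>s. U s * V s) = expectation (\<lambda>s. d' * (2 * e * (Up s * V' s - Um s * V' s) - e * (Up s - Um s)))"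
      by (intro integral_cong_AE) auto
    also have "\<dots> = d' * (2 * e * (expectation (\<lambda>s. Up s * V' s) - expectation (\<lambda>s. Um s * V' s)) - e * (expectation Up - expectation Um))"
      using i by simp
    finally have 1: "expectation (\<lambda>s. U s * V s) = \<dots>" .
    have "expectation U = expectation (\<lambda>s. d' * (Up s - Um s))"
      using eU(1) by (intro integral_cong_AE) auto
    then have 2: "expectation U = d' * (expectation Up - expectation Um)" using i by simp
    have "expectation (\<lambda>s. \<bar>U s\<bar>) = expectation (\<lambda>s. d' * (Up s + Um s))"
      using eU(2) by (intro integral_cong_AE) auto
    then have 3: "expectation (\<lambda>s. \<bar>U s\<bar>) = d' * (expectation Up + expectation Um)" using i by simp
    have "expectation V = expectation (\<lambda>s. 2 * e * V' s - e)"
      using eV by (intro integral_cong_AE) auto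
    then have 4: "expectation V = 2 * e * expectation V' - e" using i by (simp add: prob_space)
    have "expectation (\<lambda>s. U s * V s) - expectation U * expectation V =
      2 * e * d' * ((expectation (\<lambda>s. Up s * V' s) - expectation Up * expectation V') - (expectation (\<lambda>s. Um s * V' s) - expectation Um * expectation V'))"
      unfolding 1 2 4 by (simp add: algebra_simps)
    also have "\<bar>\<dots>\<bar> \<le> 2 * e * d' * (\<phi> * expectation Up + \<phi> * expectation Um)"
      unfolding abs_mult using d e0 cp cm by (intro mult_mono) auto
    also have "\<dots> = 2 * e * \<phi> * expectation (\<lambda>s. \<bar>U s\<bar>)" unfolding 3 by (simp add: algebra_simps)
    finally show ?thesis .
  qed
  have "((\<lambda>e. 2 * e * \<phi> * expectation (\<lambda>s. \<bar>U s\<bar>)) \<longlongrightarrow> 2 * b * \<phi> * expectation (\<lambda>s. \<bar>U s\<bar>)) (at_right b)"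
    by (intro tendsto_intros)
  then show ?thesis
    by (intro tendsto_lowerbound[of _ _ "at_right b"]) (use core in \<open>auto simp: eventually_at_filter\<close>)
qed

text \<open>Real and imaginary parts give four real covariances, each at most 2 \<phi>. Two of them
  enter the real part of the difference and two the imaginary part, whence 8 \<phi>.\<close>

lemma covariance_complex:
  fixes U V :: "'a \<Rightarrow> complex"
  assumes mix: "mixing_le F1 F2 \<phi>"
    and U: "ae_measurable F1 U" "U \<in> borel_measurable M" "AE s in M. norm (U s) \<le> 1"
    and V: "ae_measurable F2 V" "V \<in> borel_measurable M" "AE s in M. norm (V s) \<le> 1"
  shows "norm (expectation (\<lambda>s. U s * V s) - expectation U * expectation V) \<le> 8 * \<phi>"
proof -
  note [measurable] = U(2) V(2)
  have \<phi>: "0 \<le> \<phi>" using mix by (simp add: mixing_le_def)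
  have c: "\<bar>expectation (\<lambda>s. u (U s) * v (V s)) - expectation (\<lambda>s. u (U s)) * expectation (\<lambda>s. v (V s))\<bar> \<le> 2 * \<phi>"
    if u: "u = Re \<or> u = Im" and v: "v = Re \<or> v = Im" for u v
  proof -
    have [measurable]: "u \<in> borel_measurable borel" "v \<in> borel_measurable borel" using u v by auto
    have b: "AE s in M. \<bar>u (U s)\<bar> \<le> 1"
      using U(3) by eventually_elim (use u in \<open>auto intro: order_trans[OF abs_Re_le_cmod] order_trans[OF abs_Im_le_cmod]\<close>)
    have b': "AE s in M. \<bar>v (V s)\<bar> \<le> 1"
      using V(3) by eventually_elim (use v in \<open>auto intro: order_trans[OF abs_Re_le_cmod] order_trans[OF abs_Im_le_cmod]\<close>)
    have "\<bar>expectation (\<lambda>s. u (U s) * v (V s)) - expectation (\<lambda>s. u (U s)) * expectation (\<lambda>s. v (V s))\<bar>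
       \<le> 2 * 1 * \<phi> * expectation (\<lambda>s. \<bar>u (U s)\<bar>)"
      by (rule covariance_real[OF mix, of 1 1 "\<lambda>s. u (U s)" "\<lambda>s. v (V s)"])
         (use b b' ae_measurable_compose[OF U(1), of u] ae_measurable_compose[OF V(1), of v] in simp_all)
    also have "\<dots> \<le> 2 * 1 * \<phi> * 1"
      using b \<phi> by (intro mult_left_mono integral_le_const integrable_const_bound[where B=1]) auto
    finally show ?thesis by simp
  qed
  have i: "integrable M U" "integrable M V" using U V by (auto intro!: integrable_const_bound[where B=1])
  have prod: "integrable M (\<lambda>s. f s * h s)"
    if "f \<in> borel_measurable M" "h \<in> borel_measurable M" "AE s in M. norm (f s) \<le> 1" "AE s in M. norm (h s) \<le> 1"
    for f h :: "'a \<Rightarrow> 'd::{second_countable_topology, banach, real_normed_algebra}"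
  proof (rule integrable_const_bound[where B=1])
    show "AE s in M. norm (f s * h s) \<le> 1"
      using that(3,4)
    proof eventually_elim
      case (elim s)
      have "norm (f s * h s) \<le> norm (f s) * norm (h s)" by (rule norm_mult_ineq)
      also have "\<dots> \<le> 1" using elim by (simp add: mult_le_one)
      finally show ?case .
    qed
  qed (use that in auto)
  have iUV: "integrable M (\<lambda>s. U s * V s)" by (rule prod[OF U(2) V(2) U(3) V(3)])
  have b: "AE s in M. norm (Re (U s)) \<le> 1" "AE s in M. norm (Im (U s)) \<le> 1" 
    "AE s in M. norm (Re (V s)) \<le> 1" "AE s in M. norm (Im (V s)) \<le> 1"
    using U(3) V(3)
    by (eventually_elim, simp add: order_trans[OF abs_Re_le_cmod] order_trans[OF abs_Im_le_cmod])+
  have iRI: "integrable M (\<lambda>s. Re (U s) * Re (V s))" "integrable M (\<lambda>s. Im (U s) * Im (V s))"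
    "integrable M (\<lambda>s. Re (U s) * Im (V s))" "integrable M (\<lambda>s. Im (U s) * Re (V s))"
    by (intro prod b; measurable)+
  let ?D = "expectation (\<lambda>s. U s * V s) - expectation U * expectation V"
  have ReD: "Re ?D = (expectation (\<lambda>s. Re (U s) * Re (V s)) - expectation (\<lambda>s. Re (U s)) * expectation (\<lambda>s. Re (V s)))
     - (expectation (\<lambda>s. Im (U s) * Im (V s)) - expectation (\<lambda>s. Im (U s)) * expectation (\<lambda>s. Im (V s)))"
    using i iUV iRI by (simp flip: integral_Re integral_Im)
  have ImD: "Im ?D = (expectation (\<lambda>s. Re (U s) * Im (V s)) - expectation (\<lambda>s. Re (U s)) * expectation (\<lambda>s. Im (V s)))
     + (expectation (\<lambda>s. Im (U s) * Re (V s)) - expectation (\<lambda>s. Im (U s)) * expectation (\<lambda>s. Re (V s)))"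
    using i iUV iRI by (simp flip: integral_Re integral_Im)
  have "\<bar>Re ?D\<bar> \<le> 4 * \<phi>" unfolding ReD using c[of Re Re] c[of Im Im] by auto
  moreover have "\<bar>Im ?D\<bar> \<le> 4 * \<phi>" unfolding ImD using c[of Re Im] c[of Im Re] by auto
  ultimately show ?thesis using cmod_le[of ?D] by linarith
qed

end

section \<open>Integrals of a mixing process\<close>

lemma abs_integral_le:
  fixes f g :: "'a \<Rightarrow> real"
  assumes "integrable M g" "\<And>x. x \<in> space M \<Longrightarrow> \<bar>f x\<bar> \<le> g x"
  shows "\<bar>\<integral>x. f x \<partial>M\<bar> \<le> (\<integral>x. g x \<partial>M)"
proof -
  have "\<bar>\<integral>x. f x \<partial>M\<bar> \<le> (\<integral>x. \<bar>f x\<bar> \<partial>M)" by (rule integral_abs_bound)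
  also have "\<dots> \<le> (\<integral>x. g x \<partial>M)"
    using assms by (intro integral_mono') (auto intro: order_trans[OF abs_ge_zero])
  finally show ?thesis .
qed

text \<open>Each half-line contributes 1/(2 (1+g)^2). This is how the cubic mixing rate becomes the
  quadratic gap term in the variance estimates; at g = 0 the total mass is 1.\<close>

lemma integrable_tail_cube:
  fixes g :: real
  assumes "0 \<le> g"
  shows "integrable lborel (\<lambda>u. indicator {u. g \<le> \<bar>u\<bar>} u / (1 + \<bar>u\<bar>) ^ 3 :: real)"
    and "(\<integral>u. indicator {u. g \<le> \<bar>u\<bar>} u / (1 + \<bar>u\<bar>) ^ 3 \<partial>lborel) = 1 / (1 + g) ^ 2"
proof -
  let ?f = "\<lambda>u::real. indicator {g..} u / (1 + \<bar>u\<bar>) ^ 3 :: real"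
  have m[measurable]: "?f \<in> borel_measurable lborel" by measurable
  have "(\<integral>\<^sup>+u. ennreal (1 / (1 + \<bar>u\<bar>) ^ 3) * indicator {g..} u \<partial>lborel) = ennreal (0 - (- (1 / (2 * (1 + g)\<^sup>2))))"
  proof (rule nn_integral_FTC_atLeast[where F = "\<lambda>u. - (1 / (2 * (1 + u)\<^sup>2))"])
    fix u assume "g \<le> u"
    then have "0 \<le> u" using assms by simp
    then show "((\<lambda>u. - (1 / (2 * (1 + u)\<^sup>2))) has_real_derivative 1 / (1 + \<bar>u\<bar>) ^ 3) (at u)"
      by (auto intro!: derivative_eq_intros simp: power2_eq_square power3_eq_cube divide_simps)
  next
    show "((\<lambda>u::real. - (1 / (2 * (1 + u)\<^sup>2))) \<longlongrightarrow> 0) at_top" by real_asymp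
  qed auto
  also have "(\<integral>\<^sup>+u. ennreal (1 / (1 + \<bar>u\<bar>) ^ 3) * indicator {g..} u \<partial>lborel) = (\<integral>\<^sup>+u. ennreal (?f u) \<partial>lborel)"
    by (intro nn_integral_cong) (auto simp: indicator_def)
  finally have nn: "(\<integral>\<^sup>+u. ennreal (?f u) \<partial>lborel) = ennreal (1 / (2 * (1 + g)\<^sup>2))" by simp
  have hb: "has_bochner_integral lborel ?f (1 / (2 * (1 + g)\<^sup>2))"
    by (rule has_bochner_integral_nn_integral) (use nn assms in auto)
  have hb': "has_bochner_integral lborel (\<lambda>u. ?f (- u)) (1 / (2 * (1 + g)\<^sup>2))"
    using lborel_has_bochner_integral_real_affine_iff[of "-1" ?f _ 0] hb by simp
  have sum: "has_bochner_integral lborel (\<lambda>u. ?f u + ?f (- u)) (1 / (1 + g)\<^sup>2)"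
    using has_bochner_integral_add[OF hb hb'] by (simp add: field_simps)
  \<comment> \<open>For g = 0 both half-lines contain the origin, which would be counted
    twice.\<close>
  have "AE u in lborel. u \<noteq> (0::real)" by (rule AE_lborel_singleton)
  then have "AE u in lborel. ?f u + ?f (- u) = indicator {u. g \<le> \<bar>u\<bar>} u / (1 + \<bar>u\<bar>) ^ 3"
  proof eventually_elim
    case (elim u)
    then show ?case using assms by (auto simp: indicator_def abs_if)
  qed
  then have "has_bochner_integral lborel (\<lambda>u. indicator {u. g \<le> \<bar>u\<bar>} u / (1 + \<bar>u\<bar>) ^ 3 :: real) (1 / (1 + g)\<^sup>2)"
    using sum has_bochner_integral_cong_AE[of "\<lambda>u. ?f u + ?f (- u)" lborel "\<lambda>u. indicator {u. g \<le> \<bar>u\<bar>} u / (1 + \<bar>u\<bar>) ^ 3"] by simp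
  then show "integrable lborel (\<lambda>u. indicator {u. g \<le> \<bar>u\<bar>} u / (1 + \<bar>u\<bar>) ^ 3 :: real)"
    "(\<integral>u. indicator {u. g \<le> \<bar>u\<bar>} u / (1 + \<bar>u\<bar>) ^ 3 \<partial>lborel) = 1 / (1 + g) ^ 2"
    by (auto simp: has_bochner_integral_iff)
qed

lemma (in prob_space) integrable_pair_bounded:
  fixes F :: "real \<times> 'a \<Rightarrow> 'c::{banach, second_countable_topology}"
  assumes F: "F \<in> borel_measurable (lborel \<Otimes>\<^sub>M M)"
    and b: "\<And>r s. s \<in> space M \<Longrightarrow> norm (F (r, s)) \<le> b * indicator {0..a} r"
  shows "integrable (lborel \<Otimes>\<^sub>M M) F"
proof -
  have "emeasure (lborel \<Otimes>\<^sub>M M) ({0..a} \<times> space M) = emeasure lborel {0..a} * emeasure M (space M)"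
    by (intro emeasure_pair_measure_Times) auto
  then have "emeasure (lborel \<Otimes>\<^sub>M M) ({0..a} \<times> space M) < \<infinity>"
    by (cases "0 \<le> a") (simp_all add: emeasure_space_1)
  then have "integrable (lborel \<Otimes>\<^sub>M M) (\<lambda>x. b * indicator ({0..a} \<times> space M) x :: real)"
    by (intro integrable_mult_right integrable_real_indicator) auto
  then show ?thesis
  proof (rule Bochner_Integration.integrable_bound[OF _ F])
    show "AE x in lborel \<Otimes>\<^sub>M M. norm (F x) \<le> norm (b * indicator ({0..a} \<times> space M) x :: real)"
    proof (rule AE_I2)
      fix x :: "real \<times> 'a" assume "x \<in> space (lborel \<Otimes>\<^sub>M M)"
      then obtain r s where x: "x = (r, s)" "s \<in> space M" by (auto simp: space_pair_measure)
      show "norm (F x) \<le> norm (b * indicator ({0..a} \<times> space M) x :: real)"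
        using b[OF x(2), of r] x by (auto simp: indicator_def split: if_splits)
    qed
  qed
qed

lemma norm_iexp_diff_le: "norm (iexp x - iexp y) \<le> \<bar>x - y\<bar>"
proof -
  have "iexp x - iexp y = iexp y * (iexp (x - y) - 1)"
    by (simp add: algebra_simps flip: exp_add)
  then have "norm (iexp x - iexp y) = norm (iexp (x - y) - 1)"
    by (simp add: norm_mult)
  also have "\<dots> \<le> \<bar>x - y\<bar>" using iexp_approx1[of "x - y" 0] by simp
  finally show ?thesis .
qed

lemma exp_neg_diff_le:
  fixes a b :: real
  assumes "0 \<le> a" "0 \<le> b"
  shows "\<bar>exp (- a) - exp (- b)\<bar> \<le> \<bar>a - b\<bar>"
proof -
  have *: "exp (- x) - exp (- y) \<le> y - x" "0 \<le> exp (- x) - exp (- y)" if "0 \<le> x" "x \<le> y" for x y :: real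
  proof -
    have "exp (- x) - exp (- y) = exp (- x) * (1 - exp (- (y - x)))"
      by (simp add: algebra_simps flip: exp_add)
    also have "\<dots> = exp (- x) * (1 - exp (x - y))" by simp
    also have "\<dots> \<le> 1 * (y - x)"
      
    proof (intro mult_mono)
      show "1 - exp (x - y) \<le> y - x" using exp_ge_add_one_self[of "x - y"] by linarith
    qed (use that in auto)
    finally show "exp (- x) - exp (- y) \<le> y - x" by simp
  qed (use that in auto)
  show ?thesis using *[of a b] *[of b a] assms by linarith
qed

lemma exp_neg_quadratic:
  fixes x :: real
  assumes "0 \<le> x"
  shows "\<bar>exp (- x) - (1 - x)\<bar> \<le> x\<^sup>2"
proof -
  have "exp (- x) \<le> 1 / (1 + x)"
    using exp_ge_add_one_self[of x] assms by (simp add: exp_minus field_simps)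
  also have "\<dots> \<le> 1 - x + x\<^sup>2"
  proof -
    \<comment> \<open>The product equals 1 + x^3.\<close>
    have "1 \<le> (1 - x + x\<^sup>2) * (1 + x)"
      using assms by (simp add: algebra_simps power2_eq_square)
    then show ?thesis using assms by (simp add: divide_le_eq)
  qed
  finally show ?thesis using exp_ge_add_one_self[of "- x"] by auto
qed

lemma (in prob_space) abs_expectation_le_sqrt:
  assumes "Z \<in> borel_measurable M" "integrable M (\<lambda>s. (Z s)\<^sup>2)"
  shows "expectation (\<lambda>s. \<bar>Z s\<bar>) \<le> sqrt (expectation (\<lambda>s. (Z s)\<^sup>2))"
proof -
  note [measurable] = assms(1)
  have i: "integrable M (\<lambda>s. \<bar>Z s\<bar>)"
  proof (rule Bochner_Integration.integrable_bound[where f = "\<lambda>s. 1 + (Z s)\<^sup>2"])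
    have "\<bar>z\<bar> \<le> 1 + z\<^sup>2" for z :: real
      using zero_le_power2[of "\<bar>z\<bar> - 1"] by (simp add: power2_eq_square algebra_simps abs_mult_self_eq)
    then show "AE s in M. norm \<bar>Z s\<bar> \<le> norm (1 + (Z s)\<^sup>2)" by (auto intro: order_trans[OF _ abs_ge_self])
  qed (use assms in auto)
  have "0 \<le> variance (\<lambda>s. \<bar>Z s\<bar>)" by (rule variance_positive)
  also have "\<dots> = expectation (\<lambda>s. (Z s)\<^sup>2) - (expectation (\<lambda>s. \<bar>Z s\<bar>))\<^sup>2"
    using i assms by (subst variance_eq) auto
  finally show ?thesis by (intro real_le_rsqrt) simp
qed

section \<open>Decoupling products over separated time blocks\<close>

lemma (in prob_space) mixing_le_mono: "mixing_le F1 F2 \<phi> \<Longrightarrow> \<phi> \<le> \<psi> \<Longrightarrow> mixing_le F1 F2 \<psi>"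
  unfolding mixing_le_def by (meson measure_nonneg mult_right_mono order_trans)

lemma (in prob_space) norm_expectation_le:
  fixes f :: "'a \<Rightarrow> 'c::{banach, second_countable_topology}"
  assumes "\<And>s. s \<in> space M \<Longrightarrow> norm (f s) \<le> b" "0 \<le> b"
  shows "norm (expectation f) \<le> b"
proof -
  have "norm (expectation f) \<le> expectation (\<lambda>s. norm (f s))" by (rule integral_norm_bound)
  also have "\<dots> \<le> expectation (\<lambda>s. b)" using assms by (intro integral_mono') auto
  finally show ?thesis by (simp add: prob_space)
qed

text \<open>\<open>P a\<close> stands for the past up to time a and \<open>Q b\<close> for the
  future from time b. The random field is left out, so that the block arguments see the time
  direction alone.\<close>

locale mixing_filtration = prob_space M for M :: "'s measure" +
  fixes P Q :: "real \<Rightarrow> 's measure" and C :: real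
  assumes C_nonneg: "0 \<le> C"
    and mix: "\<And>a b. 0 \<le> a \<Longrightarrow> a \<le> b \<Longrightarrow> mixing_le (P a) (Q b) (C / (1 + (b - a)) ^ 3)"
begin

lemma mix_gap:
  assumes "0 \<le> a" "0 \<le> g" "a + g \<le> b"
  shows "mixing_le (P a) (Q b) (C / (1 + g) ^ 3)"
  using assms C_nonneg by (intro mixing_le_mono[OF mix]) (auto intro!: divide_left_mono power_mono)

lemma subalgebras: "0 \<le> a \<Longrightarrow> subalgebra M (P a)" "0 \<le> a \<Longrightarrow> subalgebra M (Q a)"
  using mix[of a a] by (auto simp: mixing_le_def)

text \<open>\<open>a j\<close> is the end of block j and \<open>b j\<close> its beginning. The last
  block is split off by induction; since all factors have modulus at most 1, the costs 8 C/(1+g)^3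
  simply add up.\<close>

lemma decouple_iexp:
  fixes Y :: "nat \<Rightarrow> 's \<Rightarrow> real"
  assumes P: "\<And>j k. k \<le> j \<Longrightarrow> j < n \<Longrightarrow> ae_measurable (P (a j)) (Y k)"
    and Q: "\<And>j. j < n \<Longrightarrow> ae_measurable (Q (b j)) (Y j)"
    and ab: "\<And>j. j < n \<Longrightarrow> 0 \<le> a j" "\<And>j. Suc j < n \<Longrightarrow> a j + g \<le> b (Suc j)" and "0 \<le> g"
    and Y[measurable]: "\<And>j. j < n \<Longrightarrow> Y j \<in> borel_measurable M"
  shows "norm (expectation (\<lambda>s. \<Prod>j<n. iexp (Y j s)) - (\<Prod>j<n. expectation (\<lambda>s. iexp (Y j s)))) \<le> real n * (8 * (C / (1 + g) ^ 3))"
  using P Q ab Y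
proof (induction n)
  case 0
  then show ?case by (simp add: prob_space)
next
  case (Suc n)
  note [measurable] = Suc.prems(5)
  let ?p = "\<lambda>s. \<Prod>j<n. iexp (Y j s)"
  have IH: "norm (expectation ?p - (\<Prod>j<n. expectation (\<lambda>s. iexp (Y j s)))) \<le> real n * (8 * (C / (1 + g) ^ 3))"
    using Suc by auto
  have np: "norm (?p s) \<le> 1" for s by (auto simp: prod_norm[symmetric] intro!: prod_le_1)
  have nE: "norm (expectation (\<lambda>s. iexp (Y n s))) \<le> 1" by (rule norm_expectation_le) auto
  have "norm (expectation (\<lambda>s. ?p s * iexp (Y n s)) - expectation ?p * expectation (\<lambda>s. iexp (Y n s))) \<le> 8 * (C / (1 + g) ^ 3)"
  \<comment> \<open>A single block has no predecessor: the empty product is 1 and nothing is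
    decoupled. Otherwise the past is the one at the end of block n - 1.\<close>
  proof (cases n)
    case 0
    then show ?thesis using C_nonneg \<open>0 \<le> g\<close> by (simp add: prob_space)
  next
    case (Suc m)
    show ?thesis
    proof (rule covariance_complex[OF mix_gap[of "a m" g "b n"]])
      show "ae_measurable (P (a m)) ?p"
        using Suc.prems(1) Suc
        by (intro ae_measurable_prod ae_measurable_compose[where f = iexp]) auto
      show "ae_measurable (Q (b n)) (\<lambda>s. iexp (Y n s))"
        using Suc.prems(2) by (intro ae_measurable_compose[where f = iexp]) auto
      show "?p \<in> borel_measurable M" "(\<lambda>s. iexp (Y n s)) \<in> borel_measurable M"
        by (auto intro!: borel_measurable_prod)
    qed (use Suc.prems(3,4) Suc \<open>0 \<le> g\<close> np in auto)
  qed
  moreover have "norm (expectation ?p * expectation (\<lambda>s. iexp (Y n s)) - (\<Prod>j<n. expectation (\<lambda>s. iexp (Y j s))) * expectation (\<lambda>s. iexp (Y n s)))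
      \<le> real n * (8 * (C / (1 + g) ^ 3)) * 1"
    unfolding left_diff_distrib[symmetric] norm_mult using IH nE C_nonneg \<open>0 \<le> g\<close> by (intro mult_mono) auto
  ultimately have "norm (expectation (\<lambda>s. ?p s * iexp (Y n s)) - (\<Prod>j<n. expectation (\<lambda>s. iexp (Y j s))) * expectation (\<lambda>s. iexp (Y n s)))
      \<le> 8 * (C / (1 + g) ^ 3) + real n * (8 * (C / (1 + g) ^ 3))"
    unfolding mult_1_right by (rule norm_diff_triangle_le)
  then show ?case by (simp add: algebra_simps add_divide_distrib)
qed

text \<open>The partial product may be exponentially large, so an absolute error would be useless.
  The relative bound of \<open>covariance_real\<close> instead adds 6 C/(1+g)^3 to the factor q
  contributed by each block.\<close>

lemma decouple_exp:
  fixes Y :: "nat \<Rightarrow> 's \<Rightarrow> real"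
  assumes P: "\<And>j k. k \<le> j \<Longrightarrow> j < n \<Longrightarrow> ae_measurable (P (a j)) (Y k)"
    and Q: "\<And>j. j < n \<Longrightarrow> ae_measurable (Q (b j)) (Y j)"
    and ab: "\<And>j. j < n \<Longrightarrow> 0 \<le> a j" "\<And>j. Suc j < n \<Longrightarrow> a j + g \<le> b (Suc j)" and "0 \<le> g"
    and Y[measurable]: "\<And>j. j < n \<Longrightarrow> Y j \<in> borel_measurable M"
    and Y1: "\<And>j s. j < n \<Longrightarrow> s \<in> space M \<Longrightarrow> \<bar>Y j s\<bar> \<le> 1"
    and q: "\<And>j. j < n \<Longrightarrow> expectation (\<lambda>s. exp (Y j s)) \<le> q" "0 \<le> q"
  shows "expectation (\<lambda>s. \<Prod>j<n. exp (Y j s)) \<le> (q + 6 * (C / (1 + g) ^ 3)) ^ n"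
  using P Q ab Y Y1 q
proof (induction n)
  case 0
  then show ?case by (simp add: prob_space)
next
  case (Suc n)
  note [measurable] = Suc.prems(5)
  let ?p = "\<lambda>s. \<Prod>j<n. exp (Y j s)"
  have IH: "expectation ?p \<le> (q + 6 * (C / (1 + g) ^ 3)) ^ n"
    using Suc by auto
  have Ep: "0 \<le> expectation ?p" by (intro integral_nonneg_AE AE_I2 prod_nonneg) auto
  \<comment> \<open>Establishes boundedness only; this exponentially large constant takes the role
    of \<open>b'\<close> in \<open>covariance_real\<close> and does not enter the estimate.\<close>
  have np: "\<bar>?p s\<bar> \<le> exp 1 ^ n" if "s \<in> space M" for s
  proof -
    have "\<bar>?p s\<bar> = ?p s" by (simp add: prod_nonneg)
    also have "\<dots> \<le> (\<Prod>j<n. exp 1)" using Suc.prems(6) that by (intro prod_mono) (auto simp: abs_le_iff)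
    finally show ?thesis by simp
  qed
  \<comment> \<open>The 3 bounds e, hence exp of a block variable of size at most 1.\<close>
  have "\<bar>expectation (\<lambda>s. ?p s * exp (Y n s)) - expectation ?p * expectation (\<lambda>s. exp (Y n s))\<bar> \<le> 2 * 3 * (C / (1 + g) ^ 3) * expectation (\<lambda>s. \<bar>?p s\<bar>)"
  proof (cases n)
    case 0
    then show ?thesis using C_nonneg \<open>0 \<le> g\<close> by (simp add: prob_space)
  next
    case (Suc m)
    show ?thesis
    proof (rule covariance_real[OF mix_gap[of "a m" g "b n"], where b' = "exp 1 ^ n"])
      show "ae_measurable (P (a m)) ?p"
        using Suc.prems(1) Suc
        by (intro ae_measurable_prod ae_measurable_compose[where f = exp]) auto
      show "ae_measurable (Q (b n)) (\<lambda>s. exp (Y n s))"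
        using Suc.prems(2) by (intro ae_measurable_compose[where f = exp]) auto
      show "?p \<in> borel_measurable M" "(\<lambda>s. exp (Y n s)) \<in> borel_measurable M"
        by (auto intro!: borel_measurable_prod)
      have "exp (Y n s) \<le> 3" if "s \<in> space M" for s
      proof -
        have "exp (Y n s) \<le> exp 1" using Suc.prems(6)[of n s] that by auto
        then show ?thesis using exp_le by linarith
      qed
      then show "AE s in M. \<bar>exp (Y n s)\<bar> \<le> 3" by auto
    qed (use Suc.prems(3,4) Suc \<open>0 \<le> g\<close> np in auto)
  qed
  moreover have "expectation (\<lambda>s. \<bar>?p s\<bar>) = expectation ?p" by (simp add: prod_nonneg)
  moreover have "expectation ?p * expectation (\<lambda>s. exp (Y n s)) \<le> expectation ?p * q"
    using Suc.prems(7) Ep by (intro mult_left_mono) auto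
  ultimately have "expectation (\<lambda>s. ?p s * exp (Y n s)) \<le> expectation ?p * (q + 6 * (C / (1 + g) ^ 3))"
    by (simp add: algebra_simps)
  also have "\<dots> \<le> (q + 6 * (C / (1 + g) ^ 3)) ^ n * (q + 6 * (C / (1 + g) ^ 3))"
    using IH C_nonneg \<open>0 \<le> g\<close> q(2) by (intro mult_right_mono) auto
  finally show ?case by (simp add: algebra_simps)
qed

end

section \<open>Time integrals of a centred mixing process\<close>

text \<open>Measurability and boundedness are asked for at all real times, so that integrals against
  \<open>lborel\<close> need no sign conditions; centring and adaptedness concern times r \<ge> 0.
  Processes living on the half-line are to be extended by freezing them at time 0.\<close>

locale mixing_process = mixing_filtration M P Q C for M :: "'s measure" and P Q C +
  fixes h :: "real \<Rightarrow> 's \<Rightarrow> real" and K :: real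
  assumes h_measurable: "(\<lambda>(r, s). h r s) \<in> borel_measurable (borel \<Otimes>\<^sub>M M)"
    and h_bound: "\<And>r s. s \<in> space M \<Longrightarrow> \<bar>h r s\<bar> \<le> K"
    and K_nonneg: "0 \<le> K"
    and h_centered: "\<And>r. 0 \<le> r \<Longrightarrow> expectation (h r) = 0"
    and h_past: "\<And>r a. 0 \<le> r \<Longrightarrow> r \<le> a \<Longrightarrow> h r \<in> borel_measurable (P a)"
    and h_future: "\<And>r b. 0 \<le> b \<Longrightarrow> b \<le> r \<Longrightarrow> h r \<in> borel_measurable (Q b)"
begin

lemma h_measurable'[measurable]: "(\<lambda>x. h (fst x) (snd x)) \<in> borel_measurable (lborel \<Otimes>\<^sub>M M)"
  using h_measurable by (simp add: case_prod_beta' cong: measurable_cong_sets sets_pair_measure_cong)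

lemma h_meas[measurable]: "h r \<in> borel_measurable M"
  using measurable_compose[OF measurable_Pair1' h_measurable, of r] by simp

definition I :: "real set \<Rightarrow> 's \<Rightarrow> real" where
  "I A s = (\<integral>r. indicator A r * h r s \<partial>lborel)"

lemma I_measurable[measurable]: "A \<in> sets borel \<Longrightarrow> I A \<in> borel_measurable M"
proof -
  assume [measurable]: "A \<in> sets borel"
  have "(\<lambda>(s, r). indicator A r * h r s) \<in> borel_measurable (M \<Otimes>\<^sub>M lborel)"
    using measurable_compose[OF measurable_pair_swap' h_measurable'] 
    by (simp add: case_prod_beta' space_pair_measure) 
  then show ?thesis unfolding I_def[abs_def] by (rule lborel.borel_measurable_lebesgue_integral)
qed

lemma integrable_section:
  assumes [measurable]: "A \<in> sets borel" and A: "A \<subseteq> {0..a}" and s: "s \<in> space M"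
  shows "integrable lborel (\<lambda>r. indicator A r * h r s)"
proof -
  have [measurable]: "(\<lambda>r. h r s) \<in> borel_measurable lborel"
    using measurable_compose[OF measurable_Pair2'[OF s] h_measurable'] by simp
  have "integrable lborel (\<lambda>r. K * indicator {0..a} r :: real)"
    by (intro integrable_mult_right integrable_real_indicator) (auto simp: emeasure_lborel_Icc_eq)
  then show ?thesis
    by (rule Bochner_Integration.integrable_bound) (use A h_bound[OF s] K_nonneg in \<open>auto simp: indicator_def subset_iff\<close>)
qed

lemma I_union:
  assumes [measurable]: "A \<in> sets borel" "A' \<in> sets borel" and A: "A \<subseteq> {0..a}" "A' \<subseteq> {0..a}"
    and "A \<inter> A' = {}" and s: "s \<in> space M"
  shows "I (A \<union> A') s = I A s + I A' s"
proof -
  have "I (A \<union> A') s = (\<integral>r. indicator A r * h r s + indicator A' r * h r s \<partial>lborel)"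
    unfolding I_def using assms by (intro Bochner_Integration.integral_cong) (auto simp: indicator_def)
  also have "\<dots> = I A s + I A' s" unfolding I_def using assms
    by (intro Bochner_Integration.integral_add integrable_section[where a=a]) auto
  finally show ?thesis .
qed

lemma I_UN:
  assumes "finite J" "\<And>j. j \<in> J \<Longrightarrow> A j \<in> sets borel" "\<And>j. j \<in> J \<Longrightarrow> A j \<subseteq> {0..a}"
    "disjoint_family_on A J" and s: "s \<in> space M"
  shows "I (\<Union>j\<in>J. A j) s = (\<Sum>j\<in>J. I (A j) s)"
  using assms
proof (induction J rule: finite_induct)
  case empty
  then show ?case by (simp add: I_def)
next
  case (insert j J)
  have "I (A j \<union> (\<Union>j\<in>J. A j)) s = I (A j) s + I (\<Union>j\<in>J. A j) s"
    using insert by (intro I_union[where a=a]) (auto simp: disjoint_family_on_def)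
  moreover have "disjoint_family_on A J" using insert.prems by (auto simp: disjoint_family_on_def)
  ultimately show ?case using insert by simp
qed

lemma I_bound:
  assumes [measurable]: "A \<in> sets borel" and A: "A \<subseteq> {0..a}" and s: "s \<in> space M"
  shows "\<bar>I A s\<bar> \<le> K * measure lborel A"
proof -
  have "emeasure lborel A \<le> emeasure lborel {0..a}" using A by (intro emeasure_mono) auto
  also have "\<dots> < \<infinity>" by (simp add: emeasure_lborel_Icc_eq)
  finally have f: "emeasure lborel A < \<infinity>" .
  have "\<bar>I A s\<bar> \<le> (\<integral>r. K * indicator A r \<partial>lborel)"
    unfolding I_def using f h_bound[OF s]
    by (intro abs_integral_le integrable_mult_right integrable_real_indicator) (auto simp: indicator_def)
  then show ?thesis by simp
qed

lemma I_bound':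
  assumes "A \<in> sets borel" "A \<subseteq> {0..a}" "0 \<le> a" "s \<in> space M"
  shows "\<bar>I A s\<bar> \<le> K * a"
proof -
  have "measure lborel A \<le> measure lborel {0..a}"
    using assms by (intro measure_mono_fmeasurable) (auto simp: emeasure_lborel_Icc_eq fmeasurable_def)
  then have "K * measure lborel A \<le> K * a" using K_nonneg assms(3) by (intro mult_left_mono) auto
  then show ?thesis using I_bound[OF assms(1,2,4)] by linarith
qed

text \<open>Fubini. The bound on \<open>Z\<close> holds almost surely, so a truncated copy
  \<open>Z'\<close> is used on the product space.\<close>

lemma I_expectation:
  assumes [measurable]: "A \<in> sets borel" "Z \<in> borel_measurable M" and A: "A \<subseteq> {0..a}"
    and Z: "AE s in M. \<bar>Z s\<bar> \<le> z"
  shows "expectation (\<lambda>s. I A s * Z s) = (\<integral>r. indicator A r * expectation (\<lambda>s. h r s * Z s) \<partial>lborel)"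
proof -
  define Z' where "Z' s = max (- z) (min z (Z s))" for s
  have [measurable]: "Z' \<in> borel_measurable M" unfolding Z'_def[abs_def] by measurable
  have ZZ': "AE s in M. Z s = Z' s" using Z by eventually_elim (auto simp: Z'_def)
  interpret pair_sigma_finite lborel M ..
  have int: "integrable (lborel \<Otimes>\<^sub>M M) (\<lambda>(r, s). indicator A r * h r s * Z' s)"
  proof (rule integrable_pair_bounded[where b = "K * \<bar>z\<bar>" and a = a])
    show "(\<lambda>(r, s). indicator A r * h r s * Z' s) \<in> borel_measurable (lborel \<Otimes>\<^sub>M M)"
      unfolding case_prod_beta' by measurable
    fix r s assume s: "s \<in> space M"
    have "\<bar>Z' s\<bar> \<le> \<bar>z\<bar>" by (auto simp: Z'_def)
    then have "\<bar>h r s\<bar> * \<bar>Z' s\<bar> \<le> K * \<bar>z\<bar>" using h_bound[OF s] K_nonneg by (intro mult_mono) auto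
    then show "norm (case (r, s) of (r, s) \<Rightarrow> indicator A r * h r s * Z' s) \<le> K * \<bar>z\<bar> * indicator {0..a} r"
      using A K_nonneg by (auto simp: abs_mult indicator_def)
  qed
  have "expectation (\<lambda>s. I A s * Z s) = expectation (\<lambda>s. I A s * Z' s)"
    using ZZ' by (intro integral_cong_AE) auto
  also have "\<dots> = expectation (\<lambda>s. \<integral>r. indicator A r * h r s * Z' s \<partial>lborel)"
    unfolding I_def by simp
  also have "\<dots> = (\<integral>r. expectation (\<lambda>s. indicator A r * h r s * Z' s) \<partial>lborel)"
    using Fubini_integral[OF int] by simp
  also have "\<dots> = (\<integral>r. indicator A r * expectation (\<lambda>s. h r s * Z' s) \<partial>lborel)"
    by (simp add: mult.assoc)
  also have "\<dots> = (\<integral>r. indicator A r * expectation (\<lambda>s. h r s * Z s) \<partial>lborel)"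
  proof -
    have "expectation (\<lambda>s. h r s * Z' s) = expectation (\<lambda>s. h r s * Z s)" for r
      using ZZ' by (intro integral_cong_AE) auto
    then show ?thesis by simp
  qed
  finally show ?thesis .
qed

text \<open>Joint measurability does not make the integral measurable with respect to the
  \<open>\<sigma>\<close>-algebra generated by the integrand, but Fubini shows that it agrees almost surely with its
  conditional expectation.\<close>

lemma I_ae_measurable:
  assumes F: "subalgebra M F" and [measurable]: "A \<in> sets borel" and A: "A \<subseteq> {0..a}"
    and hF: "\<And>r. r \<in> A \<Longrightarrow> h r \<in> borel_measurable F"
  shows "ae_measurable F (I A)"
proof (cases "0 \<le> a")
  case False
  then have "A = {}" using A by auto
  then show ?thesis by (auto intro!: ae_measurableI simp: I_def[abs_def])
next
  case True
  interpret finite_measure_subalgebra M F by unfold_locales (rule F)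
  define b where "b = K * a"
  have Yb: "\<bar>I A s\<bar> \<le> b" if "s \<in> space M" for s
    unfolding b_def using I_bound'[OF _ A True that] by simp
  have iY: "integrable M (I A)" using Yb by (auto intro!: integrable_const_bound[where B=b])
  define Z where "Z = real_cond_exp M F (I A)"
  have ZF[measurable]: "Z \<in> borel_measurable F" unfolding Z_def by auto
  have [measurable]: "Z \<in> borel_measurable M" by (rule measurable_from_subalg[OF F ZF])
  have "AE s in M. real_cond_exp M F (I A) s \<le> real_cond_exp M F (\<lambda>_. b) s"
    using Yb iY by (intro real_cond_exp_mono AE_I2) (auto simp: abs_le_iff)
  moreover have "AE s in M. real_cond_exp M F (\<lambda>_. -b) s \<le> real_cond_exp M F (I A) s"
    using Yb iY by (intro real_cond_exp_mono AE_I2) (auto simp: abs_le_iff minus_le_iff)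
  moreover have "AE s in M. real_cond_exp M F (\<lambda>_. b) s = b" "AE s in M. real_cond_exp M F (\<lambda>_. -b) s = -b"
    by auto
  ultimately have Zb: "AE s in M. \<bar>Z s\<bar> \<le> b"
    unfolding Z_def by eventually_elim auto
  \<comment> \<open>\<open>D\<close> is orthogonal to every bounded function measurable with respect
    to \<open>F\<close>. The aim is that \<open>D\<close> is also orthogonal to itself.\<close>
  define D where "D s = I A s - Z s" for s
  have [measurable]: "D \<in> borel_measurable M" unfolding D_def[abs_def] by measurable
  have Db: "AE s in M. \<bar>D s\<bar> \<le> 2 * b"
    using Zb AE_space by eventually_elim (use Yb D_def in force)
  have mul: "integrable M (\<lambda>s. f s * k s)"
    if "f \<in> borel_measurable M" "k \<in> borel_measurable M" "AE s in M. \<bar>f s\<bar> \<le> B" "AE s in M. \<bar>k s\<bar> \<le> B'" for f k :: "'s \<Rightarrow> real" and B B'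
  proof (rule integrable_const_bound[where B="B*B'"])
    show "AE s in M. norm (f s * k s) \<le> B * B'"
      using that(3,4) by eventually_elim (auto simp: abs_mult intro!: mult_mono)
  qed (use that in auto)
  have IAb: "AE s in M. \<bar>I A s\<bar> \<le> b" using Yb by auto
  have orth: "expectation (\<lambda>s. f s * D s) = 0" if f: "f \<in> borel_measurable F" "AE s in M. \<bar>f s\<bar> \<le> B" for f B
  proof -
    have [measurable]: "f \<in> borel_measurable M" by (rule measurable_from_subalg[OF F f(1)])
    have "expectation (\<lambda>s. f s * D s) = expectation (\<lambda>s. f s * I A s) - expectation (\<lambda>s. f s * Z s)"
      unfolding D_def right_diff_distrib
      by (intro Bochner_Integration.integral_diff mul[OF _ _ f(2) IAb] mul[OF _ _ f(2) Zb]) auto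
    also have "expectation (\<lambda>s. f s * Z s) = expectation (\<lambda>s. f s * I A s)"
      unfolding Z_def
      by (rule real_cond_exp_intg(2)) (auto intro!: mul[OF _ _ f(2) IAb] f(1))
    finally show ?thesis by simp
  qed
  \<comment> \<open>The part with \<open>Z\<close> vanishes because \<open>Z\<close> is measurable
    with respect to \<open>F\<close>. The part with \<open>I A\<close> becomes, by Fubini, an
    integral over r in A of expectations of \<open>h r * D\<close>, and each \<open>h r\<close> is
    measurable with respect to \<open>F\<close>.\<close>
  have "expectation (\<lambda>s. D s * D s) = expectation (\<lambda>s. I A s * D s) - expectation (\<lambda>s. Z s * D s)"
  proof -
    have "expectation (\<lambda>s. D s * D s) = expectation (\<lambda>s. I A s * D s - Z s * D s)"
      by (simp add: D_def algebra_simps)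
    also have "\<dots> = expectation (\<lambda>s. I A s * D s) - expectation (\<lambda>s. Z s * D s)"
      by (intro Bochner_Integration.integral_diff mul[OF _ _ IAb Db] mul[OF _ _ Zb Db]) auto
    finally show ?thesis .
  qed
  also have "expectation (\<lambda>s. Z s * D s) = 0" by (rule orth[OF ZF Zb])
  also have "expectation (\<lambda>s. I A s * D s) = (\<integral>r. indicator A r * expectation (\<lambda>s. h r s * D s) \<partial>lborel)"
    by (rule I_expectation[OF _ _ A Db]) auto
  also have "\<dots> = 0"
  proof -
    have "indicator A r * expectation (\<lambda>s. h r s * D s) = 0" for r
      using orth[of "h r" K] hF h_bound by (cases "r \<in> A") auto
    then show ?thesis by (simp only: Bochner_Integration.integral_zero)
  qed
  finally have "expectation (\<lambda>s. D s * D s) = 0" by simp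
  then have "AE s in M. D s * D s = 0"
    by (subst (asm) integral_nonneg_eq_0_iff_AE) (auto intro!: mul[OF _ _ Db Db])
  then have "AE s in M. I A s = Z s" by eventually_elim (simp add: D_def)
  then show ?thesis unfolding ae_measurable_def using ZF by auto
qed

lemma h_covariance:
  assumes "0 \<le> r" "0 \<le> r'"
  shows "\<bar>expectation (\<lambda>s. h r s * h r' s)\<bar> \<le> 2 * K\<^sup>2 * C / (1 + \<bar>r - r'\<bar>) ^ 3"
proof -
  have *: "\<bar>expectation (\<lambda>s. h r s * h r' s)\<bar> \<le> 2 * K\<^sup>2 * C / (1 + (r' - r)) ^ 3" if "0 \<le> r" "r \<le> r'" for r r'
  proof -
    have "\<bar>expectation (\<lambda>s. h r s * h r' s) - expectation (h r) * expectation (h r')\<bar>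
      \<le> 2 * K * (C / (1 + (r' - r)) ^ 3) * expectation (\<lambda>s. \<bar>h r s\<bar>)"
      by (rule covariance_real[OF mix[of r r'], where b' = K])
         (use that h_bound K_nonneg in \<open>auto intro!: ae_measurableI h_past h_future\<close>)
    also have "\<dots> \<le> 2 * K * (C / (1 + (r' - r)) ^ 3) * K"
      using K_nonneg C_nonneg that h_bound
      by (intro mult_left_mono integral_le_const integrable_const_bound[where B=K] AE_I2) auto
    finally show ?thesis using h_centered that by (simp add: power2_eq_square mult_ac)
  qed
  show ?thesis
    using *[of r r'] *[of r' r] assms by (cases "r \<le> r'") (auto simp: mult.commute)
qed

text \<open>For fixed r in A, the covariances of \<open>h r\<close> with all times at distance at
  least g have total mass at most 2 K^2 C/(1+g)^2; then r is integrated over A. The bound is linear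
  in the measure of A and does not depend on the size of A', which later permits grouping many
  blocks into a single A'.\<close>

lemma I_covariance:
  assumes [measurable]: "A \<in> sets borel" "A' \<in> sets borel" and A: "A \<subseteq> {0..a}" "A' \<subseteq> {0..a}"
    and g: "0 \<le> g" "\<And>r r'. r \<in> A \<Longrightarrow> r' \<in> A' \<Longrightarrow> g \<le> \<bar>r - r'\<bar>"
  shows "\<bar>expectation (\<lambda>s. I A s * I A' s)\<bar> \<le> 2 * K\<^sup>2 * C / (1 + g)\<^sup>2 * measure lborel A"
proof (cases "0 \<le> a")
  case False
  then have "A = {}" using A by auto
  then show ?thesis by (simp add: I_def)
next
  case a: True
  have f: "emeasure lborel A < \<infinity>"
    using emeasure_mono[of A "{0..a}" lborel] A a by (auto simp: intro: le_less_trans)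
  define k where "k u = 2 * K\<^sup>2 * C * (indicator {u. g \<le> \<bar>u\<bar>} u / (1 + \<bar>u\<bar>) ^ 3)" for u :: real
  have ik: "integrable lborel k" "(\<integral>u. k u \<partial>lborel) = 2 * K\<^sup>2 * C / (1 + g)\<^sup>2"
    unfolding k_def[abs_def]
    by (intro integrable_mult_right integrable_tail_cube[OF g(1)])
       (subst integral_mult_right_zero, simp add: integrable_tail_cube[OF g(1)])
  have inner: "\<bar>expectation (\<lambda>s. h r s * I A' s)\<bar> \<le> 2 * K\<^sup>2 * C / (1 + g)\<^sup>2" if r: "r \<in> A" for r
  proof -
    have "expectation (\<lambda>s. h r s * I A' s) = expectation (\<lambda>s. I A' s * h r s)" by (simp add: mult.commute)
    also have "\<dots> = (\<integral>r'. indicator A' r' * expectation (\<lambda>s. h r' s * h r s) \<partial>lborel)"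
      by (rule I_expectation[OF _ _ A(2), where z = K]) (use h_bound in auto)
    also have "\<bar>\<dots>\<bar> \<le> (\<integral>r'. k (- r + 1 * r') \<partial>lborel)"
    proof (rule abs_integral_le)
      show "integrable lborel (\<lambda>r'. k (- r + 1 * r'))"
        by (rule lborel_integrable_real_affine) (use ik in auto)
      fix r' :: real
      show "\<bar>indicator A' r' * expectation (\<lambda>s. h r' s * h r s)\<bar> \<le> k (- r + 1 * r')"
      proof (cases "r' \<in> A'")
        case True
        then have "g \<le> \<bar>r' - r\<bar>" using g(2)[OF r] by (simp add: abs_minus_commute)
        then show ?thesis using h_covariance[of r' r] True subsetD[OF A(1) r] subsetD[OF A(2) True] by (simp add: k_def)
      next
        case False
        then show ?thesis using C_nonneg by (simp add: k_def)
      qed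
    qed
    also have "\<dots> = 2 * K\<^sup>2 * C / (1 + g)\<^sup>2"
      using lborel_integral_real_affine[of 1 k "- r"] ik by simp
    finally show ?thesis .
  qed
  have "expectation (\<lambda>s. I A s * I A' s) = (\<integral>r. indicator A r * expectation (\<lambda>s. h r s * I A' s) \<partial>lborel)"
    by (rule I_expectation[OF _ _ A(1), where z = "K * a"]) (use I_bound'[OF _ A(2) a] in auto)
  also have "\<bar>\<dots>\<bar> \<le> (\<integral>r. 2 * K\<^sup>2 * C / (1 + g)\<^sup>2 * indicator A r \<partial>lborel)"
    using f inner C_nonneg by (intro abs_integral_le integrable_mult_right integrable_real_indicator) (auto simp: indicator_def)
  finally show ?thesis by simp
qed

end

section \<open>Block estimates: exponential moments and central limit theorem\<close>

lemma exp_le_quadratic: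
  fixes x :: real
  assumes "\<bar>x\<bar> \<le> 1"
  shows "exp x \<le> 1 + x + x\<^sup>2"
proof (cases "0 \<le> x")
  case True
  then show ?thesis using assms by (intro exp_bound) auto
next
  case False
  then show ?thesis using exp_neg_quadratic[of "- x"] by auto
qed

text \<open>The Taylor remainder is cubic, and boundedness trades one of the three powers for the
  constant b. The error is thereby proportional to the variance and can be summed over
  blocks.\<close>

lemma (in prob_space) iexp_second_order:
  assumes [measurable]: "Y \<in> borel_measurable M" and b: "\<And>s. s \<in> space M \<Longrightarrow> \<bar>Y s\<bar> \<le> b"
    and "expectation Y = 0"
  shows "norm (expectation (\<lambda>s. iexp (Y s)) - (1 - expectation (\<lambda>s. (Y s)\<^sup>2) / 2)) \<le> b * expectation (\<lambda>s. (Y s)\<^sup>2)"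
proof -
  obtain s where "s \<in> space M" using not_empty by auto
  then have b0: "0 \<le> b" using b[of s] by linarith
  have i: "integrable M Y" using b by (auto intro!: integrable_const_bound[where B=b])
  have i2: "integrable M (\<lambda>s. (Y s)\<^sup>2)"
    using b b0 by (auto intro!: integrable_const_bound[where B="b\<^sup>2"] AE_I2 simp: abs_le_square_iff[symmetric])
  have "expectation (\<lambda>s. iexp (Y s)) - (1 - expectation (\<lambda>s. (Y s)\<^sup>2) / 2)
      = expectation (\<lambda>s. iexp (Y s) - (1 + \<i> * complex_of_real (Y s) - complex_of_real ((Y s)\<^sup>2) / 2))"
  proof -
    have c: "integrable M (\<lambda>s. complex_of_real (Y s))" "integrable M (\<lambda>s. complex_of_real ((Y s)\<^sup>2))"
      using i i2 by (auto simp del: of_real_power)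
    have e: "integrable M (\<lambda>s. iexp (Y s))" by (intro integrable_iexp) auto
    have "expectation (\<lambda>s. iexp (Y s) - (1 + \<i> * complex_of_real (Y s) - complex_of_real ((Y s)\<^sup>2) / 2))
      = expectation (\<lambda>s. iexp (Y s)) - (expectation (\<lambda>s. 1 + \<i> * complex_of_real (Y s)) - expectation (\<lambda>s. complex_of_real ((Y s)\<^sup>2) / 2))"
      using c e by (simp del: of_real_power)
    also have "expectation (\<lambda>s. 1 + \<i> * complex_of_real (Y s)) = 1 + \<i> * complex_of_real (expectation Y)"
      using c by (simp add: prob_space)
    also have "expectation (\<lambda>s. complex_of_real ((Y s)\<^sup>2) / 2) = complex_of_real (expectation (\<lambda>s. (Y s)\<^sup>2)) / 2"
      using c by (simp del: of_real_power)
    finally show ?thesis using assms(3) by simp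
  qed
  also have "norm \<dots> \<le> expectation (\<lambda>s. norm (iexp (Y s) - (1 + \<i> * complex_of_real (Y s) - complex_of_real ((Y s)\<^sup>2) / 2)))"
    by (rule integral_norm_bound)
  also have "\<dots> \<le> expectation (\<lambda>s. b * (Y s)\<^sup>2)"
  proof (rule integral_mono')
    fix s assume s: "s \<in> space M"
    have "norm (iexp (Y s) - (1 + \<i> * complex_of_real (Y s) - complex_of_real ((Y s)\<^sup>2) / 2)) \<le> \<bar>Y s\<bar> ^ 3 / 6"
      using iexp_approx1[of "Y s" 2]
      by (simp add: numeral_2_eq_2 numeral_3_eq_3 power_mult_distrib algebra_simps fact_numeral)
    also have "\<dots> \<le> \<bar>Y s\<bar> ^ 3" by simp
    also have "\<dots> = \<bar>Y s\<bar> * \<bar>Y s\<bar>\<^sup>2" by (simp only: power3_eq_cube power2_eq_square mult.assoc)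
    also have "\<dots> = \<bar>Y s\<bar> * (Y s)\<^sup>2" by simp
    also have "\<dots> \<le> b * (Y s)\<^sup>2" using b[OF s] by (intro mult_right_mono) auto
    finally show "norm (iexp (Y s) - (1 + \<i> * complex_of_real (Y s) - complex_of_real ((Y s)\<^sup>2) / 2)) \<le> b * (Y s)\<^sup>2" .
  qed (use i2 b0 in auto)
  finally show ?thesis using i2 by simp
qed

lemma block_subset: "0 \<le> \<tau> \<Longrightarrow> {real j * \<tau>..<b} \<subseteq> {0..b}"
proof
  fix x assume "0 \<le> \<tau>" "x \<in> {real j * \<tau>..<b}"
  moreover from this have "0 \<le> real j * \<tau>" by simp
  ultimately show "x \<in> {0..b}"
    by (metis atLeastAtMost_iff atLeastLessThan_iff less_imp_le order_trans)
qed

context mixing_process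
begin

lemma I_past: "A \<in> sets borel \<Longrightarrow> A \<subseteq> {0..a} \<Longrightarrow> 0 \<le> a \<Longrightarrow> ae_measurable (P a) (I A)"
  by (rule I_ae_measurable[of _ _ a]) (auto intro!: subalgebras h_past)

lemma I_future: "A \<in> sets borel \<Longrightarrow> A \<subseteq> {b..a} \<Longrightarrow> 0 \<le> b \<Longrightarrow> ae_measurable (Q b) (I A)"
  by (rule I_ae_measurable[of _ _ a]) (auto intro!: subalgebras h_future)

lemma I_integrable:
  assumes [measurable]: "A \<in> sets borel" "A' \<in> sets borel" and A: "A \<subseteq> {0..a}" "A' \<subseteq> {0..a}" "0 \<le> a"
  shows "integrable M (I A)" "integrable M (\<lambda>s. I A s * I A' s)"
proof -
  show "integrable M (I A)"
    using I_bound'[of A a] A by (auto intro!: integrable_const_bound[where B="K * a"])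
  show "integrable M (\<lambda>s. I A s * I A' s)"
    using I_bound'[of A a] I_bound'[of A' a] A K_nonneg
    by (auto intro!: integrable_const_bound[where B="(K * a) * (K * a)"] AE_I2 mult_mono simp: abs_mult)
qed

lemma I_centered: "A \<in> sets borel \<Longrightarrow> A \<subseteq> {0..a} \<Longrightarrow> expectation (I A) = 0"
proof -
  assume A: "A \<in> sets borel" "A \<subseteq> {0..a}"
  have "expectation (\<lambda>s. I A s * 1) = (\<integral>r. indicator A r * expectation (\<lambda>s. h r s * 1) \<partial>lborel)"
    by (rule I_expectation[OF A(1) _ A(2), where z = 1]) auto
  also have "\<dots> = 0"
  proof -
    have "indicator A r * expectation (\<lambda>s. h r s * 1) = 0" for r
      using h_centered[of r] A by (auto simp: indicator_def)
    then show ?thesis by (simp only: Bochner_Integration.integral_zero)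
  qed
  finally show ?thesis by simp
qed

lemma I_second_moment:
  assumes "A \<in> sets borel" "A' \<in> sets borel" "A \<subseteq> {0..a}" "A' \<subseteq> {0..a}"
  shows "\<bar>expectation (\<lambda>s. I A s * I A' s)\<bar> \<le> 2 * K\<^sup>2 * C * measure lborel A"
  using I_covariance[OF assms, of 0] by simp

lemma I_sum_consecutive:
  assumes "0 \<le> \<tau>" "s \<in> space M"
  shows "I {0..<real n * \<tau>} s = (\<Sum>j<n. I {real j * \<tau>..<real (Suc j) * \<tau>} s)"
proof (induction n)
  case 0
  then show ?case by (simp add: I_def)
next
  case (Suc n)
  have "{0..<real (Suc n) * \<tau>} = {0..<real n * \<tau>} \<union> {real n * \<tau>..<real (Suc n) * \<tau>}"
    using assms by (intro ivl_disj_un(17)[symmetric]) (auto simp: algebra_simps)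
  moreover have "I ({0..<real n * \<tau>} \<union> {real n * \<tau>..<real (Suc n) * \<tau>}) s
      = I {0..<real n * \<tau>} s + I {real n * \<tau>..<real (Suc n) * \<tau>} s"
  proof (rule I_union[where a = "real (Suc n) * \<tau>"])
    have "real n * \<tau> \<le> real (Suc n) * \<tau>" using assms by (intro mult_right_mono) auto
    then show "{0..<real n * \<tau>} \<subseteq> {0..real (Suc n) * \<tau>}" by auto
  qed (use assms block_subset in auto)
  ultimately show ?case using Suc by simp
qed

text \<open>Bernstein's blocks: even and odd blocks are separated by gaps of the block length, and each
  block contributes at most 1 to the exponent, so that second moments control the exponential.\<close>

lemma exponential_moment:
  assumes T: "1 \<le> T" and K: "1 \<le> K"
  shows "expectation (\<lambda>s. exp (I {0..<T} s / sqrt T)) \<le> exp (2 * (2 * K\<^sup>2 * C) + 768 * C * K ^ 4)"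
proof -
  define D where "D = 2 * K\<^sup>2 * C"
  have D: "0 \<le> D" using C_nonneg by (simp add: D_def)
  \<comment> \<open>With 2 m blocks of length \<tau> = T/(2m), the doubled normalised block integral
    is at most 2 K \<tau>/sqrt T = K sqrt T/m, so this m is just large enough to make it at most
    1.\<close>
  define m where "m = nat \<lceil>K * sqrt T\<rceil>"
  have KT: "1 \<le> K * sqrt T" using mult_mono[OF K, of 1 "sqrt T"] K T by auto
  have m: "K * sqrt T \<le> m" "real m \<le> 2 * (K * sqrt T)" "0 < m"
    unfolding m_def using KT by (auto simp: of_nat_nat) linarith+
  define \<tau> where "\<tau> = T / (2 * m)"
  have \<tau>: "0 < \<tau>" using T m by (simp add: \<tau>_def)
  have T\<tau>: "real (2 * m) * \<tau> = T" using m by (simp add: \<tau>_def)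
  \<comment> \<open>\<open>e\<close> is the parity of the block. The factor 2 pays for separating
    even from odd blocks through exp((a+b)/2) \<le> (exp a + exp b)/2.\<close>
  define Y where "Y e j s = 2 * (I {real (2 * j + e) * \<tau>..<real (Suc (2 * j + e)) * \<tau>} s / sqrt T)" for e j :: nat and s
  have part: "expectation (\<lambda>s. \<Prod>j<m. exp (Y e j s)) \<le> exp (2 * D + 768 * C * K ^ 4)"
    if e: "e = 0 \<or> e = 1" for e
  proof -
    let ?A = "\<lambda>j. {real (2 * j + e) * \<tau>..<real (Suc (2 * j + e)) * \<tau>}"
    have A0: "?A j \<subseteq> {0..real (Suc (2 * j + e)) * \<tau>}" for j
      using \<tau> by (intro block_subset) simp
    have meas: "measure lborel (?A j) = \<tau>" for j using \<tau> by (simp add: algebra_simps)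
    have Yb: "\<bar>Y e j s\<bar> \<le> 1" if "s \<in> space M" for j s
    proof -
      have "\<bar>I (?A j) s\<bar> \<le> K * \<tau>" using I_bound[OF _ A0 that, of j] meas by simp
      then have "\<bar>Y e j s\<bar> \<le> 2 * (K * \<tau> / sqrt T)"
        using T by (auto simp: Y_def abs_mult intro!: divide_right_mono)
      also have "\<dots> = K * (T / sqrt T) / m" using m by (simp add: \<tau>_def)
      also have "\<dots> = K * sqrt T / m" using T by (simp add: real_div_sqrt)
      also have "\<dots> \<le> 1" using m by simp
      finally show ?thesis .
    qed
    have [measurable]: "Y e j \<in> borel_measurable M" for j unfolding Y_def[abs_def] by measurable
    have "expectation (\<lambda>s. \<Prod>j<m. exp (Y e j s)) \<le> ((1 + 2 * D / m) + 6 * (C / (1 + \<tau>) ^ 3)) ^ m"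
    proof (rule decouple_exp[where a = "\<lambda>j. real (Suc (2 * j + e)) * \<tau>" and b = "\<lambda>j. real (2 * j + e) * \<tau>"])
      show "ae_measurable (P (real (Suc (2 * j + e)) * \<tau>)) (Y e k)" if "k \<le> j" for j k
        unfolding Y_def
      proof (rule ae_measurable_compose[where f = "\<lambda>x. 2 * (x / sqrt T)"], rule I_past)
        have "real (Suc (2 * k + e)) * \<tau> \<le> real (Suc (2 * j + e)) * \<tau>"
          using that \<tau> by (intro mult_right_mono) auto
        then show "?A k \<subseteq> {0..real (Suc (2 * j + e)) * \<tau>}" using A0[of k] by fastforce
      qed (use \<tau> in auto)
      show "ae_measurable (Q (real (2 * j + e) * \<tau>)) (Y e j)" for j
        unfolding Y_def
        by (rule ae_measurable_compose[where f = "\<lambda>x. 2 * (x / sqrt T)"],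
            rule I_future[where a = "real (Suc (2 * j + e)) * \<tau>"]) (use \<tau> in auto)
      show "real (Suc (2 * j + e)) * \<tau> + \<tau> \<le> real (2 * Suc j + e) * \<tau>" for j
        by (simp add: algebra_simps)
      show "expectation (\<lambda>s. exp (Y e j s)) \<le> 1 + 2 * D / m" for j
      proof -
        have i: "integrable M (Y e j)" "integrable M (\<lambda>s. (Y e j s)\<^sup>2)" "integrable M (\<lambda>s. exp (Y e j s))"
        proof -
          show "integrable M (Y e j)" using Yb by (auto intro!: integrable_const_bound[where B=1])
          show "integrable M (\<lambda>s. (Y e j s)\<^sup>2)" using Yb by (auto intro!: integrable_const_bound[where B=1] AE_I2 simp: abs_square_le_1)
          show "integrable M (\<lambda>s. exp (Y e j s))" using Yb by (auto intro!: integrable_const_bound[where B="exp 1"] AE_I2 simp: abs_le_iff)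
        qed
        have "expectation (\<lambda>s. exp (Y e j s)) \<le> expectation (\<lambda>s. 1 + Y e j s + (Y e j s)\<^sup>2)"
          using i Yb by (intro integral_mono exp_le_quadratic) auto
        also have "\<dots> = 1 + expectation (Y e j) + expectation (\<lambda>s. (Y e j s)\<^sup>2)"
          using i by (simp add: prob_space)
        also have "expectation (Y e j) = 0"
          unfolding Y_def[abs_def] using I_centered[OF _ A0, of j] by simp
        \<comment> \<open>A block of length \<tau> has variance at most D \<tau>, and 4 D \<tau>/T =
          2 D/m because T = 2 m \<tau>. Over m blocks this amounts to 2 D in the exponent.\<close>
        also have "expectation (\<lambda>s. (Y e j s)\<^sup>2) = 4 / T * expectation (\<lambda>s. I (?A j) s * I (?A j) s)"
        proof -
          have "(Y e j s)\<^sup>2 = 4 / T * (I (?A j) s * I (?A j) s)" for s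
            unfolding Y_def using T by (simp add: power_divide power2_eq_square power_mult_distrib)
          then show ?thesis by simp
        qed
        also have "1 + 0 + 4 / T * expectation (\<lambda>s. I (?A j) s * I (?A j) s) \<le> 1 + 0 + 4 / T * (D * \<tau>)"
          using I_second_moment[OF _ _ A0[of j] A0[of j]] meas[of j] T
          by (intro add_left_mono mult_left_mono) (auto simp: D_def abs_le_iff)
        also have "\<dots> = 1 + 2 * D / m" using T m by (simp add: \<tau>_def)
        finally show ?thesis .
      qed
    qed (use \<tau> Yb D in auto)
    also have "\<dots> \<le> exp (2 * D / m + 6 * (C / (1 + \<tau>) ^ 3)) ^ m"
      using exp_ge_add_one_self[of "2 * D / m + 6 * (C / (1 + \<tau>) ^ 3)"] D C_nonneg \<tau>
      by (intro power_mono) (auto simp: add.assoc)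
    also have "\<dots> = exp (m * (2 * D / m + 6 * (C / (1 + \<tau>) ^ 3)))"
      by (simp add: exp_of_nat_mult)
    also have "m * (2 * D / m + 6 * (C / (1 + \<tau>) ^ 3)) = 2 * D + 6 * C * (m * (1 / (1 + \<tau>) ^ 3))"
      using m by (simp add: algebra_simps)
    \<comment> \<open>Here the gap equals the block length: m/\<tau>^3 = 8 m^4/T^3 and m \<le> 2 K
      sqrt T give 128 K^4/T. With the factor 6 of \<open>decouple_exp\<close> this yields the
      constant 768.\<close>
    also have "m * (1 / (1 + \<tau>) ^ 3) \<le> 128 * K ^ 4"
    proof -
      have "m * (1 / (1 + \<tau>) ^ 3) \<le> m * (1 / \<tau> ^ 3)"
        using \<tau> by (intro mult_left_mono divide_left_mono power_mono) auto
      also have "\<dots> = 8 * real m ^ 4 / T ^ 3"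
        using m T by (simp add: \<tau>_def power_divide power_mult_distrib eval_nat_numeral)
      also have "\<dots> \<le> 8 * (2 * (K * sqrt T)) ^ 4 / T ^ 3"
        using m T by (intro divide_right_mono mult_left_mono power_mono) auto
      also have "\<dots> = 128 * K ^ 4 * (sqrt T ^ 4 / T ^ 3)" by (simp add: power_mult_distrib)
      also have "sqrt T ^ 4 / T ^ 3 = 1 / T"
        using T by (simp add: eval_nat_numeral)
      also have "128 * K ^ 4 * (1 / T) \<le> 128 * K ^ 4" using T mult_left_mono[of "1 / T" 1 "128 * K ^ 4"] by simp
      finally show ?thesis by simp
    qed
    then have "6 * C * (m * (1 / (1 + \<tau>) ^ 3)) \<le> 6 * C * (128 * K ^ 4)"
      using C_nonneg by (intro mult_left_mono) auto
    then have "exp (2 * D + 6 * C * (m * (1 / (1 + \<tau>) ^ 3))) \<le> exp (2 * D + 6 * C * (128 * K ^ 4))"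
      by (simp only: exp_le_cancel_iff add_le_cancel_left)
    finally show ?thesis by (simp add: algebra_simps)
  qed
  have split: "exp (I {0..<T} s / sqrt T) \<le> ((\<Prod>j<m. exp (Y 0 j s)) + (\<Prod>j<m. exp (Y 1 j s))) / 2" if s: "s \<in> space M" for s
  proof -
    have "I {0..<T} s = (\<Sum>j<2 * m. I {real j * \<tau>..<real (Suc j) * \<tau>} s)"
      using I_sum_consecutive[of \<tau> s "2 * m"] \<tau> s T\<tau> by simp
    also have "\<dots> = (\<Sum>j<m. I {real (2 * j) * \<tau>..<real (Suc (2 * j)) * \<tau>} s) + (\<Sum>j<m. I {real (2 * j + 1) * \<tau>..<real (Suc (2 * j + 1)) * \<tau>} s)"
      by (induction m) (simp_all add: algebra_simps)
    finally have "2 * (I {0..<T} s / sqrt T) = (\<Sum>j<m. Y 0 j s) + (\<Sum>j<m. Y 1 j s)"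
      by (simp add: Y_def sum_distrib_left[symmetric] sum_divide_distrib[symmetric] add_divide_distrib)
    then have eq: "I {0..<T} s / sqrt T = (\<Sum>j<m. Y 0 j s) / 2 + (\<Sum>j<m. Y 1 j s) / 2" by simp
    have "exp (a / 2 + b / 2) \<le> (exp a + exp b) / 2" for a b :: real
    proof -
      have "0 \<le> (exp (a / 2) - exp (b / 2))\<^sup>2" by simp
      also have "\<dots> = exp a + exp b - 2 * exp (a / 2 + b / 2)"
        by (simp add: power2_diff exp_add flip: exp_double)
      finally show ?thesis by simp
    qed
    from this[of "\<Sum>j<m. Y 0 j s" "\<Sum>j<m. Y 1 j s"] show ?thesis
      unfolding eq by (simp only: exp_sum finite_lessThan)
  qed
  have bp: "\<bar>\<Prod>j<m. exp (Y e j s)\<bar> \<le> (\<Prod>j<m. exp (2 * (K * \<tau> / sqrt T)))" if s: "s \<in> space M" for e s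
  proof -
    have "Y e j s \<le> 2 * (K * \<tau> / sqrt T)" for j
    proof -
      have "{real (2 * j + e) * \<tau>..<real (Suc (2 * j + e)) * \<tau>} \<subseteq> {0..real (Suc (2 * j + e)) * \<tau>}"
        using \<tau> by (intro block_subset) simp
      from I_bound[OF _ this s] have "I {real (2 * j + e) * \<tau>..<real (Suc (2 * j + e)) * \<tau>} s \<le> K * \<tau>"
        using \<tau> by (simp add: algebra_simps)
      then show ?thesis using T by (auto simp: Y_def intro!: divide_right_mono)
    qed
    then show ?thesis by (auto simp: abs_prod simp del: prod_constant intro!: prod_mono)
  qed
  have [measurable]: "Y e j \<in> borel_measurable M" for e j unfolding Y_def[abs_def] by measurable
  have ip: "integrable M (\<lambda>s. \<Prod>j<m. exp (Y e j s))" for e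
    by (rule integrable_const_bound[OF AE_I2]) (use bp in auto)
  have "expectation (\<lambda>s. exp (I {0..<T} s / sqrt T)) \<le> expectation (\<lambda>s. ((\<Prod>j<m. exp (Y 0 j s)) + (\<Prod>j<m. exp (Y 1 j s))) / 2)"
    using ip split by (intro integral_mono') (auto intro!: add_nonneg_nonneg prod_nonneg)
  also have "\<dots> = (expectation (\<lambda>s. \<Prod>j<m. exp (Y 0 j s)) + expectation (\<lambda>s. \<Prod>j<m. exp (Y 1 j s))) / 2"
    using ip by simp
  also have "\<dots> \<le> exp (2 * D + 768 * C * K ^ 4)" using part[of 0] part[of 1] by simp
  finally show ?thesis by (simp add: D_def)
qed

text \<open>The interval is cut into n blocks of length T/n, each ending in a gap of length g. The
  error terms are, in order: the integral over the gaps, estimated in L2; the decoupling of the n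
  blocks; the third-order Taylor term of the block characteristic functions; the replacement of 1 -
  v/2 by exp(-v/2); and the difference between the total variance and the sum of the block
  variances.\<close>

lemma clt_bound:
  fixes n :: nat and g T :: real
  assumes T: "0 < T" and n: "0 < n" and g: "0 \<le> g" "g < T / n"
  defines "D \<equiv> 2 * K\<^sup>2 * C"
  shows "norm (expectation (\<lambda>s. iexp (I {0..<T} s / sqrt T)) - exp (- expectation (\<lambda>s. (I {0..<T} s / sqrt T)\<^sup>2) / 2))
    \<le> sqrt (D * (n * g / T)) + n * (8 * (C / (1 + g) ^ 3)) + K * sqrt T / n * D + D\<^sup>2 / n + D * (n * g / T + 1 / (1 + g)\<^sup>2)"
proof -
  have D: "0 \<le> D" using C_nonneg by (simp add: D_def)
  define \<tau> where "\<tau> = T / n"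
  have \<tau>: "0 < \<tau>" "g < \<tau>" "n * \<tau> = T" using T n g by (auto simp: \<tau>_def)
  \<comment> \<open>The gap is taken from the right end of each block, so the last block also has
    one; the gaps then have total length n g.\<close>
  define A where "A j = {real j * \<tau>..<real (Suc j) * \<tau> - g}" for j
  have [measurable]: "A j \<in> sets borel" for j by (simp add: A_def)
  have A0: "A j \<subseteq> {0..T}" if "j < n" for j
  proof -
    have "real (Suc j) * \<tau> \<le> n * \<tau>" "0 \<le> real j * \<tau>"
      using that \<tau> by (intro mult_right_mono mult_nonneg_nonneg; simp)+
    then show ?thesis unfolding A_def using g \<tau>(3) by auto
  qed
  have mA: "measure lborel (A j) = \<tau> - g" for j using \<tau> by (simp add: A_def algebra_simps)
  have sep: "g \<le> \<bar>r - r'\<bar>" "r \<noteq> r'" if "r \<in> A j" "r' \<in> A k" "j \<noteq> k" for j k r r'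
  proof -
    have *: "g < r' - r \<or> (r < r' \<and> g \<le> r' - r)" if "r \<in> A j" "r' \<in> A k" "j < k" for j k r r'
    proof -
      have "real (Suc j) * \<tau> \<le> real k * \<tau>" using that \<tau> by (intro mult_right_mono) auto
      then show ?thesis using that g by (auto simp: A_def)
    qed
    show "g \<le> \<bar>r - r'\<bar>" "r \<noteq> r'"
      using *[of r j r' k] *[of r' k r j] that g by (cases "j < k"; auto)+
  qed
  define U where "U = (\<Union>j<n. A j)"
  define G where "G = {0..<T} - U"
  have [measurable]: "U \<in> sets borel" "G \<in> sets borel" by (auto simp: U_def G_def)
  have disj: "disjoint_family_on A J" for J using sep(2) by (auto simp: disjoint_family_on_def)
  have AT: "A j \<subseteq> {0..<T}" if "j < n" for j
  proof -
    have "real (Suc j) * \<tau> \<le> n * \<tau>" "0 \<le> real j * \<tau>"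
      using that \<tau> by (intro mult_right_mono mult_nonneg_nonneg; simp)+
    then show ?thesis unfolding A_def using g \<tau>(3) by auto
  qed
  have U0: "U \<subseteq> {0..T}" "G \<subseteq> {0..T}" "U \<subseteq> {0..<T}" using AT by (fastforce simp: U_def G_def)+
  have mU: "measure lborel U = n * (\<tau> - g)"
  proof -
    have "emeasure lborel (A j) \<noteq> \<infinity>" for j
      using emeasure_bounded_finite[of "A j"] by (simp add: A_def)
    then show ?thesis unfolding U_def by (subst measure_finite_Union) (auto intro: disj simp: mA)
  qed
  have mG: "measure lborel G = n * g"
  proof -
    have "measure lborel G = measure lborel {0..<T} - measure lborel U"
      unfolding G_def using U0 T by (intro measure_Diff) auto
    then show ?thesis using mU T \<tau>(3) by (simp add: algebra_simps)
  qed
  have full: "{0..<T} \<subseteq> {0..T}" by auto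
  have IU: "I U s = (\<Sum>j<n. I (A j) s)" if "s \<in> space M" for s
    unfolding U_def using A0 disj that by (intro I_UN[where a=T]) auto
  have Iall: "I {0..<T} s = I U s + I G s" if "s \<in> space M" for s
    using I_union[of U G T s] U0 that by (simp add: G_def Un_absorb1)
  note int = I_integrable(2)[where a = T]
  define X where "X s = I {0..<T} s / sqrt T" for s
  define Y where "Y j s = I (A j) s / sqrt T" for j s
  have [measurable]: "X \<in> borel_measurable M" "Y j \<in> borel_measurable M" for j
    unfolding X_def[abs_def] Y_def[abs_def] by measurable
  have sumY: "(\<Sum>j<n. Y j s) = I U s / sqrt T" if "s \<in> space M" for s
    using IU[OF that] by (simp add: Y_def sum_divide_distrib)
  define v where "v j = expectation (\<lambda>s. (Y j s)\<^sup>2)" for j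
  have v_eq: "v j = expectation (\<lambda>s. I (A j) s * I (A j) s) / T" for j
    unfolding v_def Y_def using T by (simp add: power_divide power2_eq_square)
  have v0: "0 \<le> v j" for j unfolding v_def by simp
  have vle: "v j \<le> D / n" if "j < n" for j
  proof -
    have "expectation (\<lambda>s. I (A j) s * I (A j) s) \<le> D * (\<tau> - g)"
      using I_second_moment[OF _ _ A0[OF that] A0[OF that]] mA by (simp add: D_def abs_le_iff)
    also have "\<dots> \<le> D * \<tau>" using D g by (intro mult_left_mono) auto
    finally have "v j \<le> D * \<tau> / T" unfolding v_eq using T by (intro divide_right_mono) auto
    then show ?thesis using T n by (simp add: \<tau>_def)
  qed
  have Yb: "\<bar>Y j s\<bar> \<le> K * sqrt T / n" if "j < n" "s \<in> space M" for j s
  proof -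
    have "\<bar>I (A j) s\<bar> \<le> K * (\<tau> - g)" using I_bound[OF _ A0[OF that(1)] that(2)] mA by simp
    also have "\<dots> \<le> K * \<tau>" using K_nonneg g by (intro mult_left_mono) auto
    finally have "\<bar>Y j s\<bar> \<le> K * \<tau> / sqrt T" using T by (auto simp: Y_def intro!: divide_right_mono)
    also have "\<dots> = K * (T / sqrt T) / n" by (simp add: \<tau>_def)
    finally show ?thesis using T by (simp add: real_div_sqrt)
  qed
  have 1: "norm (expectation (\<lambda>s. iexp (X s)) - expectation (\<lambda>s. \<Prod>j<n. iexp (Y j s))) \<le> sqrt (D * (n * g / T))"
  proof -
    have "expectation (\<lambda>s. iexp (X s)) - expectation (\<lambda>s. \<Prod>j<n. iexp (Y j s))
      = expectation (\<lambda>s. iexp (X s) - iexp (\<Sum>j<n. Y j s))"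
    proof -
      have "(\<Prod>j<n. iexp (Y j s)) = iexp (\<Sum>j<n. Y j s)" for s
        by (simp add: exp_sum sum_distrib_left)
      then show ?thesis by (subst Bochner_Integration.integral_diff) (auto intro!: integrable_iexp)
    qed
    also have "norm \<dots> \<le> expectation (\<lambda>s. norm (iexp (X s) - iexp (\<Sum>j<n. Y j s)))"
      by (rule integral_norm_bound)
    also have "\<dots> \<le> expectation (\<lambda>s. \<bar>I G s / sqrt T\<bar>)"
    proof (rule integral_mono')
      show "integrable M (\<lambda>s. \<bar>I G s / sqrt T\<bar>)"
        using I_integrable(1)[of G G T] U0 T by (intro integrable_abs) auto
      fix s assume s: "s \<in> space M"
      have "norm (iexp (X s) - iexp (\<Sum>j<n. Y j s)) \<le> \<bar>X s - (\<Sum>j<n. Y j s)\<bar>" by (rule norm_iexp_diff_le)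
      also have "X s - (\<Sum>j<n. Y j s) = I G s / sqrt T"
        using sumY[OF s] Iall[OF s] by (simp add: X_def add_divide_distrib)
      finally show "norm (iexp (X s) - iexp (\<Sum>j<n. Y j s)) \<le> \<bar>I G s / sqrt T\<bar>" .
    qed auto
    also have "\<dots> \<le> sqrt (expectation (\<lambda>s. (I G s / sqrt T)\<^sup>2))"
      using int[of G G] U0 T by (intro abs_expectation_le_sqrt) (auto simp: power_divide power2_eq_square)
    also have "expectation (\<lambda>s. (I G s / sqrt T)\<^sup>2) = expectation (\<lambda>s. I G s * I G s) / T"
      using T by (simp add: power_divide power2_eq_square)
    also have "\<dots> \<le> D * (n * g) / T"
      using I_second_moment[of G G T] U0 T mG by (intro divide_right_mono) (auto simp: D_def abs_le_iff)
    finally show ?thesis by (simp add: real_sqrt_le_mono)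
  qed
  have 2: "norm (expectation (\<lambda>s. \<Prod>j<n. iexp (Y j s)) - (\<Prod>j<n. expectation (\<lambda>s. iexp (Y j s)))) \<le> n * (8 * (C / (1 + g) ^ 3))"
  proof (rule decouple_iexp[where a = "\<lambda>j. real (Suc j) * \<tau> - g" and b = "\<lambda>j. real j * \<tau>"])
    show pos: "0 \<le> real (Suc j) * \<tau> - g" for j
    proof -
      have "1 * \<tau> \<le> real (Suc j) * \<tau>" using \<tau> by (intro mult_right_mono) auto
      then show ?thesis using \<tau> by linarith
    qed
    show "ae_measurable (P (real (Suc j) * \<tau> - g)) (Y k)" if "k \<le> j" for j k
      unfolding Y_def
    proof (rule ae_measurable_compose[where f = "\<lambda>x. x / sqrt T"], rule I_past)
      have "real (Suc k) * \<tau> \<le> real (Suc j) * \<tau>" "0 \<le> real k * \<tau>"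
        using that \<tau> by (intro mult_right_mono mult_nonneg_nonneg; simp)+
      then show "A k \<subseteq> {0..real (Suc j) * \<tau> - g}" by (auto simp: A_def)
    qed (use pos in auto)
    show "ae_measurable (Q (real j * \<tau>)) (Y j)" for j
      unfolding Y_def
      by (rule ae_measurable_compose[where f = "\<lambda>x. x / sqrt T"],
          rule I_future[where a = "real (Suc j) * \<tau> - g"]) (use \<tau> in \<open>auto simp: A_def\<close>)
  qed (use g in auto)
  have 3: "norm ((\<Prod>j<n. expectation (\<lambda>s. iexp (Y j s))) - (\<Prod>j<n. complex_of_real (exp (- (v j / 2)))))
     \<le> K * sqrt T / n * D + D\<^sup>2 / n"
  proof -
    have "norm ((\<Prod>j<n. expectation (\<lambda>s. iexp (Y j s))) - (\<Prod>j<n. complex_of_real (exp (- (v j / 2)))))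
      \<le> (\<Sum>j<n. norm (expectation (\<lambda>s. iexp (Y j s)) - complex_of_real (exp (- (v j / 2)))))"
      by (rule norm_prod_diff) (use v0 in \<open>auto intro!: norm_expectation_le\<close>)
    also have "\<dots> \<le> (\<Sum>j<n. K * sqrt T / n * (D / n) + (D / n)\<^sup>2)"
    proof (rule sum_mono)
      fix j assume "j \<in> {..<n}"
      then have j: "j < n" by simp
      have a: "norm (expectation (\<lambda>s. iexp (Y j s)) - (1 - v j / 2)) \<le> K * sqrt T / n * v j"
        unfolding v_def using Yb[OF j] I_centered[OF _ A0[OF j]]
        by (intro iexp_second_order) (auto simp: Y_def)
      have b: "norm (complex_of_real (1 - v j / 2) - complex_of_real (exp (- (v j / 2)))) \<le> (v j / 2)\<^sup>2"
        unfolding of_real_diff[symmetric] norm_of_real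
        using exp_neg_quadratic[of "v j / 2"] v0[of j] by (simp add: abs_minus_commute)
      have "norm (expectation (\<lambda>s. iexp (Y j s)) - complex_of_real (exp (- (v j / 2)))) \<le> K * sqrt T / n * v j + (v j / 2)\<^sup>2"
        using norm_diff_triangle_le[OF a] b by simp
      also have "\<dots> \<le> K * sqrt T / n * (D / n) + (D / n)\<^sup>2"
      proof (intro add_mono mult_left_mono power_mono)
        show "v j \<le> D / n" by (rule vle[OF j])
        show "v j / 2 \<le> D / n" using vle[OF j] v0[of j] by linarith
      qed (use v0[of j] K_nonneg T in auto)
      finally show "norm (expectation (\<lambda>s. iexp (Y j s)) - complex_of_real (exp (- (v j / 2)))) \<le> K * sqrt T / n * (D / n) + (D / n)\<^sup>2" .
    qed
    also have "\<dots> = K * sqrt T / n * D + D\<^sup>2 / n"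
      using n by (simp add: field_simps power2_eq_square)
    finally show ?thesis .
  qed
  have 4: "\<bar>expectation (\<lambda>s. (X s)\<^sup>2) - (\<Sum>j<n. v j)\<bar> \<le> 2 * (D * (n * g / T + 1 / (1 + g)\<^sup>2))"
  proof -
    have X2: "expectation (\<lambda>s. (X s)\<^sup>2) = expectation (\<lambda>s. I {0..<T} s * I {0..<T} s) / T"
      unfolding X_def using T by (simp add: power_divide power2_eq_square)
    \<comment> \<open>With X = U + G for the integrals over blocks and gaps, X^2 = U^2 + G U + G X.
      The last two terms are each controlled by the total length n g of the gaps.\<close>
    have "expectation (\<lambda>s. I {0..<T} s * I {0..<T} s) =
      expectation (\<lambda>s. I U s * I U s + I G s * I U s + I G s * I {0..<T} s)"
      using Iall by (intro Bochner_Integration.integral_cong) (auto simp: algebra_simps)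
    also have "\<dots> = expectation (\<lambda>s. I U s * I U s) + expectation (\<lambda>s. I G s * I U s) + expectation (\<lambda>s. I G s * I {0..<T} s)"
      using int U0 full T by simp
    finally have e1: "expectation (\<lambda>s. I {0..<T} s * I {0..<T} s) = \<dots>" .
    have b1: "\<bar>expectation (\<lambda>s. I G s * I U s)\<bar> \<le> D * (n * g)" "\<bar>expectation (\<lambda>s. I G s * I {0..<T} s)\<bar> \<le> D * (n * g)"
      using I_second_moment[of G U T] I_second_moment[of G "{0..<T}" T] U0 full mG by (auto simp: D_def)
    \<comment> \<open>All other blocks together, treated as one set at distance at least g from
      block j. Bounding the cross terms pair by pair would cost a further factor n.\<close>
    define V where "V j = (\<Union>k\<in>{..<n} - {j}. A k)" for j
    have [measurable]: "V j \<in> sets borel" for j by (auto simp: V_def)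
    have V0: "V j \<subseteq> {0..T}" for j using A0 by (fastforce simp: V_def)
    have IUV: "I U s = I (A j) s + I (V j) s" if "j < n" "s \<in> space M" for j s
    proof -
      have "I (V j) s = (\<Sum>k\<in>{..<n} - {j}. I (A k) s)"
        unfolding V_def using A0 disj that by (intro I_UN[where a=T]) auto
      then show ?thesis using IU[OF that(2)] that(1) by (simp add: sum.remove)
    qed
    have "expectation (\<lambda>s. I U s * I U s) = expectation (\<lambda>s. \<Sum>j<n. I (A j) s * I (A j) s + I (A j) s * I (V j) s)"
    proof (rule Bochner_Integration.integral_cong[OF refl])
      fix s assume s: "s \<in> space M"
      have "I U s * I U s = (\<Sum>j<n. I (A j) s * I U s)" using IU[OF s] by (simp add: sum_distrib_right)
      also have "\<dots> = (\<Sum>j<n. I (A j) s * I (A j) s + I (A j) s * I (V j) s)"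
        by (intro sum.cong refl) (simp add: IUV[OF _ s] algebra_simps)
      finally show "I U s * I U s = \<dots>" .
    qed
    also have "\<dots> = (\<Sum>j<n. expectation (\<lambda>s. I (A j) s * I (A j) s) + expectation (\<lambda>s. I (A j) s * I (V j) s))"
      using A0 V0 T by (subst Bochner_Integration.integral_sum) (auto intro!: sum.cong Bochner_Integration.integral_add Bochner_Integration.integrable_add int)
    also have "\<dots> = T * (\<Sum>j<n. v j) + (\<Sum>j<n. expectation (\<lambda>s. I (A j) s * I (V j) s))"
      using T by (simp add: sum.distrib v_eq sum_divide_distrib[symmetric])
    finally have e2: "expectation (\<lambda>s. I U s * I U s) = \<dots>" .
    have b2: "\<bar>\<Sum>j<n. expectation (\<lambda>s. I (A j) s * I (V j) s)\<bar> \<le> D / (1 + g)\<^sup>2 * T"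
    proof -
      have "\<bar>\<Sum>j<n. expectation (\<lambda>s. I (A j) s * I (V j) s)\<bar> \<le> (\<Sum>j<n. \<bar>expectation (\<lambda>s. I (A j) s * I (V j) s)\<bar>)"
        by (rule sum_abs)
      also have "\<dots> \<le> (\<Sum>j<n. D / (1 + g)\<^sup>2 * (\<tau> - g))"
      proof (rule sum_mono)
        fix j assume "j \<in> {..<n}"
        moreover have "g \<le> \<bar>r - r'\<bar>" if "r \<in> A j" "r' \<in> V j" for r r'
          using that sep(1) unfolding V_def by blast
        ultimately show "\<bar>expectation (\<lambda>s. I (A j) s * I (V j) s)\<bar> \<le> D / (1 + g)\<^sup>2 * (\<tau> - g)"
          unfolding D_def mA[of j, symmetric] using A0 V0 g
          by (intro I_covariance[where a=T]) auto
      qed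
      also have "\<dots> \<le> (\<Sum>j<n. D / (1 + g)\<^sup>2 * \<tau>)"
        using D g by (intro sum_mono mult_left_mono) auto
      also have "\<dots> = D / (1 + g)\<^sup>2 * T" using \<tau>(3) by (simp add: algebra_simps)
      finally show ?thesis .
    qed
    have "\<bar>expectation (\<lambda>s. I {0..<T} s * I {0..<T} s) - T * (\<Sum>j<n. v j)\<bar> \<le> D / (1 + g)\<^sup>2 * T + 2 * (D * (n * g))"
      using e1 e2 b1 b2 by linarith
    then have "\<bar>expectation (\<lambda>s. I {0..<T} s * I {0..<T} s) - T * (\<Sum>j<n. v j)\<bar> / T \<le> (D / (1 + g)\<^sup>2 * T + 2 * (D * (n * g))) / T"
      using T by (intro divide_right_mono) auto
    moreover have "\<bar>expectation (\<lambda>s. I {0..<T} s * I {0..<T} s) - T * (\<Sum>j<n. v j)\<bar> / T = \<bar>expectation (\<lambda>s. (X s)\<^sup>2) - (\<Sum>j<n. v j)\<bar>"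
    proof -
      have "expectation (\<lambda>s. (X s)\<^sup>2) - (\<Sum>j<n. v j) = (expectation (\<lambda>s. I {0..<T} s * I {0..<T} s) - T * (\<Sum>j<n. v j)) / T"
        using T unfolding X2 by (simp add: diff_divide_distrib)
      then show ?thesis using T by (simp add: abs_divide)
    qed
    moreover have "(D / (1 + g)\<^sup>2 * T + 2 * (D * (n * g))) / T = D / (1 + g)\<^sup>2 + 2 * (D * (n * g / T))"
      using T by (simp add: add_divide_distrib)
    moreover have "0 \<le> D / (1 + g)\<^sup>2" using D by simp
    ultimately show ?thesis by (simp add: distrib_left)
  qed
  have 5: "norm ((\<Prod>j<n. complex_of_real (exp (- (v j / 2)))) - complex_of_real (exp (- expectation (\<lambda>s. (X s)\<^sup>2) / 2)))
      \<le> D * (n * g / T + 1 / (1 + g)\<^sup>2)"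
  proof -
    have "(\<Prod>j<n. complex_of_real (exp (- (v j / 2)))) = complex_of_real (exp (- ((\<Sum>j<n. v j) / 2)))"
      by (simp add: exp_sum sum_negf[symmetric] sum_divide_distrib)
    then have "norm ((\<Prod>j<n. complex_of_real (exp (- (v j / 2)))) - complex_of_real (exp (- expectation (\<lambda>s. (X s)\<^sup>2) / 2)))
      = \<bar>exp (- ((\<Sum>j<n. v j) / 2)) - exp (- (expectation (\<lambda>s. (X s)\<^sup>2) / 2))\<bar>"
      by (simp only: of_real_diff[symmetric] norm_of_real real_norm_def minus_divide_left)
    also have "\<dots> \<le> \<bar>(\<Sum>j<n. v j) / 2 - expectation (\<lambda>s. (X s)\<^sup>2) / 2\<bar>"
      by (intro exp_neg_diff_le) (auto intro!: sum_nonneg v0 divide_nonneg_pos)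
    also have "\<dots> \<le> D * (n * g / T + 1 / (1 + g)\<^sup>2)" using 4 by linarith
    finally show ?thesis .
  qed
  show ?thesis
    using norm_diff_triangle_le[OF norm_diff_triangle_le[OF norm_diff_triangle_le[OF 1 2] 3] 5]
    unfolding X_def by (simp add: add.assoc)
qed

end

text \<open>With n = T^0.6 blocks and gaps g = T^0.3 one needs n g/T, n/g^3 and sqrt T/n to vanish.
  In exponents: 0.6 + 0.3 < 1, 0.6 < 3 * 0.3 and 0.5 < 0.6.\<close>

lemma clt_error_tendsto_0:
  fixes K C :: real
  assumes T: "filterlim T at_top F"
  defines "D \<equiv> 2 * K\<^sup>2 * C"
  shows "((\<lambda>k. sqrt (D * (real (nat \<lceil>T k powr 0.6\<rceil>) * T k powr 0.3 / T k))
      + real (nat \<lceil>T k powr 0.6\<rceil>) * (8 * (C / (1 + T k powr 0.3) ^ 3))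
      + K * sqrt (T k) / real (nat \<lceil>T k powr 0.6\<rceil>) * D + D\<^sup>2 / real (nat \<lceil>T k powr 0.6\<rceil>)
      + D * (real (nat \<lceil>T k powr 0.6\<rceil>) * T k powr 0.3 / T k + 1 / (1 + T k powr 0.3)\<^sup>2)) \<longlongrightarrow> 0) F"
proof -
  have a: "((\<lambda>T::real. real (nat \<lceil>T powr 0.6\<rceil>) * T powr 0.3 / T) \<longlongrightarrow> 0) at_top"
    by real_asymp
  have b: "((\<lambda>T::real. real (nat \<lceil>T powr 0.6\<rceil>) * (1 / (1 + T powr 0.3) ^ 3)) \<longlongrightarrow> 0) at_top"
    by real_asymp
  have c: "((\<lambda>T::real. sqrt T / real (nat \<lceil>T powr 0.6\<rceil>)) \<longlongrightarrow> 0) at_top"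
    by real_asymp
  have d: "((\<lambda>T::real. 1 / real (nat \<lceil>T powr 0.6\<rceil>)) \<longlongrightarrow> 0) at_top"
    by real_asymp
  have e: "((\<lambda>T::real. 1 / (1 + T powr 0.3)\<^sup>2) \<longlongrightarrow> 0) at_top"
    by real_asymp
  note abcde = filterlim_compose[OF a T] filterlim_compose[OF b T] filterlim_compose[OF c T]
    filterlim_compose[OF d T] filterlim_compose[OF e T]
  have "((\<lambda>k. sqrt (D * (real (nat \<lceil>T k powr 0.6\<rceil>) * T k powr 0.3 / T k))
      + 8 * C * (real (nat \<lceil>T k powr 0.6\<rceil>) * (1 / (1 + T k powr 0.3) ^ 3))
      + K * D * (sqrt (T k) / real (nat \<lceil>T k powr 0.6\<rceil>)) + D\<^sup>2 * (1 / real (nat \<lceil>T k powr 0.6\<rceil>))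
      + D * (real (nat \<lceil>T k powr 0.6\<rceil>) * T k powr 0.3 / T k + 1 / (1 + T k powr 0.3)\<^sup>2)) \<longlongrightarrow>
      sqrt (D * 0) + 8 * C * 0 + K * D * 0 + D\<^sup>2 * 0 + D * (0 + 0)) F"
    by (intro tendsto_intros abcde)
  then show ?thesis by (simp add: mult_ac)
qed

section \<open>From paths to Feynman-Kac averages\<close>

text \<open>Finite sums of exponentials with arbitrary real frequencies. The inductive form lets a
  statement that is additive in the function be verified on a single exponential, where expectations
  become characteristic functions.\<close>

inductive trig_poly :: "(real \<Rightarrow> complex) \<Rightarrow> bool" where
  iexp: "trig_poly (\<lambda>x. a * iexp (\<omega> * x))"
| add: "trig_poly f \<Longrightarrow> trig_poly g \<Longrightarrow> trig_poly (\<lambda>x. f x + g x)"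

lemma trig_poly_mult:
  assumes "trig_poly f" "trig_poly g"
  shows "trig_poly (\<lambda>x. f x * g x)"
  using assms(1)
proof induction
  case (iexp a \<omega>)
  show ?case using assms(2)
  proof induction
    case (iexp b \<upsilon>)
    have "(\<lambda>x. a * iexp (\<omega> * x) * (b * iexp (\<upsilon> * x))) = (\<lambda>x. (a * b) * iexp ((\<omega> + \<upsilon>) * x))"
      by (auto simp: algebra_simps exp_add)
    then show ?case by (metis trig_poly.iexp)
  next
    case (add f g)
    then show ?case by (simp add: distrib_left trig_poly.add)
  qed
next
  case (add f g)
  then show ?case by (simp add: distrib_right trig_poly.add)
qed

lemma trig_poly_bounded: "trig_poly f \<Longrightarrow> \<exists>b\<ge>0. \<forall>x. norm (f x) \<le> b"
proof (induction rule: trig_poly.induct)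
  case (iexp a \<omega>)
  show ?case by (rule exI[of _ "norm a"]) (auto simp: norm_mult)
next
  case (add f g)
  then obtain b c where "0 \<le> b" "\<forall>x. norm (f x) \<le> b" "0 \<le> c" "\<forall>x. norm (g x) \<le> c" by blast
  then show ?case by (intro exI[of _ "b + c"]) (auto intro: norm_triangle_le add_mono)
qed

lemma trig_poly_measurable: "trig_poly f \<Longrightarrow> f \<in> borel_measurable borel"
  by (induction rule: trig_poly.induct) auto

text \<open>Induction on the construction of the polynomial: the linear case is Euler's formula for
  the sine, products are handled by \<open>trig_poly_mult\<close>.\<close>

lemma trig_poly_polynomial_sin:
  assumes "real_polynomial_function (p :: real \<Rightarrow> real)"
  shows "trig_poly (\<lambda>x. complex_of_real (p (sin (\<omega> * x))))"
  using assms
proof induction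
  case (linear f)
  have f: "f y = f 1 * y" for y
    using linear_scale[OF bounded_linear.linear[OF linear], of y 1] by (simp add: mult.commute)
  have "complex_of_real (f (sin (\<omega> * x))) = (f 1 / (2 * \<i>)) * iexp (\<omega> * x) + (- f 1 / (2 * \<i>)) * iexp ((- \<omega>) * x)" for x
    by (subst f) (simp add: sin_of_real[symmetric] sin_exp_eq field_simps)
  then show ?case by (simp only:) (intro trig_poly.intros)
next
  case (const c)
  show ?case using trig_poly.iexp[of "complex_of_real c" 0] by simp
next
  case (add f g)
  then show ?case using trig_poly.add by (simp add: of_real_add)
next
  case (mult f g)
  then show ?case using trig_poly_mult by (simp add: of_real_mult)
qed

text \<open>On \<open>[-A, A]\<close> the exponential is a continuous function of \<open>sin (\<pi> x / (2 A))\<close>; polynomials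
  in that sine are bounded trigonometric polynomials on the whole line.\<close>

lemma exp_trig_poly_approx:
  fixes A \<eta> :: real
  assumes "0 < A" "0 < \<eta>"
  obtains \<phi> :: "real \<Rightarrow> real" where "trig_poly (\<lambda>x. complex_of_real (\<phi> x))"
    "\<And>x. \<bar>x\<bar> \<le> A \<Longrightarrow> \<bar>exp x - \<phi> x\<bar> \<le> \<eta>" "\<And>x. \<bar>\<phi> x\<bar> \<le> exp A + \<eta>"
proof -
  define f where "f y = exp ((2 * A / pi) * arcsin y)" for y :: real
  have "continuous_on {-1..1} f" unfolding f_def by (intro continuous_intros continuous_on_arcsin') auto
  then obtain p where p: "real_polynomial_function p" "\<And>y. y \<in> {-1..1} \<Longrightarrow> \<bar>f y - p y\<bar> < \<eta>"
    using Stone_Weierstrass_real_polynomial_function[of "{-1..1}" f \<eta>] assms by (metis compact_Icc)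
  define \<phi> where "\<phi> x = p (sin ((pi / (2 * A)) * x))" for x
  show ?thesis
  proof
    show "trig_poly (\<lambda>x. complex_of_real (\<phi> x))"
      unfolding \<phi>_def by (rule trig_poly_polynomial_sin[OF p(1)])
    fix x :: real
    have s: "sin ((pi / (2 * A)) * x) \<in> {-1..1}" by simp
    show "\<bar>exp x - \<phi> x\<bar> \<le> \<eta>" if x: "\<bar>x\<bar> \<le> A"
    proof -
      have "\<bar>(pi / (2 * A)) * x\<bar> = (pi / (2 * A)) * \<bar>x\<bar>" using assms by (simp add: abs_mult)
      also have "\<dots> \<le> (pi / (2 * A)) * A" using x assms by (intro mult_left_mono) auto
      finally have "\<bar>(pi / (2 * A)) * x\<bar> \<le> pi / 2" using assms by simp
      then have "arcsin (sin ((pi / (2 * A)) * x)) = (pi / (2 * A)) * x"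
        by (intro arcsin_sin) (simp_all only: abs_le_iff, linarith+)
      then have "f (sin ((pi / (2 * A)) * x)) = exp x" using assms by (simp add: f_def)
      then show ?thesis using p(2)[OF s] by (simp add: \<phi>_def)
    qed
    have "f (sin ((pi / (2 * A)) * x)) \<le> exp ((2 * A / pi) * (pi / 2))"
      unfolding f_def using assms arcsin_ubound[of "sin ((pi / (2 * A)) * x)"] s
      by (subst exp_le_cancel_iff, intro mult_left_mono) auto
    also have "\<dots> = exp A" by simp
    finally have "f (sin ((pi / (2 * A)) * x)) \<le> exp A" .
    moreover have "0 \<le> f (sin ((pi / (2 * A)) * x))" by (simp add: f_def)
    ultimately show "\<bar>\<phi> x\<bar> \<le> exp A + \<eta>" using p(2)[OF s] unfolding \<phi>_def by linarith
  qed
qed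

text \<open>Outside [-A, A] both terms are controlled by exp|x|, and exp|x| \<le> exp(-A) exp(2|x|)
  there. The second exponential moment thus makes the tail small, which is why moments of exp(2|X|)
  are the ones estimated throughout.\<close>

lemma exp_trig_poly_error:
  fixes A \<eta> x p :: real
  assumes "0 < \<eta>" "\<bar>x\<bar> \<le> A \<Longrightarrow> \<bar>exp x - p\<bar> \<le> \<eta>" "\<bar>p\<bar> \<le> exp A + \<eta>"
  shows "\<bar>exp x - p\<bar> \<le> \<eta> + 2 * exp (- A) * exp (2 * \<bar>x\<bar>)"
proof (cases "\<bar>x\<bar> \<le> A")
  case True
  then show ?thesis using assms(2) by (smt (verit) exp_gt_zero mult_nonneg_nonneg)
next
  case False
  have "exp x \<le> exp \<bar>x\<bar>" "exp A \<le> exp \<bar>x\<bar>" using False by auto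
  then have "\<bar>exp x - p\<bar> \<le> \<eta> + 2 * exp \<bar>x\<bar>" using assms(3) by (smt (verit) exp_gt_zero)
  also have "exp \<bar>x\<bar> \<le> exp (- A) * exp (2 * \<bar>x\<bar>)" using False by (simp flip: exp_add)
  finally show ?thesis by simp
qed

text \<open>Exchange of limits in a form where the approximating sequence and its limit may be
  chosen anew for every e.\<close>

lemma tendsto_uniform_approx:
  fixes x :: "'b \<Rightarrow> 'a::real_normed_vector"
  assumes "\<And>e. 0 < e \<Longrightarrow> \<exists>y y'. (y \<longlongrightarrow> y') F \<and> (\<forall>\<^sub>F n in F. norm (x n - y n) \<le> e) \<and> norm (x' - y') \<le> e"
  shows "(x \<longlongrightarrow> x') F"
proof (rule tendstoI)
  fix e :: real assume "0 < e"
  then obtain y y' where y: "(y \<longlongrightarrow> y') F" "\<forall>\<^sub>F n in F. norm (x n - y n) \<le> e / 4" "norm (x' - y') \<le> e / 4"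
    using assms[of "e / 4"] by auto
  have "\<forall>\<^sub>F n in F. dist (y n) y' < e / 4" using y(1) \<open>0 < e\<close> by (intro tendstoD) auto
  with y(2) show "\<forall>\<^sub>F n in F. dist (x n) x' < e"
  proof eventually_elim
    case (elim n)
    have "norm (x n - x') \<le> norm (x n - y n) + norm (y n - y') + norm (x' - y')"
      using norm_triangle_ineq[of "x n - y n" "y n - y'"] norm_triangle_ineq4[of "x n - y'" "x' - y'"] by simp
    then show ?case using elim y(3) \<open>0 < e\<close> by (simp add: dist_norm)
  qed
qed

section \<open>Averages of functionals over random paths\<close>

text \<open>In the application \<open>G w\<close> is g(x + B_t) and \<open>X w s\<close> is the
  exponent along the path of w. The full-measure condition is kept as a set \<open>good\<close>
  because the moments quantify over arbitrary finite families of paths, each of which must be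
  admissible.\<close>

locale random_functionals = S: prob_space M + O: prob_space Om
  for M :: "'s measure" and Om :: "'w measure" +
  fixes G :: "'w \<Rightarrow> real" and good :: "'w set"
  assumes G_integrable: "integrable Om G"
    and good_space: "good \<subseteq> space Om"
    and AE_good: "AE w in Om. w \<in> good"
begin

sublocale OM: pair_sigma_finite Om M ..

lemma G_measurable[measurable]: "G \<in> borel_measurable Om"
  using G_integrable by auto

text \<open>Pairs of a frequency and a path. In a list paths may be repeated, and one more pair can
  be put in front, which is what the induction over moments does.\<close>

definition lin :: "(real \<times> 'w) list \<Rightarrow> ('w \<Rightarrow> 's \<Rightarrow> real) \<Rightarrow> 's \<Rightarrow> real" where
  "lin L X s = (\<Sum>p\<leftarrow>L. fst p * X (snd p) s)"

definition avg :: "(real \<Rightarrow> complex) \<Rightarrow> ('w \<Rightarrow> 's \<Rightarrow> real) \<Rightarrow> 's \<Rightarrow> complex" where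
  "avg \<phi> X s = (\<integral>w. complex_of_real (G w) * \<phi> (X w s) \<partial>Om)"

context
  fixes X :: "'w \<Rightarrow> 's \<Rightarrow> real"
  assumes X[measurable]: "(\<lambda>(w, s). X w s) \<in> borel_measurable (Om \<Otimes>\<^sub>M M)"
begin

lemma section_measurable: "w \<in> space Om \<Longrightarrow> X w \<in> borel_measurable M"
  using measurable_compose[OF measurable_Pair1' X, of w] by simp

lemma lin_measurable: "snd ` set L \<subseteq> good \<Longrightarrow> lin L X \<in> borel_measurable M"
proof (induction L)
  case (Cons p L)
  then have [measurable]: "lin L X \<in> borel_measurable M" "X (snd p) \<in> borel_measurable M"
    using good_space by (auto intro: section_measurable)
  have "lin (p # L) X = (\<lambda>s. fst p * X (snd p) s + lin L X s)" by (auto simp: lin_def)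
  then show ?case by simp
qed (simp add: lin_def[abs_def])

lemma avg_measurable:
  assumes [measurable]: "\<phi> \<in> borel_measurable borel"
  shows "avg \<phi> X \<in> borel_measurable M"
  unfolding avg_def[abs_def] using measurable_compose[OF measurable_pair_swap' X]
  by (intro O.borel_measurable_lebesgue_integral) (simp add: case_prod_beta')

lemma norm_avg_le:
  assumes "\<And>x. norm (\<phi> x) \<le> b" "0 \<le> b"
  shows "norm (avg \<phi> X s) \<le> b * (\<integral>w. \<bar>G w\<bar> \<partial>Om)"
proof -
  have "norm (avg \<phi> X s) \<le> (\<integral>w. norm (complex_of_real (G w) * \<phi> (X w s)) \<partial>Om)"
    unfolding avg_def by (rule integral_norm_bound)
  also have "\<dots> \<le> (\<integral>w. b * \<bar>G w\<bar> \<partial>Om)"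
  proof (rule integral_mono')
    fix w show "norm (complex_of_real (G w) * \<phi> (X w s)) \<le> b * \<bar>G w\<bar>"
      using assms mult_right_mono[OF assms(1)[of "X w s"], of "\<bar>G w\<bar>"] by (simp add: norm_mult mult.commute)
  qed (use G_integrable assms in auto)
  finally show ?thesis by simp
qed

text \<open>Turns one factor of a moment into an integral over a fresh path, with the remaining
  factors collected in \<psi>.\<close>

lemma avg_Fubini:
  assumes [measurable]: "\<phi> \<in> borel_measurable borel" "\<psi> \<in> borel_measurable M"
    and b: "\<And>x. norm (\<phi> x) \<le> b" "0 \<le> b" "\<And>s. s \<in> space M \<Longrightarrow> norm (\<psi> s) \<le> d" "0 \<le> d"
  shows "(\<integral>s. \<psi> s * avg \<phi> X s \<partial>M) = (\<integral>w. complex_of_real (G w) * (\<integral>s. \<psi> s * \<phi> (X w s) \<partial>M) \<partial>Om)"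
proof -
  let ?F = "\<lambda>(w, s). complex_of_real (G w) * (\<psi> s * \<phi> (X w s))"
  have i: "integrable (Om \<Otimes>\<^sub>M M) ?F"
  proof (rule Bochner_Integration.integrable_bound)
    show "integrable (Om \<Otimes>\<^sub>M M) (\<lambda>x. d * b * G (fst x))"
    proof (rule OM.Fubini_integrable)
      show "integrable Om (\<lambda>w. \<integral>s. norm (d * b * G (fst (w, s))) \<partial>M)"
        using G_integrable by (simp add: S.prob_space)
    qed auto
    show "?F \<in> borel_measurable (Om \<Otimes>\<^sub>M M)" using X by (simp add: case_prod_beta')
    show "AE x in Om \<Otimes>\<^sub>M M. norm (?F x) \<le> norm (d * b * G (fst x))"
    proof (rule AE_I2)
      fix x assume "x \<in> space (Om \<Otimes>\<^sub>M M)"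
      then obtain w s where x: "x = (w, s)" "s \<in> space M" by (auto simp: space_pair_measure)
      have "norm (\<psi> s) * norm (\<phi> (X w s)) \<le> d * b" using b x by (intro mult_mono) auto
      then have "\<bar>G w\<bar> * (norm (\<psi> s) * norm (\<phi> (X w s))) \<le> \<bar>G w\<bar> * (d * b)" by (rule mult_left_mono) auto
      then show "norm (?F x) \<le> norm (d * b * G (fst x))"
        using b x by (simp add: norm_mult abs_mult mult_ac)
    qed
  qed
  have "(\<integral>s. \<psi> s * avg \<phi> X s \<partial>M) = (\<integral>s. \<integral>w. complex_of_real (G w) * (\<psi> s * \<phi> (X w s)) \<partial>Om \<partial>M)"
    unfolding avg_def
    by (intro Bochner_Integration.integral_cong refl) (simp flip: integral_mult_right_zero add: mult_ac)
  also have "\<dots> = (\<integral>w. \<integral>s. complex_of_real (G w) * (\<psi> s * \<phi> (X w s)) \<partial>M \<partial>Om)"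
    using OM.Fubini_integral[OF i] by simp
  finally show ?thesis by simp
qed

text \<open>\<open>iexp\<close> is Lipschitz, so the L1 distance of the two averages suffices. By
  Fubini it is computed path by path, where the pointwise error and the bound q on the second
  exponential moment apply uniformly.\<close>

lemma exp_avg_error:
  fixes \<phi> :: "real \<Rightarrow> real"
  assumes [measurable]: "\<phi> \<in> borel_measurable borel" and "0 < \<eta>" "0 \<le> b"
    and \<phi>: "\<And>x. \<bar>\<phi> x\<bar> \<le> b" "\<And>x. \<bar>exp x - \<phi> x\<bar> \<le> \<eta> + 2 * exp (- A) * exp (2 * \<bar>x\<bar>)"
    and Q: "\<And>w. w \<in> good \<Longrightarrow> integrable M (\<lambda>s. exp (2 * \<bar>X w s\<bar>))"
      "\<And>w. w \<in> good \<Longrightarrow> (\<integral>s. exp (2 * \<bar>X w s\<bar>) \<partial>M) \<le> q"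
  shows "norm ((\<integral>s. iexp (u * (\<integral>w. G w * exp (X w s) \<partial>Om)) \<partial>M) - (\<integral>s. iexp (u * (\<integral>w. G w * \<phi> (X w s) \<partial>Om)) \<partial>M))
    \<le> \<bar>u\<bar> * ((\<eta> + 2 * exp (- A) * q) * (\<integral>w. \<bar>G w\<bar> \<partial>Om))"
proof -
  let ?U = "\<lambda>s. \<integral>w. G w * exp (X w s) \<partial>Om" and ?V = "\<lambda>s. \<integral>w. G w * \<phi> (X w s) \<partial>Om"
  have X': "(\<lambda>(s, w). X w s) \<in> borel_measurable (M \<Otimes>\<^sub>M Om)"
    using measurable_compose[OF measurable_pair_swap' X] by (simp add: case_prod_beta')
  note X'[measurable]
  have [measurable]: "(\<lambda>s. \<integral>w. G w * exp (X w s) \<partial>Om) \<in> borel_measurable M"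
    "(\<lambda>s. \<integral>w. G w * \<phi> (X w s) \<partial>Om) \<in> borel_measurable M"
    using X' by (auto intro!: O.borel_measurable_lebesgue_integral simp: case_prod_beta')
  let ?e2 = "\<lambda>w s. exp (2 * \<bar>X w s\<bar>)"
  have i2: "integrable (Om \<Otimes>\<^sub>M M) (\<lambda>(w, s). \<bar>G w\<bar> * ?e2 w s)"
  proof (rule OM.Fubini_integrable)
    show "(\<lambda>(w, s). \<bar>G w\<bar> * ?e2 w s) \<in> borel_measurable (Om \<Otimes>\<^sub>M M)" using X by (simp add: case_prod_beta')
    show "AE w in Om. integrable M (\<lambda>s. (case (w, s) of (w, s) \<Rightarrow> \<bar>G w\<bar> * ?e2 w s))"
      using AE_good by eventually_elim (use Q in auto)
    have m: "(\<lambda>w. \<integral>s. \<bar>G w\<bar> * ?e2 w s \<partial>M) \<in> borel_measurable Om"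
      using X by (intro S.borel_measurable_lebesgue_integral) (simp add: case_prod_beta')
    show "integrable Om (\<lambda>w. \<integral>s. norm (case (w, s) of (w, s) \<Rightarrow> \<bar>G w\<bar> * ?e2 w s) \<partial>M)"
    proof (rule Bochner_Integration.integrable_bound[where f = "\<lambda>w. q * \<bar>G w\<bar>"])
      show "AE w in Om. norm (\<integral>s. norm (case (w, s) of (w, s) \<Rightarrow> \<bar>G w\<bar> * ?e2 w s) \<partial>M) \<le> norm (q * \<bar>G w\<bar>)"
        using AE_good
      proof eventually_elim
        case (elim w)
        have "0 \<le> (\<integral>s. ?e2 w s \<partial>M)" by simp
        then have "0 \<le> q" using Q(2)[OF elim] by linarith
        then show ?case using Q(2)[OF elim] mult_right_mono[OF Q(2)[OF elim], of "\<bar>G w\<bar>"] by (simp add: abs_mult mult.commute[of "\<bar>G w\<bar>"])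
      qed
    qed (use G_integrable m in \<open>auto simp: abs_mult\<close>)
  qed
  have iexp: "integrable (Om \<Otimes>\<^sub>M M) (\<lambda>(w, s). G w * exp (X w s))"
  proof (rule Bochner_Integration.integrable_bound[OF i2])
    show "(\<lambda>(w, s). G w * exp (X w s)) \<in> borel_measurable (Om \<Otimes>\<^sub>M M)" using X by (simp add: case_prod_beta')
  qed (auto simp: abs_mult split: prod.splits intro!: AE_I2 mult_left_mono)
  have iG: "integrable (Om \<Otimes>\<^sub>M M) (\<lambda>(w, s). c * \<bar>G w\<bar>)" for c
  proof (rule OM.Fubini_integrable)
    show "integrable Om (\<lambda>w. \<integral>s. norm (case (w, s) of (w, s) \<Rightarrow> c * \<bar>G w\<bar>) \<partial>M)"
      using G_integrable by (simp add: S.prob_space)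
  qed (auto simp: case_prod_beta')
  have iphi: "integrable (Om \<Otimes>\<^sub>M M) (\<lambda>(w, s). G w * \<phi> (X w s))"
  proof (rule Bochner_Integration.integrable_bound[OF iG[of b]])
    show "(\<lambda>(w, s). G w * \<phi> (X w s)) \<in> borel_measurable (Om \<Otimes>\<^sub>M M)" using X by (simp add: case_prod_beta')
    show "AE x in Om \<Otimes>\<^sub>M M. norm (case x of (w, s) \<Rightarrow> G w * \<phi> (X w s)) \<le> norm (case x of (w, s) \<Rightarrow> b * \<bar>G w\<bar>)"
      using \<phi>(1) \<open>0 \<le> b\<close> by (auto simp: abs_mult mult.commute[of b] split: prod.splits intro!: AE_I2 mult_left_mono)
  qed
  let ?D = "\<lambda>(w, s). \<bar>G w * exp (X w s) - G w * \<phi> (X w s)\<bar>"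
  have iD: "integrable (Om \<Otimes>\<^sub>M M) ?D"
    using integrable_abs[OF Bochner_Integration.integrable_diff[OF iexp iphi]] by (simp add: case_prod_beta')
  have "norm ((\<integral>s. iexp (u * ?U s) \<partial>M) - (\<integral>s. iexp (u * ?V s) \<partial>M))
    = norm (\<integral>s. iexp (u * ?U s) - iexp (u * ?V s) \<partial>M)"
    by (subst Bochner_Integration.integral_diff) (auto intro!: S.integrable_iexp)
  also have "\<dots> \<le> (\<integral>s. norm (iexp (u * ?U s) - iexp (u * ?V s)) \<partial>M)"
    by (rule integral_norm_bound)
  also have "\<dots> \<le> (\<integral>s. \<bar>u\<bar> * (\<integral>w. ?D (w, s) \<partial>Om) \<partial>M)"
  proof (rule integral_mono_AE)
    show "integrable M (\<lambda>s. norm (iexp (u * ?U s) - iexp (u * ?V s)))"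
      by (intro integrable_norm Bochner_Integration.integrable_diff S.integrable_iexp) auto
    show "integrable M (\<lambda>s. \<bar>u\<bar> * (\<integral>w. ?D (w, s) \<partial>Om))"
      using OM.integrable_snd[of "\<lambda>w s. ?D (w, s)"] iD by simp
    have "AE s in M. integrable Om (\<lambda>w. G w * exp (X w s))"
      using OM.AE_integrable_snd[of "\<lambda>w s. G w * exp (X w s)"] iexp by simp
    moreover have "AE s in M. integrable Om (\<lambda>w. G w * \<phi> (X w s))"
      using OM.AE_integrable_snd[of "\<lambda>w s. G w * \<phi> (X w s)"] iphi by simp
    ultimately show "AE s in M. norm (iexp (u * ?U s) - iexp (u * ?V s))
        \<le> \<bar>u\<bar> * (\<integral>w. ?D (w, s) \<partial>Om)"
    proof eventually_elim
      case (elim s)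
      have "norm (iexp (u * ?U s) - iexp (u * ?V s))
        \<le> \<bar>u * ?U s - u * ?V s\<bar>"
        by (rule norm_iexp_diff_le)
      also have "\<dots> = \<bar>u\<bar> * \<bar>\<integral>w. G w * exp (X w s) - G w * \<phi> (X w s) \<partial>Om\<bar>"
        unfolding Bochner_Integration.integral_diff[OF elim] by (simp add: abs_mult flip: right_diff_distrib)
      also have "\<dots> \<le> \<bar>u\<bar> * (\<integral>w. ?D (w, s) \<partial>Om)"
        by (intro mult_left_mono) (simp_all add: integral_abs_bound)
      finally show ?case .
    qed
  qed
  also have "\<dots> = \<bar>u\<bar> * (\<integral>w. \<integral>s. ?D (w, s) \<partial>M \<partial>Om)"
    using OM.Fubini_integral[of "\<lambda>w s. ?D (w, s)"] iD by simp
  also have "(\<integral>w. \<integral>s. ?D (w, s) \<partial>M \<partial>Om) \<le> (\<integral>w. (\<eta> + 2 * exp (- A) * q) * \<bar>G w\<bar> \<partial>Om)"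
  proof (rule integral_mono_AE)
    show "integrable Om (\<lambda>w. \<integral>s. ?D (w, s) \<partial>M)"
      using OM.integrable_fst[of "\<lambda>w s. ?D (w, s)"] iD by simp
    show "AE w in Om. (\<integral>s. ?D (w, s) \<partial>M) \<le> (\<eta> + 2 * exp (- A) * q) * \<bar>G w\<bar>"
      using AE_good
    proof eventually_elim
      case (elim w)
      have "(\<integral>s. ?D (w, s) \<partial>M) \<le> (\<integral>s. \<bar>G w\<bar> * (\<eta> + 2 * exp (- A) * ?e2 w s) \<partial>M)"
      proof (rule integral_mono')
        show "integrable M (\<lambda>s. \<bar>G w\<bar> * (\<eta> + 2 * exp (- A) * ?e2 w s))" using Q(1)[OF elim] by auto
        fix s
        have "?D (w, s) = \<bar>G w\<bar> * \<bar>exp (X w s) - \<phi> (X w s)\<bar>" by (simp add: abs_mult flip: right_diff_distrib)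
        also have "\<dots> \<le> \<bar>G w\<bar> * (\<eta> + 2 * exp (- A) * ?e2 w s)" using \<phi>(2) by (intro mult_left_mono) auto
        finally show "?D (w, s) \<le> \<bar>G w\<bar> * (\<eta> + 2 * exp (- A) * ?e2 w s)" .
      qed (use \<open>0 < \<eta>\<close> in auto)
      also have "\<dots> = \<bar>G w\<bar> * (\<eta> + 2 * exp (- A) * (\<integral>s. ?e2 w s \<partial>M))"
        using Q(1)[OF elim] by (simp add: S.prob_space)
      also have "\<dots> \<le> \<bar>G w\<bar> * (\<eta> + 2 * exp (- A) * q)"
        using Q(2)[OF elim] by (intro mult_left_mono add_left_mono) auto
      finally show ?case by (simp add: mult.commute)
    qed
  qed (use G_integrable in auto)
  finally show ?thesis by (simp add: mult_left_mono)
qed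

end

lemma lin_Cons: "lin ((\<omega>, w) # L) X s = \<omega> * X w s + lin L X s"
  by (simp add: lin_def)

text \<open>The factor with \<open>lin\<close> makes the induction on N work: one average is opened
  by Fubini, the trigonometric polynomial on the new path is expanded, and every resulting
  exponential extends the list L by one pair. For N = 0 a joint characteristic function
  remains.\<close>

lemma avg_moments_tendsto:
  fixes X :: "nat \<Rightarrow> 'w \<Rightarrow> 's \<Rightarrow> real" and X' :: "'w \<Rightarrow> 's \<Rightarrow> real"
  assumes X: "\<And>n. (\<lambda>(w, s). X n w s) \<in> borel_measurable (Om \<Otimes>\<^sub>M M)"
    and X': "(\<lambda>(w, s). X' w s) \<in> borel_measurable (Om \<Otimes>\<^sub>M M)"
    and conv: "\<And>L. snd ` set L \<subseteq> good \<Longrightarrow>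
      (\<lambda>n. \<integral>s. iexp (lin L (X n) s) \<partial>M) \<longlonglongrightarrow> (\<integral>s. iexp (lin L X' s) \<partial>M)"
    and \<phi>: "trig_poly \<phi>" and L: "snd ` set L \<subseteq> good"
  shows "(\<lambda>n. \<integral>s. iexp (lin L (X n) s) * avg \<phi> (X n) s ^ N \<partial>M) \<longlonglongrightarrow> (\<integral>s. iexp (lin L X' s) * avg \<phi> X' s ^ N \<partial>M)"
  using L
proof (induction N arbitrary: L)
  case 0
  then show ?case using conv by simp
next
  case (Suc N)
  have [measurable]: "\<phi> \<in> borel_measurable borel" by (rule trig_poly_measurable[OF \<phi>])
  obtain b where b: "0 \<le> b" "\<And>x. norm (\<phi> x) \<le> b" using trig_poly_bounded[OF \<phi>] by blast
  define d where "d = (b * (\<integral>w. \<bar>G w\<bar> \<partial>Om)) ^ N"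
  have d: "0 \<le> d" using b by (simp add: d_def)
  define \<psi> where "\<psi> Y s = iexp (lin L Y s) * avg \<phi> Y s ^ N" for Y s
  have \<psi>b: "norm (\<psi> Y s) \<le> d" if "(\<lambda>(w, s). Y w s) \<in> borel_measurable (Om \<Otimes>\<^sub>M M)" for Y s
    unfolding \<psi>_def d_def norm_mult norm_power using norm_avg_le[OF that b(2,1)]
    by (auto intro: power_mono)
  have \<psi>m: "\<psi> Y \<in> borel_measurable M" if "(\<lambda>(w, s). Y w s) \<in> borel_measurable (Om \<Otimes>\<^sub>M M)" for Y
  proof -
    note [measurable] = lin_measurable[OF that Suc.prems] avg_measurable[OF that, of \<phi>]
    show ?thesis unfolding \<psi>_def[abs_def] by measurable
  qed
  have eq: "(\<integral>s. iexp (lin L Y s) * avg \<phi> Y s ^ Suc N \<partial>M) = (\<integral>w. complex_of_real (G w) * (\<integral>s. \<psi> Y s * \<phi> (Y w s) \<partial>M) \<partial>Om)"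
    if "(\<lambda>(w, s). Y w s) \<in> borel_measurable (Om \<Otimes>\<^sub>M M)" for Y
    using avg_Fubini[OF that, of \<phi> "\<psi> Y" b d] \<psi>m[OF that] b \<psi>b[OF that] d by (simp add: \<psi>_def mult_ac)
  \<comment> \<open>Stated for an arbitrary trigonometric polynomial f so that it can be proved by
    induction on f, while \<phi> in the remaining N factors stays fixed.\<close>
  have inner: "(\<lambda>n. \<integral>s. \<psi> (X n) s * f (X n w s) \<partial>M) \<longlonglongrightarrow> (\<integral>s. \<psi> X' s * f (X' w s) \<partial>M)"
    if w: "w \<in> good" and f: "trig_poly f" for w f
    using f
  proof induction
    case (iexp a \<omega>)
    have e: "\<psi> Y s * (a * iexp (\<omega> * Y w s)) = a * (iexp (lin ((\<omega>, w) # L) Y s) * avg \<phi> Y s ^ N)" for Y s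
      by (simp add: \<psi>_def lin_Cons exp_add algebra_simps)
    show ?case unfolding e using Suc.IH[of "(\<omega>, w) # L"] Suc.prems w
      by (auto intro!: tendsto_mult_left)
  next
    case (add f g)
    have i: "integrable M (\<lambda>s. \<psi> Y s * k (Y w s))"
      if Y: "(\<lambda>(w, s). Y w s) \<in> borel_measurable (Om \<Otimes>\<^sub>M M)" and k: "trig_poly k" for Y k
    proof -
      obtain c where c: "0 \<le> c" "\<And>x. norm (k x) \<le> c" using trig_poly_bounded[OF k] by blast
      note [measurable] = \<psi>m[OF Y] section_measurable[OF Y, of w] trig_poly_measurable[OF k]
      have [measurable]: "Y w \<in> borel_measurable M" using section_measurable[OF Y, of w] w good_space by auto
      show ?thesis
        by (rule S.integrable_const_bound[where B = "d * c"])
           (use \<psi>b[OF Y] c d in \<open>auto simp: norm_mult intro!: AE_I2 mult_mono\<close>)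
    qed
    show ?case using add i[OF X] i[OF X'] by (simp add: distrib_left tendsto_add)
  qed
  show ?case unfolding eq[OF X] eq[OF X']
  proof (rule integral_dominated_convergence[where w = "\<lambda>w. \<bar>G w\<bar> * (d * b)"])
    have "(\<lambda>w. \<integral>s. \<psi> Y s * \<phi> (Y w s) \<partial>M) \<in> borel_measurable Om"
      if Y: "(\<lambda>(w, s). Y w s) \<in> borel_measurable (Om \<Otimes>\<^sub>M M)" for Y
    proof -
      note [measurable] = Y \<psi>m[OF Y]
      show ?thesis by measurable
    qed
    note [measurable] = this[OF X] this[OF X']
    show "(\<lambda>w. complex_of_real (G w) * (\<integral>s. \<psi> X' s * \<phi> (X' w s) \<partial>M)) \<in> borel_measurable Om"
      "(\<lambda>w. complex_of_real (G w) * (\<integral>s. \<psi> (X n) s * \<phi> (X n w s) \<partial>M)) \<in> borel_measurable Om" for n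
      by measurable
    show "integrable Om (\<lambda>w. \<bar>G w\<bar> * (d * b))" using G_integrable by auto
    show "AE w in Om. (\<lambda>n. complex_of_real (G w) * (\<integral>s. \<psi> (X n) s * \<phi> (X n w s) \<partial>M)) \<longlonglongrightarrow>
        complex_of_real (G w) * (\<integral>s. \<psi> X' s * \<phi> (X' w s) \<partial>M)"
      using AE_good by eventually_elim (intro tendsto_mult_left inner \<phi>)
    show "AE w in Om. norm (complex_of_real (G w) * (\<integral>s. \<psi> (X n) s * \<phi> (X n w s) \<partial>M)) \<le> \<bar>G w\<bar> * (d * b)" for n
    proof (rule AE_I2)
      fix w
      have "norm (\<integral>s. \<psi> (X n) s * \<phi> (X n w s) \<partial>M) \<le> d * b"
        using \<psi>b[OF X] b d by (intro S.norm_expectation_le) (auto simp: norm_mult intro!: mult_mono)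
      then show "norm (complex_of_real (G w) * (\<integral>s. \<psi> (X n) s * \<phi> (X n w s) \<partial>M)) \<le> \<bar>G w\<bar> * (d * b)"
        by (simp add: norm_mult mult_left_mono)
    qed
  qed
qed

text \<open>Levy continuity, with two approximations of the characteristic function whose errors are
  uniform in n: exp is replaced by a bounded \<phi>, at a cost controlled by q, and then
  \<open>iexp\<close> of the bounded average by its Taylor polynomial, whose expectation is a
  combination of moments. The bound q is required eventually in n, which allows small values of n to
  be exceptional.\<close>

theorem exp_avg_weak_conv:
  fixes X :: "nat \<Rightarrow> 'w \<Rightarrow> 's \<Rightarrow> real" and X' :: "'w \<Rightarrow> 's \<Rightarrow> real"
  assumes X: "\<And>n. (\<lambda>(w, s). X n w s) \<in> borel_measurable (Om \<Otimes>\<^sub>M M)"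
    and X': "(\<lambda>(w, s). X' w s) \<in> borel_measurable (Om \<Otimes>\<^sub>M M)"
    and conv: "\<And>L. snd ` set L \<subseteq> good \<Longrightarrow>
      (\<lambda>n. \<integral>s. iexp (lin L (X n) s) \<partial>M) \<longlonglongrightarrow> (\<integral>s. iexp (lin L X' s) \<partial>M)"
    and Q: "\<forall>\<^sub>F n in sequentially. \<forall>w\<in>good. integrable M (\<lambda>s. exp (2 * \<bar>X n w s\<bar>)) \<and> (\<integral>s. exp (2 * \<bar>X n w s\<bar>) \<partial>M) \<le> q"
    and Q': "\<And>w. w \<in> good \<Longrightarrow> integrable M (\<lambda>s. exp (2 * \<bar>X' w s\<bar>))"
      "\<And>w. w \<in> good \<Longrightarrow> (\<integral>s. exp (2 * \<bar>X' w s\<bar>) \<partial>M) \<le> q"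
  shows "weak_conv_m (\<lambda>n. distr M borel (\<lambda>s. \<integral>w. G w * exp (X n w s) \<partial>Om))
     (distr M borel (\<lambda>s. \<integral>w. G w * exp (X' w s) \<partial>Om))"
proof -
  have meas: "(\<lambda>s. \<integral>w. G w * f (Y w s) \<partial>Om) \<in> borel_measurable M"
    if Y: "(\<lambda>(w, s). Y w s) \<in> borel_measurable (Om \<Otimes>\<^sub>M M)" and [measurable]: "f \<in> borel_measurable borel"
    for Y and f :: "real \<Rightarrow> real"
    using measurable_compose[OF measurable_pair_swap' Y]
    by (intro O.borel_measurable_lebesgue_integral) (simp add: case_prod_beta')
  have mX: "(\<lambda>s. \<integral>w. G w * exp (X n w s) \<partial>Om) \<in> borel_measurable M" for n by (rule meas[OF X]) simp
  have mX': "(\<lambda>s. \<integral>w. G w * exp (X' w s) \<partial>Om) \<in> borel_measurable M" by (rule meas[OF X']) simp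
  obtain w0 where "w0 \<in> good"
    using eventually_happens'[OF O.ae_filter_bot AE_good] by blast
  have q: "0 \<le> q"
  proof -
    have "0 \<le> (\<integral>s. exp (2 * \<bar>X' w0 s\<bar>) \<partial>M)" by simp
    then show ?thesis using Q'(2)[OF \<open>w0 \<in> good\<close>] by linarith
  qed
  define g where "g = (\<integral>w. \<bar>G w\<bar> \<partial>Om)"
  have g: "0 \<le> g" by (simp add: g_def)
  have bounded_conv: "(\<lambda>n. \<integral>s. iexp (u * (\<integral>w. G w * \<phi> (X n w s) \<partial>Om)) \<partial>M) \<longlonglongrightarrow> (\<integral>s. iexp (u * (\<integral>w. G w * \<phi> (X' w s) \<partial>Om)) \<partial>M)"
    if \<phi>: "trig_poly (\<lambda>x. complex_of_real (\<phi> x))" and b: "\<And>x. \<bar>\<phi> x\<bar> \<le> b" "0 \<le> b" for \<phi> b u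
  proof -
    have \<phi>m[measurable]: "\<phi> \<in> borel_measurable borel"
      using measurable_compose[OF trig_poly_measurable[OF \<phi>] borel_measurable_Re] by simp
    let ?v = "\<lambda>Y s. \<integral>w. G w * \<phi> (Y w s) \<partial>Om"
    have av: "avg (\<lambda>x. complex_of_real (\<phi> x)) Y s = complex_of_real (?v Y s)" for Y s
      unfolding avg_def by (simp flip: of_real_mult)
    have vb: "\<bar>?v Y s\<bar> \<le> b * g" if "(\<lambda>(w, s). Y w s) \<in> borel_measurable (Om \<Otimes>\<^sub>M M)" for Y s
      using norm_avg_le[OF that, of "\<lambda>x. complex_of_real (\<phi> x)" b s] b unfolding av g_def by simp
    define R where "R = \<bar>u\<bar> * (b * g)"
    \<comment> \<open>Taylor polynomial of \<open>iexp\<close> at u times the average. The argument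
      is bounded by R, so the remainder R^(N+1)/(N+1)! is uniform in s and in the sequence
      index.\<close>
    define p where "p N Y s = (\<Sum>k\<le>N. (\<i> * complex_of_real (u * ?v Y s)) ^ k / fact k)"
      for N and Y :: "'w \<Rightarrow> 's \<Rightarrow> real" and s
    have pE: "(\<integral>s. p N Y s \<partial>M) = (\<Sum>k\<le>N. ((\<i> * complex_of_real u) ^ k / fact k) * (\<integral>s. complex_of_real (?v Y s) ^ k \<partial>M))"
      and pi: "integrable M (p N Y)"
      if Y: "(\<lambda>(w, s). Y w s) \<in> borel_measurable (Om \<Otimes>\<^sub>M M)" for N Y
    proof -
      note [measurable] = meas[OF Y \<phi>m]
      have i: "integrable M (\<lambda>s. complex_of_real (?v Y s) ^ k)" for k
        using vb[OF Y] by (intro S.integrable_const_bound[where B = "(b * g) ^ k"] AE_I2) (auto simp: norm_power intro!: power_mono)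
      have p_eq: "p N Y s = (\<Sum>k\<le>N. ((\<i> * complex_of_real u) ^ k / fact k) * complex_of_real (?v Y s) ^ k)" for s
        unfolding p_def by (simp add: power_mult_distrib mult_ac)
      show "(\<integral>s. p N Y s \<partial>M) = (\<Sum>k\<le>N. ((\<i> * complex_of_real u) ^ k / fact k) * (\<integral>s. complex_of_real (?v Y s) ^ k \<partial>M))"
        unfolding p_eq using i by (subst Bochner_Integration.integral_sum) auto
      show "integrable M (p N Y)" unfolding p_eq[abs_def] using i by auto
    qed
    have err: "norm ((\<integral>s. iexp (u * ?v Y s) \<partial>M) - (\<integral>s. p N Y s \<partial>M)) \<le> R ^ Suc N / fact (Suc N)"
      if Y: "(\<lambda>(w, s). Y w s) \<in> borel_measurable (Om \<Otimes>\<^sub>M M)" for N Y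
    proof -
      note [measurable] = meas[OF Y \<phi>m]
      have "(\<integral>s. iexp (u * ?v Y s) \<partial>M) - (\<integral>s. p N Y s \<partial>M) = (\<integral>s. iexp (u * ?v Y s) - p N Y s \<partial>M)"
        by (rule Bochner_Integration.integral_diff[symmetric]) (auto intro!: S.integrable_iexp pi[OF Y])
      also have "norm \<dots> \<le> R ^ Suc N / fact (Suc N)"
      proof (rule S.norm_expectation_le)
        fix s
        have "norm (iexp (u * ?v Y s) - p N Y s) \<le> \<bar>u * ?v Y s\<bar> ^ Suc N / fact (Suc N)"
          unfolding p_def by (rule iexp_approx1)
        also have "\<dots> \<le> R ^ Suc N / fact (Suc N)"
          unfolding R_def abs_mult using vb[OF Y] by (intro divide_right_mono power_mono mult_left_mono) auto
        finally show "norm (iexp (u * ?v Y s) - p N Y s) \<le> R ^ Suc N / fact (Suc N)" .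
      qed (use b g in \<open>auto simp: R_def\<close>)
      finally show ?thesis .
    qed
    show ?thesis
    proof (rule tendsto_uniform_approx)
      fix e :: real assume "0 < e"
      have "(\<lambda>N. R ^ N / fact N) \<longlonglongrightarrow> 0"
        using summable_LIMSEQ_zero[OF summable_exp[of R]] by (simp add: field_simps)
      then have "(\<lambda>N. R ^ Suc N / fact (Suc N)) \<longlonglongrightarrow> 0" by (rule LIMSEQ_Suc)
      then obtain N where N: "R ^ Suc N / fact (Suc N) \<le> e"
        using \<open>0 < e\<close> by (metis (no_types, lifting) eventually_sequentially le_refl less_imp_le order_tendstoD(2))
      have "(\<lambda>n. \<integral>s. p N (X n) s \<partial>M) \<longlonglongrightarrow> (\<integral>s. p N X' s \<partial>M)"
        unfolding pE[OF X] pE[OF X']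
        using avg_moments_tendsto[OF X X' conv \<phi>, of "[]"]
        by (intro tendsto_sum tendsto_mult_left) (auto simp: av lin_def)
      then show "\<exists>y y'. y \<longlonglongrightarrow> y' \<and> (\<forall>\<^sub>F n in sequentially. norm ((\<integral>s. iexp (u * ?v (X n) s) \<partial>M) - y n) \<le> e)
          \<and> norm ((\<integral>s. iexp (u * ?v X' s) \<partial>M) - y') \<le> e"
        using order_trans[OF err[OF X, of _ N] N] order_trans[OF err[OF X', of N] N]
        by (intro exI[of _ "\<lambda>n. \<integral>s. p N (X n) s \<partial>M"] exI[of _ "\<integral>s. p N X' s \<partial>M"] conjI always_eventually allI)
    qed
  qed
  have char_conv: "(\<lambda>n. \<integral>s. iexp (u * (\<integral>w. G w * exp (X n w s) \<partial>Om)) \<partial>M) \<longlonglongrightarrow> (\<integral>s. iexp (u * (\<integral>w. G w * exp (X' w s) \<partial>Om)) \<partial>M)" for u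
  proof (rule tendsto_uniform_approx)
    fix e :: real assume e: "0 < e"
    \<comment> \<open>Chosen so that \<bar>u\<bar> * g * 2 \<eta> \<le> e; the added 1 keeps the
      denominator positive. The cutoff A is then taken so large that the tail term 2 exp(-A) q is
      also below \<eta>.\<close>
    define \<eta> where "\<eta> = e / (2 * (1 + \<bar>u\<bar> * g))"
    have ug: "0 < 1 + \<bar>u\<bar> * g" using g by (simp add: add_pos_nonneg)
    then have \<eta>: "0 < \<eta>" using e by (simp add: \<eta>_def)
    have "((\<lambda>A. 2 * exp (- A) * q) \<longlongrightarrow> 0) at_top" by real_asymp
    then have "\<forall>\<^sub>F A in at_top. 2 * exp (- A) * q < \<eta>" using \<eta> by (rule order_tendstoD)
    then have "\<forall>\<^sub>F A in at_top. 2 * exp (- A) * q < \<eta> \<and> (0::real) < A" using eventually_gt_at_top by (rule eventually_conj)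
    from eventually_happens'[OF trivial_limit_at_top_linorder this]
    obtain A where A: "2 * exp (- A) * q < \<eta>" "0 < A" by auto
    obtain \<phi> where \<phi>: "trig_poly (\<lambda>x. complex_of_real (\<phi> x))"
      "\<And>x. \<bar>x\<bar> \<le> A \<Longrightarrow> \<bar>exp x - \<phi> x\<bar> \<le> \<eta>" "\<And>x. \<bar>\<phi> x\<bar> \<le> exp A + \<eta>"
      using exp_trig_poly_approx[OF A(2) \<eta>] by blast
    have [measurable]: "\<phi> \<in> borel_measurable borel"
      using measurable_compose[OF trig_poly_measurable[OF \<phi>(1)] borel_measurable_Re] by simp
    have small: "\<bar>u\<bar> * ((\<eta> + 2 * exp (- A) * q) * g) \<le> e"
    proof -
      have "\<bar>u\<bar> * ((\<eta> + 2 * exp (- A) * q) * g) = (\<bar>u\<bar> * g) * (\<eta> + 2 * exp (- A) * q)" by simp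
      also have "\<dots> \<le> (1 + \<bar>u\<bar> * g) * (2 * \<eta>)" using A \<eta> g q by (intro mult_mono) auto
      also have "\<dots> = e"
      proof -
        have "x * (2 * (e / (2 * x))) = e" if "0 < x" for x using that by simp
        from this[OF ug] show ?thesis by (simp only: \<eta>_def)
      qed
      finally show ?thesis .
    qed
    let ?U = "\<lambda>Y. (\<integral>s. iexp (u * (\<integral>w. G w * exp (Y w s) \<partial>Om)) \<partial>M)"
    let ?V = "\<lambda>Y. (\<integral>s. iexp (u * (\<integral>w. G w * \<phi> (Y w s) \<partial>Om)) \<partial>M)"
    have err: "norm (?U Y - ?V Y) \<le> e"
      if Y: "(\<lambda>(w, s). Y w s) \<in> borel_measurable (Om \<Otimes>\<^sub>M M)"
        "\<forall>w\<in>good. integrable M (\<lambda>s. exp (2 * \<bar>Y w s\<bar>)) \<and> (\<integral>s. exp (2 * \<bar>Y w s\<bar>) \<partial>M) \<le> q" for Y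
    proof -
      have "norm (?U Y - ?V Y) \<le> \<bar>u\<bar> * ((\<eta> + 2 * exp (- A) * q) * g)"
        unfolding g_def
        by (rule exp_avg_error[OF Y(1), where b = "exp A + \<eta>"])
           (use Y(2) \<eta> \<phi> in \<open>auto intro!: exp_trig_poly_error add_nonneg_nonneg\<close>)
      then show ?thesis using small by linarith
    qed
    show "\<exists>y y'. y \<longlonglongrightarrow> y' \<and> (\<forall>\<^sub>F n in sequentially. norm (?U (X n) - y n) \<le> e) \<and> norm (?U X' - y') \<le> e"
    proof (intro exI conjI)
      show "(\<lambda>n. ?V (X n)) \<longlonglongrightarrow> ?V X'"
        using \<eta> by (intro bounded_conv[OF \<phi>(1) \<phi>(3)]) (auto intro!: add_nonneg_nonneg)
      show "\<forall>\<^sub>F n in sequentially. norm (?U (X n) - ?V (X n)) \<le> e"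
        using Q by eventually_elim (rule err[OF X])
      show "norm (?U X' - ?V X') \<le> e" using Q' by (intro err[OF X']) auto
    qed
  qed
  show ?thesis
  proof (rule levy_continuity)
    show "real_distribution (distr M borel (\<lambda>s. \<integral>w. G w * exp (X n w s) \<partial>Om))" for n
      using mX by (rule S.real_distribution_distr)
    show "real_distribution (distr M borel (\<lambda>s. \<integral>w. G w * exp (X' w s) \<partial>Om))"
      using mX' by (rule S.real_distribution_distr)
    show "(\<lambda>n. char (distr M borel (\<lambda>s. \<integral>w. G w * exp (X n w s) \<partial>Om)) u) \<longlonglongrightarrow>
        char (distr M borel (\<lambda>s. \<integral>w. G w * exp (X' w s) \<partial>Om)) u" for u
      using char_conv[of u] mX mX' by (simp add: char_def integral_distr)
  qed
qed

end

section \<open>The limiting Gaussian noise\<close>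

text \<open>Rounding r down to the dyadic grid leaves countably many values, for which measurability
  is immediate; continuity in r passes it to the limit.\<close>

lemma Caratheodory_measurable:
  fixes f :: "real \<Rightarrow> 'a \<Rightarrow> real"
  assumes m: "\<And>r. f r \<in> borel_measurable M"
    and c: "\<And>a. a \<in> space M \<Longrightarrow> continuous_on UNIV (\<lambda>r. f r a)"
  shows "(\<lambda>(r, a). f r a) \<in> borel_measurable (borel \<Otimes>\<^sub>M M)"
proof (rule borel_measurable_LIMSEQ_real)
  fix x :: "real \<times> 'a" assume x: "x \<in> space (borel \<Otimes>\<^sub>M M)"
  have l: "(\<lambda>n. real_of_int \<lfloor>fst x * 2 ^ n\<rfloor> / 2 ^ n) \<longlonglongrightarrow> fst x"
    by real_asymp
  have "isCont (\<lambda>r. f r (snd x)) (fst x)"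
    using c[of "snd x"] x by (auto simp: space_pair_measure continuous_on_eq_continuous_at)
  from isCont_tendsto_compose[OF this l]
  show "(\<lambda>n. f (real_of_int \<lfloor>fst x * 2 ^ n\<rfloor> / 2 ^ n) (snd x)) \<longlonglongrightarrow> (case x of (r, a) \<Rightarrow> f r a)"
    by (simp add: case_prod_beta')
next
  fix n :: nat
  have "(\<lambda>x. f (real_of_int i / 2 ^ n) (snd x)) \<in> borel_measurable (borel \<Otimes>\<^sub>M M)" for i :: int
    using m by measurable
  moreover have "(\<lambda>x. \<lfloor>fst x * 2 ^ n\<rfloor>) \<in> measurable ((borel :: real measure) \<Otimes>\<^sub>M M) (count_space UNIV)"
    by measurable
  ultimately show "(\<lambda>x :: real \<times> 'a. f (real_of_int \<lfloor>fst x * 2 ^ n\<rfloor> / 2 ^ n) (snd x)) \<in> borel_measurable (borel \<Otimes>\<^sub>M M)"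
    by (rule measurable_compose_countable)
qed

context prob_space
begin

text \<open>Fourier and Laplace transform at argument 1; other arguments are reached by scaling X.
  Variances are written as expectations of squares so that degenerate and nondegenerate variables
  obey the same formula.\<close>

lemma centered_gaussian:
  assumes g: "gaussian_var M X" and E: "expectation X = 0"
  shows "integrable M (\<lambda>s. (X s)\<^sup>2)"
    and "expectation (\<lambda>s. iexp (X s)) = exp (- expectation (\<lambda>s. (X s)\<^sup>2) / 2)"
    and "integrable M (\<lambda>s. exp (X s))"
    and "expectation (\<lambda>s. exp (X s)) = exp (expectation (\<lambda>s. (X s)\<^sup>2) / 2)"
proof -
  have X[measurable]: "X \<in> borel_measurable M" using g by (simp add: gaussian_var_def)
  have "integrable M (\<lambda>s. (X s)\<^sup>2) \<and> expectation (\<lambda>s. iexp (X s)) = exp (- expectation (\<lambda>s. (X s)\<^sup>2) / 2)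
    \<and> integrable M (\<lambda>s. exp (X s)) \<and> expectation (\<lambda>s. exp (X s)) = exp (expectation (\<lambda>s. (X s)\<^sup>2) / 2)"
  proof (cases "\<exists>m. AE s in M. X s = m")
    \<comment> \<open>The degenerate case occurs, for instance for the noise at time 0; centring
      forces the constant to be 0.\<close>
    case True
    then obtain m where m: "AE s in M. X s = m" by blast
    have "expectation X = expectation (\<lambda>s. m)" using m by (intro integral_cong_AE) auto
    then have "m = 0" using E by (simp add: prob_space)
    then have X0: "AE s in M. X s = 0" using m by simp
    have 1: "integrable M (\<lambda>s. (X s)\<^sup>2)" "integrable M (\<lambda>s. exp (X s))"
      using X0 by (auto intro!: integrable_const_bound[where B=1])
    have 2: "expectation (\<lambda>s. (X s)\<^sup>2) = expectation (\<lambda>s. 0)"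
      by (rule integral_cong_AE) (use X0 in \<open>auto elim!: eventually_mono\<close>)
    have 3: "expectation (\<lambda>s. exp (X s)) = expectation (\<lambda>s. 1)"
      by (rule integral_cong_AE) (use X0 in \<open>auto elim!: eventually_mono\<close>)
    have 4: "expectation (\<lambda>s. iexp (X s)) = expectation (\<lambda>s. 1)"
      by (rule integral_cong_AE) (use X0 in \<open>auto elim!: eventually_mono\<close>)
    show ?thesis using 1 unfolding 2 3 4 by (simp add: prob_space)
  next
    case False
    then obtain m \<sigma> where \<sigma>: "0 < \<sigma>" and D: "distributed M lborel X (normal_density m \<sigma>)"
      using g by (auto simp: gaussian_var_def)
    have m: "m = 0" using normal_distributed_expectation[OF \<sigma> D] E by simp
    note D = D[unfolded m]
    have i2: "integrable M (\<lambda>s. (X s)\<^sup>2)"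
      using distributed_integrable[OF D, of "\<lambda>x. x\<^sup>2"] integrable_normal_moment[OF \<sigma>, of 0 2] by simp
    have v: "expectation (\<lambda>s. (X s)\<^sup>2) = \<sigma>\<^sup>2"
      using normal_distributed_variance[OF \<sigma> D] E by simp
    have S: "distributed M lborel (\<lambda>s. X s / \<sigma>) std_normal_density"
      using normal_standard_normal_convert[OF \<sigma>, of X 0] D by simp
    have "distr M borel (\<lambda>s. X s / \<sigma>) = std_normal_distribution"
      using distributed_distr_eq_density[OF S] by (simp cong: distr_cong)
    then have "char (distr M borel (\<lambda>s. X s / \<sigma>)) \<sigma> = exp (- \<sigma>\<^sup>2 / 2)"
      by (simp add: char_std_normal_distribution)
    then have c: "expectation (\<lambda>s. iexp (X s)) = exp (- \<sigma>\<^sup>2 / 2)"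
      using \<sigma> by (simp add: char_def integral_distr)
    \<comment> \<open>Completing the square: the exponential tilt moves the mean from 0 to
      \<sigma>^2.\<close>
    have e: "normal_density 0 \<sigma> x * exp x = exp (\<sigma>\<^sup>2 / 2) * normal_density (\<sigma>\<^sup>2) \<sigma> x" for x
    proof -
      have "- (x - 0)\<^sup>2 / (2 * \<sigma>\<^sup>2) + x = \<sigma>\<^sup>2 / 2 + - (x - \<sigma>\<^sup>2)\<^sup>2 / (2 * \<sigma>\<^sup>2)"
        using \<sigma> by (simp add: field_simps power2_eq_square)
      then show ?thesis unfolding normal_density_def by (simp flip: exp_add)
    qed
    have ie: "integrable M (\<lambda>s. exp (X s))"
      using distributed_integrable[OF D, of exp] \<sigma> by (simp add: e)
    have "expectation (\<lambda>s. exp (X s)) = exp (\<sigma>\<^sup>2 / 2)"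
      using distributed_integral[OF D, of exp] \<sigma> by (simp add: e)
    then show ?thesis using i2 v c ie by simp
  qed
  then show "integrable M (\<lambda>s. (X s)\<^sup>2)"
    and "expectation (\<lambda>s. iexp (X s)) = exp (- expectation (\<lambda>s. (X s)\<^sup>2) / 2)"
    and "integrable M (\<lambda>s. exp (X s))"
    and "expectation (\<lambda>s. exp (X s)) = exp (expectation (\<lambda>s. (X s)\<^sup>2) / 2)"
    by blast+
qed

end

lemma conv_in_probD: "conv_in_prob M X Y \<Longrightarrow> 0 < \<eta> \<Longrightarrow> (\<lambda>n. measure M {s \<in> space M. \<eta> < \<bar>X n s - Y s\<bar>}) \<longlonglongrightarrow> 0"
  by (auto simp: conv_in_prob_def)

text \<open>Right end point of the level-n dyadic interval, open on the left and closed on the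
  right, that contains r. This is the point at which \<open>W_sum\<close> evaluates the
  path.\<close>

definition dyadic_ceil :: "nat \<Rightarrow> real \<Rightarrow> real" where
  "dyadic_ceil n r = real_of_int \<lceil>r * 2 ^ n\<rceil> / 2 ^ n"

lemma dyadic_ceil_tendsto: "filterlim N at_top F \<Longrightarrow> ((\<lambda>k. dyadic_ceil (N k) r) \<longlongrightarrow> r) F"
proof -
  have "(\<lambda>n. dyadic_ceil n r) \<longlonglongrightarrow> r" unfolding dyadic_ceil_def by real_asymp
  then show "filterlim N at_top F \<Longrightarrow> ?thesis" by (rule filterlim_compose)
qed

lemma dyadic_ceil_nonneg: "0 \<le> r \<Longrightarrow> 0 \<le> dyadic_ceil n r"
  unfolding dyadic_ceil_def
  by (intro divide_nonneg_pos order_trans[OF _ le_of_int_ceiling]) auto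

lemma dyadic_interval_iff:
  "r \<in> {(real k - 1) / 2 ^ n<..real k / 2 ^ n} \<longleftrightarrow> int k = \<lceil>r * 2 ^ n\<rceil>"
proof -
  have "r \<in> {(real k - 1) / 2 ^ n<..real k / 2 ^ n} \<longleftrightarrow> real k - 1 < r * 2 ^ n \<and> r * 2 ^ n \<le> real k"
    by (simp add: field_simps)
  also have "\<dots> \<longleftrightarrow> \<lceil>r * 2 ^ n\<rceil> = int k" by (simp add: ceiling_eq_iff)
  finally show ?thesis by auto
qed

lemma integral_double_sum:
  fixes f :: "'i \<Rightarrow> 'j \<Rightarrow> 'a \<Rightarrow> real"
  assumes "\<And>k l. k \<in> A \<Longrightarrow> l \<in> B \<Longrightarrow> integrable M (f k l)"
  shows "(\<integral>x. (\<Sum>k\<in>A. \<Sum>l\<in>B. f k l x) \<partial>M) = (\<Sum>k\<in>A. \<Sum>l\<in>B. \<integral>x. f k l x \<partial>M)"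
proof -
  have "(\<integral>x. (\<Sum>k\<in>A. \<Sum>l\<in>B. f k l x) \<partial>M) = (\<Sum>k\<in>A. \<integral>x. (\<Sum>l\<in>B. f k l x) \<partial>M)"
    using assms by (intro Bochner_Integration.integral_sum Bochner_Integration.integrable_sum)
  also have "\<dots> = (\<Sum>k\<in>A. \<Sum>l\<in>B. \<integral>x. f k l x \<partial>M)"
    using assms by (intro sum.cong refl Bochner_Integration.integral_sum)
  finally show ?thesis .
qed

lemma sum_sum_delta:
  fixes c :: "'i \<Rightarrow> 'j \<Rightarrow> real"
  assumes "finite A" "finite B"
  shows "(\<Sum>k\<in>A. \<Sum>l\<in>B. (if k = a then 1 else 0) * (if l = b then 1 else 0) * c k l) = of_bool (a \<in> A \<and> b \<in> B) * c a b"
proof -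
  have "(\<Sum>l\<in>B. (if k = a then 1 else 0) * (if l = b then 1 else 0) * c k l) = (if k = a then (if b \<in> B then c a b else 0) else 0)" for k
  proof (cases "k = a")
    case True
    have "(\<Sum>l\<in>B. (if k = a then 1 else 0) * (if l = b then 1 else 0) * c k l) = (\<Sum>l\<in>B. if l = b then c a b else 0)"
      by (intro sum.cong) (auto simp: True)
    then show ?thesis using assms True by simp
  qed simp
  then show ?thesis using assms by simp
qed

lemma sum_list_mult: "(\<Sum>p\<leftarrow>L. f p) * (\<Sum>q\<leftarrow>L'. g q) = (\<Sum>p\<leftarrow>L. \<Sum>q\<leftarrow>L'. f p * g q :: real)"
  by (induction L) (auto simp: algebra_simps sum_list_const_mult)

lemma integral_sum_list:
  fixes f :: "'b \<Rightarrow> 'a \<Rightarrow> real"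
  assumes "\<And>p. p \<in> set L \<Longrightarrow> integrable M (f p)"
  shows "integrable M (\<lambda>s. \<Sum>p\<leftarrow>L. f p s)" "(\<integral>s. (\<Sum>p\<leftarrow>L. f p s) \<partial>M) = (\<Sum>p\<leftarrow>L. \<integral>s. f p s \<partial>M)"
  using assms by (induction L) auto

lemma tendsto_sum_list:
  fixes f :: "'b \<Rightarrow> nat \<Rightarrow> real"
  assumes "\<And>p. p \<in> set L \<Longrightarrow> f p \<longlonglongrightarrow> l p"
  shows "(\<lambda>n. \<Sum>p\<leftarrow>L. f p n) \<longlonglongrightarrow> (\<Sum>p\<leftarrow>L. l p)"
  using assms by (induction L) (auto intro!: tendsto_add)

section \<open>Gaussian noise and its dyadic sums along paths\<close>

locale gaussian_noise = prob_space M for M :: "'s measure" +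
  fixes W :: "real \<Rightarrow> real \<Rightarrow> 's \<Rightarrow> real" and R :: "real \<Rightarrow> real" and Rb :: real
  assumes W_cont: "\<And>s. s \<in> space M \<Longrightarrow> continuous_on ({0..} \<times> UNIV) (\<lambda>(t, x). W t x s)"
    and W_gaussian: "gaussian_field M W"
    and W_centered: "\<And>t x. 0 \<le> t \<Longrightarrow> expectation (W t x) = 0"
    and W_cov: "\<And>t t' x x'. 0 \<le> t \<Longrightarrow> 0 \<le> t' \<Longrightarrow> expectation (\<lambda>s. W t x s * W t' x' s) = min t t' * R (x - x')"
    and R_cont: "continuous_on UNIV R"
    and R_bound: "\<And>y. \<bar>R y\<bar> \<le> Rb"
begin

text \<open>Linear span of the noise. All Riemann sums, their differences and their combinations lie
  in it and are therefore centred Gaussian, without any bookkeeping of index sets.\<close>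

inductive_set wspan :: "('s \<Rightarrow> real) set" where
  "0 \<le> t \<Longrightarrow> (\<lambda>s. a * W t x s) \<in> wspan"
| "X \<in> wspan \<Longrightarrow> Y \<in> wspan \<Longrightarrow> (\<lambda>s. X s + Y s) \<in> wspan"

lemma wspan_scale: "X \<in> wspan \<Longrightarrow> (\<lambda>s. b * X s) \<in> wspan"
proof (induction rule: wspan.induct)
  case (1 t a x)
  then show ?case using wspan.intros(1)[of t "b * a" x] by (simp add: mult.assoc)
next
  case (2 X Y)
  then show ?case using wspan.intros(2) by (simp add: distrib_left)
qed

lemma wspan_0: "(\<lambda>s. 0) \<in> wspan"
  using wspan.intros(1)[of 0 0 0] by simp

lemma wspan_sum: "(\<And>i. i \<in> I \<Longrightarrow> X i \<in> wspan) \<Longrightarrow> (\<lambda>s. \<Sum>i\<in>I. X i s) \<in> wspan"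
  by (induction I rule: infinite_finite_induct) (auto intro: wspan_0 wspan.intros(2))

lemma wspan_sum_list: "(\<And>i. i \<in> set L \<Longrightarrow> X i \<in> wspan) \<Longrightarrow> (\<lambda>s. \<Sum>i\<leftarrow>L. X i s) \<in> wspan"
  by (induction L) (auto intro: wspan_0 wspan.intros(2))

lemma wspan_diff: "X \<in> wspan \<Longrightarrow> Y \<in> wspan \<Longrightarrow> (\<lambda>s. X s - Y s) \<in> wspan"
  using wspan.intros(2)[OF _ wspan_scale[of Y "-1"], of X] by simp

lemma wspan_W: "0 \<le> t \<Longrightarrow> W t x \<in> wspan"
  using wspan.intros(1)[of t 1 x] by simp

lemma wspan_gaussian:
  assumes "X \<in> wspan"
  shows "gaussian_var M X"
proof -
  have "\<exists>I a. finite I \<and> I \<subseteq> {0..} \<times> UNIV \<and> X = (\<lambda>s. \<Sum>p\<in>I. a p * W (fst p) (snd p) s)"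
    using assms
  proof induction
    case (1 t a x)
    then show ?case by (intro exI[of _ "{(t, x)}"] exI[of _ "\<lambda>_. a"]) auto
  next
    case (2 X Y)
    then obtain I a J b where I: "finite I" "I \<subseteq> {0..} \<times> UNIV" "X = (\<lambda>s. \<Sum>p\<in>I. a p * W (fst p) (snd p) s)"
      and J: "finite J" "J \<subseteq> {0..} \<times> UNIV" "Y = (\<lambda>s. \<Sum>p\<in>J. b p * W (fst p) (snd p) s)"
      by blast
    \<comment> \<open>The index sets may overlap, and the coefficients then have to be
      added.\<close>
    let ?c = "\<lambda>p. (if p \<in> I then a p else 0) + (if p \<in> J then b p else 0)"
    have "(\<Sum>p\<in>I \<union> J. ?c p * W (fst p) (snd p) s) = X s + Y s" for s
    proof -
      have "(\<Sum>p\<in>I \<union> J. ?c p * W (fst p) (snd p) s)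
        = (\<Sum>p\<in>I \<union> J. (if p \<in> I then a p * W (fst p) (snd p) s else 0)) + (\<Sum>p\<in>I \<union> J. (if p \<in> J then b p * W (fst p) (snd p) s else 0))"
        by (subst sum.distrib[symmetric], intro sum.cong) (auto simp: distrib_right)
      also have "\<dots> = X s + Y s"
        unfolding I(3) J(3) using I(1) J(1) by (simp add: sum.If_cases Int_absorb1 Int_absorb2)
      finally show ?thesis .
    qed
    then show ?case using I J by (intro exI[of _ "I \<union> J"] exI[of _ ?c]) auto
  qed
  then show ?thesis using W_gaussian by (auto simp: gaussian_field_def)
qed

lemma wspan_measurable: "X \<in> wspan \<Longrightarrow> X \<in> borel_measurable M"
  using wspan_gaussian by (auto simp: gaussian_var_def)

lemma W_measurable: "0 \<le> t \<Longrightarrow> W t x \<in> borel_measurable M"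
  by (intro wspan_measurable wspan_W)

lemma wspan_centered:
  assumes "X \<in> wspan"
  shows "integrable M X" "expectation X = 0" "integrable M (\<lambda>s. (X s)\<^sup>2)"
proof -
  have W2: "integrable M (\<lambda>s. (W t x s)\<^sup>2)" if "0 \<le> t" for t x
    using centered_gaussian(1)[OF wspan_gaussian[OF wspan_W[OF that]] W_centered[OF that]] .
  have "integrable M X \<and> expectation X = 0" using assms
  proof induction
    case (1 t a x)
    then show ?case using square_integrable_imp_integrable[OF W_measurable W2] W_centered by simp
  qed auto
  then show "integrable M X" "expectation X = 0" by auto
  then show "integrable M (\<lambda>s. (X s)\<^sup>2)" using centered_gaussian(1)[OF wspan_gaussian[OF assms]] by blast
qed

lemma wspan_product_integrable:
  assumes "X \<in> wspan" "Y \<in> wspan"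
  shows "integrable M (\<lambda>s. X s * Y s)"
proof (rule Bochner_Integration.integrable_bound[where f = "\<lambda>s. (X s)\<^sup>2 + (Y s)\<^sup>2"])
  note [measurable] = wspan_measurable[OF assms(1)] wspan_measurable[OF assms(2)]
  show "(\<lambda>s. X s * Y s) \<in> borel_measurable M" by measurable
  show "integrable M (\<lambda>s. (X s)\<^sup>2 + (Y s)\<^sup>2)"
    using wspan_centered(3)[OF assms(1)] wspan_centered(3)[OF assms(2)] by auto
  have "\<bar>a * b\<bar> \<le> a\<^sup>2 + b\<^sup>2" for a b :: real
  proof -
    have "0 \<le> (\<bar>a\<bar> - \<bar>b\<bar>)\<^sup>2" by simp
    also have "\<dots> = a\<^sup>2 + b\<^sup>2 - 2 * \<bar>a * b\<bar>" by (simp add: power2_diff abs_mult)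
    finally show ?thesis using abs_ge_zero[of "a * b"] by linarith
  qed
  then show "AE s in M. norm (X s * Y s) \<le> norm ((X s)\<^sup>2 + (Y s)\<^sup>2)"
    by (auto intro: order_trans[OF _ abs_ge_self])
qed

definition incr :: "real \<Rightarrow> real \<Rightarrow> real \<Rightarrow> 's \<Rightarrow> real" where
  "incr a b y s = W b y s - W a y s"

lemma incr_wspan: "0 \<le> a \<Longrightarrow> 0 \<le> b \<Longrightarrow> incr a b y \<in> wspan"
  unfolding incr_def[abs_def] by (intro wspan_diff wspan_W)

text \<open>The overlap length of the two time intervals is written as an integral of indicators, so
  that double sums of such covariances merge into a single time integral.\<close>

lemma incr_cov:
  assumes "0 \<le> a" "a \<le> b" "0 \<le> a'" "a' \<le> b'"
  shows "expectation (\<lambda>s. incr a b y s * incr a' b' y' s) = (\<integral>r. indicator {a<..b} r * indicator {a'<..b'} r \<partial>lborel) * R (y - y')"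
proof -
  have i: "integrable M (\<lambda>s. W t x s * W t' x' s)" if "0 \<le> t" "0 \<le> t'" for t x t' x'
    using that by (intro wspan_product_integrable wspan_W)
  have "expectation (\<lambda>s. incr a b y s * incr a' b' y' s)
    = expectation (\<lambda>s. W b y s * W b' y' s - W b y s * W a' y' s - W a y s * W b' y' s + W a y s * W a' y' s)"
    by (simp add: incr_def algebra_simps)
  also have "\<dots> = min b b' * R (y - y') - min b a' * R (y - y') - min a b' * R (y - y') + min a a' * R (y - y')"
    using assms by (simp add: i W_cov)
  also have "\<dots> = (min b b' - min b a' - min a b' + min a a') * R (y - y')"
    by (simp add: algebra_simps)
  also have "min b b' - min b a' - min a b' + min a a' = measure lborel {max a a'<..min b b'}"
    using assms by (auto simp: min_def max_def)
  also have "measure lborel {max a a'<..min b b'} = (\<integral>r. indicator {a<..b} r * indicator {a'<..b'} r \<partial>lborel)"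
  proof -
    have "indicator {a<..b} r * indicator {a'<..b'} r = (indicator {max a a'<..min b b'} r :: real)" for r
      by (auto simp: indicator_def)
    then show ?thesis by simp
  qed
  finally show ?thesis .
qed

text \<open>Says that the dyadic interval containing r is one of those summed in
  \<open>W_sum\<close> at level n. At most the last incomplete interval before t is left
  out.\<close>

definition act :: "real \<Rightarrow> nat \<Rightarrow> real \<Rightarrow> bool" where
  "act t n r \<longleftrightarrow> 0 < r \<and> \<lceil>r * 2 ^ n\<rceil> \<le> int (nat \<lfloor>t * 2 ^ n\<rfloor>)"

lemma W_sum_incr: "W_sum W t f n s = (\<Sum>k = 1..nat \<lfloor>t * 2 ^ n\<rfloor>. incr ((real k - 1) / 2 ^ n) (real k / 2 ^ n) (f (real k / 2 ^ n)) s)"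
  by (simp add: W_sum_def incr_def)

lemma W_sum_wspan: "W_sum W t f n \<in> wspan"
  unfolding W_sum_incr[abs_def] by (intro wspan_sum incr_wspan) auto

lemma W_sum_cov:
  "expectation (\<lambda>s. W_sum W t f n s * W_sum W t h m s) =
    (\<integral>r. of_bool (act t n r \<and> act t m r) * R (f (dyadic_ceil n r) - h (dyadic_ceil m r)) \<partial>lborel)"
proof -
  let ?a = "\<lambda>n k::nat. (real k - 1) / 2 ^ n" and ?b = "\<lambda>n k::nat. real k / 2 ^ n"
  let ?N = "\<lambda>n. nat \<lfloor>t * 2 ^ n\<rfloor>"
  let ?I = "\<lambda>n k. {?a n k<..?b n k}"
  have i: "integrable M (\<lambda>s. incr (?a n k) (?b n k) y s * incr (?a m l) (?b m l) y' s)"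
    if "k \<in> {1..N}" "l \<in> {1..N'}" for k l N N' y y'
    using that by (intro wspan_product_integrable incr_wspan) auto
  have "expectation (\<lambda>s. W_sum W t f n s * W_sum W t h m s)
    = expectation (\<lambda>s. \<Sum>k=1..?N n. \<Sum>l=1..?N m. incr (?a n k) (?b n k) (f (?b n k)) s * incr (?a m l) (?b m l) (h (?b m l)) s)"
    unfolding W_sum_incr by (simp add: sum_product)
  also have "\<dots> = (\<Sum>k=1..?N n. \<Sum>l=1..?N m. expectation (\<lambda>s. incr (?a n k) (?b n k) (f (?b n k)) s * incr (?a m l) (?b m l) (h (?b m l)) s))"
    by (rule integral_double_sum) (rule i)
  also have "\<dots> = (\<Sum>k=1..?N n. \<Sum>l=1..?N m. \<integral>r. indicator (?I n k) r * indicator (?I m l) r * R (f (?b n k) - h (?b m l)) \<partial>lborel)"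
    by (intro sum.cong refl) (subst incr_cov, auto simp: divide_right_mono)
  also have "\<dots> = (\<integral>r. (\<Sum>k=1..?N n. \<Sum>l=1..?N m. indicator (?I n k) r * indicator (?I m l) r * R (f (?b n k) - h (?b m l))) \<partial>lborel)"
  proof -
    have "integrable lborel (\<lambda>r. indicator (?I n k) r * indicator (?I m l) r * c :: real)" for k l c
    proof -
      have "integrable lborel (\<lambda>r. indicator (?I n k \<inter> ?I m l) r * c)"
        by (intro integrable_mult_left integrable_real_indicator emeasure_bounded_finite
            bounded_subset[OF bounded_closed_interval[of "?a n k" "?b n k"]]) auto
      then show ?thesis by (simp only: indicator_inter_arith)
    qed
    then show ?thesis
      by (intro integral_double_sum[symmetric])
  qed
  also have "\<dots> = (\<integral>r. of_bool (act t n r \<and> act t m r) * R (f (dyadic_ceil n r) - h (dyadic_ceil m r)) \<partial>lborel)"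
  proof (rule Bochner_Integration.integral_cong[OF refl])
    fix r :: real
    have ind: "indicator (?I n k) r = (of_bool (int k = \<lceil>r * 2 ^ n\<rceil>) :: real)" for n k
      using dyadic_interval_iff[of r k n] by (simp add: indicator_def)
    show "(\<Sum>k=1..?N n. \<Sum>l=1..?N m. indicator (?I n k) r * indicator (?I m l) r * R (f (?b n k) - h (?b m l)))
      = of_bool (act t n r \<and> act t m r) * R (f (dyadic_ceil n r) - h (dyadic_ceil m r))"
    proof (cases "0 < r")
      case False
      then have "\<lceil>r * 2 ^ n\<rceil> \<le> 0" for n by (simp add: mult_nonpos_nonneg)
      then have "int k \<noteq> \<lceil>r * 2 ^ n\<rceil>" if "1 \<le> k" for k n using that by (metis int_ops(2) leD of_nat_0 order_trans of_nat_le_iff not_one_le_zero)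
      then show ?thesis unfolding ind using False by (auto simp: act_def intro!: sum.neutral)
    next
      case True
      define K where "K n = nat \<lceil>r * 2 ^ n\<rceil>" for n :: nat
      have c: "0 < \<lceil>r * 2 ^ n\<rceil>" for n :: nat using True by simp
      have K: "int (K n) = \<lceil>r * 2 ^ n\<rceil>" "1 \<le> K n" for n using c[of n] unfolding K_def by linarith+
      have dy: "dyadic_ceil n r = ?b n (K n)" for n
        unfolding dyadic_ceil_def K(1)[symmetric] by simp
      have ac: "act t n r \<longleftrightarrow> K n \<in> {1..?N n}" for n
        unfolding act_def K(1)[symmetric] of_nat_le_iff atLeastAtMost_iff using True K(2) by blast
      have ind': "indicator (?I n k) r = (if k = K n then 1 else (0::real))" for n k
        unfolding ind K(1)[symmetric] by simp
      show ?thesis unfolding ind' dy ac by (rule sum_sum_delta) auto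
    qed
  qed
  finally show ?thesis .
qed

lemma act_imp: "act t n r \<Longrightarrow> 0 \<le> t \<Longrightarrow> 0 < r \<and> r \<le> t"
proof -
  assume a: "act t n r" "0 \<le> t"
  then have "\<lceil>r * 2 ^ n\<rceil> \<le> \<lfloor>t * 2 ^ n\<rfloor>" by (simp add: act_def)
  then have "r * 2 ^ n \<le> t * 2 ^ n" by linarith
  then show ?thesis using a by (simp add: act_def)
qed

text \<open>Dominated convergence in time. The two levels tend to infinity independently of each
  other, so variances along one sequence and covariances between two sequences share the same
  limit.\<close>

lemma W_sum_cov_tendsto:
  assumes t: "0 \<le> t" and f: "continuous_on {0..} f" "continuous_on {0..} h"
    and N: "filterlim N at_top sequentially" "filterlim N' at_top sequentially"
  shows "(\<lambda>k. expectation (\<lambda>s. W_sum W t f (N k) s * W_sum W t h (N' k) s)) \<longlonglongrightarrow>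
    (\<integral>r. indicator {0..t} r * R (f r - h r) \<partial>lborel)"
proof -
  let ?F = "\<lambda>k r. of_bool (act t (N k) r \<and> act t (N' k) r) * R (f (dyadic_ceil (N k) r) - h (dyadic_ceil (N' k) r))"
  have "(\<lambda>k. \<integral>r. ?F k r \<partial>lborel) \<longlonglongrightarrow> (\<integral>r. indicator {0..t} r * R (f r - h r) \<partial>lborel)"
  proof (rule integral_dominated_convergence[where w = "\<lambda>r. indicator {0..t} r * Rb"])
    have R[measurable]: "R \<in> borel_measurable borel" using R_cont by (rule borel_measurable_continuous_onI)
    \<comment> \<open>The paths are continuous on the nonnegative half-line; freezing them at 0
      gives Borel functions on the line with the same values wherever the integrands do not
      vanish.\<close>
    define f' where "f' r = f (max 0 r)" for r
    define h' where "h' r = h (max 0 r)" for r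
    have fm[measurable]: "f' \<in> borel_measurable borel" "h' \<in> borel_measurable borel"
      unfolding f'_def[abs_def] h'_def[abs_def]
      by (rule borel_measurable_continuous_onI, rule continuous_on_compose2[OF f(1)], auto intro!: continuous_intros)
         (rule borel_measurable_continuous_onI, rule continuous_on_compose2[OF f(2)], auto intro!: continuous_intros)
    have "(\<lambda>r. indicator {0..t} r * R (f' r - h' r)) \<in> borel_measurable lborel" by measurable
    also have "(\<lambda>r. indicator {0..t} r * R (f' r - h' r)) = (\<lambda>r. indicator {0..t} r * R (f r - h r))"
      by (auto simp: f'_def h'_def indicator_def fun_eq_iff max_def)
    finally show "(\<lambda>r. indicator {0..t} r * R (f r - h r)) \<in> borel_measurable lborel" .
    show "(\<lambda>r. ?F k r) \<in> borel_measurable lborel" for k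
    proof -
      have [measurable]: "dyadic_ceil n \<in> borel_measurable borel" for n
        unfolding dyadic_ceil_def[abs_def] by measurable
      have "(\<lambda>r. of_bool (act t (N k) r \<and> act t (N' k) r) * R (f' (dyadic_ceil (N k) r) - h' (dyadic_ceil (N' k) r))) \<in> borel_measurable lborel"
        unfolding act_def by measurable
      also have "(\<lambda>r. of_bool (act t (N k) r \<and> act t (N' k) r) * R (f' (dyadic_ceil (N k) r) - h' (dyadic_ceil (N' k) r)))
        = (\<lambda>r. ?F k r)"
      proof (rule ext)
        fix r
        show "of_bool (act t (N k) r \<and> act t (N' k) r) * R (f' (dyadic_ceil (N k) r) - h' (dyadic_ceil (N' k) r))
          = ?F k r"
          using dyadic_ceil_nonneg[of r] by (auto simp: f'_def h'_def act_def max_absorb2)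
      qed
      finally show ?thesis .
    qed
    show "integrable lborel (\<lambda>r. indicator {0..t} r * Rb :: real)"
      by (intro integrable_mult_left integrable_real_indicator) (auto simp: t emeasure_lborel_Icc_eq)
    show "AE r in lborel. norm (?F k r) \<le> indicator {0..t} r * Rb" for k
      using act_imp[OF _ t] R_bound order_trans[OF abs_ge_zero R_bound] by (intro AE_I2) (auto simp: indicator_def less_imp_le)
    have act: "\<forall>\<^sub>F k in sequentially. act t (N k) r" if r: "0 < r" "r < t" and N: "filterlim N at_top sequentially" for r and N :: "nat \<Rightarrow> nat"
    proof -
      have "\<forall>\<^sub>F n in sequentially. \<lceil>r * 2 ^ n\<rceil> \<le> \<lfloor>t * 2 ^ n\<rfloor>"
      proof -
        have "filterlim (\<lambda>n. (t - r) * 2 ^ n) at_top sequentially" using r by real_asymp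
        then have "\<forall>\<^sub>F n in sequentially. 1 \<le> (t - r) * 2 ^ n" by (simp add: filterlim_at_top)
        then show ?thesis
        proof eventually_elim
          case (elim n)
          then have "r * 2 ^ n + 1 \<le> t * 2 ^ n" by (simp add: algebra_simps)
          then show ?case by linarith
        qed
      qed
      then have "\<forall>\<^sub>F n in sequentially. act t n r"
        by eventually_elim (use r in \<open>auto simp: act_def\<close>)
      then show ?thesis using N by (rule eventually_compose_filterlim)
    qed
    \<comment> \<open>At r = 0 no interval is active although the limiting indicator is 1. At r = t
      activity depends on whether t lies on the grid. Both points are null.\<close>
    have "AE r in lborel. r \<noteq> 0" "AE r in lborel. r \<noteq> t" by (rule AE_lborel_singleton)+
    then show "AE r in lborel. (\<lambda>k. ?F k r)
        \<longlonglongrightarrow> indicator {0..t} r * R (f r - h r)"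
    proof eventually_elim
      case (elim r)
      show ?case
      proof (cases "0 < r \<and> r < t")
        case False
        then have "\<not> (0 < r \<and> r \<le> t)" "indicator {0..t} r = (0::real)" using elim by auto
        then have "\<not> act t n r" for n using act_imp[OF _ t] by blast
        then show ?thesis using \<open>indicator {0..t} r = (0::real)\<close> by simp
      next
        case True
        have nn: "0 \<le> dyadic_ceil n r" for n using True by (intro dyadic_ceil_nonneg) auto
        have lim: "(\<lambda>k. k' (dyadic_ceil (L k) r)) \<longlonglongrightarrow> k' r"
          if "continuous_on {0..} k'" "filterlim L at_top sequentially" for k' :: "real \<Rightarrow> real" and L
          by (rule continuous_on_tendsto_compose[OF that(1) dyadic_ceil_tendsto[OF that(2)]]) (use True nn in auto)
        have "(\<lambda>k. R (f (dyadic_ceil (N k) r) - h (dyadic_ceil (N' k) r))) \<longlonglongrightarrow> R (f r - h r)"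
          by (rule continuous_on_tendsto_compose[OF R_cont]) (auto intro!: tendsto_diff lim f N)
        moreover have "\<forall>\<^sub>F k in sequentially. R (f (dyadic_ceil (N k) r) - h (dyadic_ceil (N' k) r)) =
            ?F k r"
          using act[OF _ _ N(1), of r] act[OF _ _ N(2), of r] True by (auto elim: eventually_elim2)
        ultimately show ?thesis using True by (simp add: Lim_transform_eventually)
      qed
    qed
  qed
  then show ?thesis unfolding W_sum_cov .
qed

lemma W_sum_second_moment_le:
  assumes "0 \<le> t"
  shows "expectation (\<lambda>s. (W_sum W t f n s)\<^sup>2) \<le> Rb * t"
proof -
  have "\<bar>expectation (\<lambda>s. W_sum W t f n s * W_sum W t f n s)\<bar> \<le> (\<integral>r. Rb * indicator {0..t} r \<partial>lborel)"
    unfolding W_sum_cov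
  proof (rule abs_integral_le)
    show "integrable lborel (\<lambda>r. Rb * indicator {0..t} r :: real)"
      by (intro integrable_mult_right integrable_real_indicator) (auto simp: assms emeasure_lborel_Icc_eq)
    show "\<bar>of_bool (act t n r \<and> act t n r) * R (f (dyadic_ceil n r) - f (dyadic_ceil n r))\<bar> \<le> Rb * indicator {0..t} r" for r
      using act_imp[OF _ assms] R_bound order_trans[OF abs_ge_zero R_bound] by (auto simp: indicator_def less_imp_le)
  qed
  then show ?thesis using assms by (simp add: power2_eq_square)
qed

lemma W_sum_exp_moment:
  assumes "0 \<le> t"
  shows "integrable M (\<lambda>s. exp (2 * \<bar>W_sum W t f n s\<bar>))"
    and "expectation (\<lambda>s. exp (2 * \<bar>W_sum W t f n s\<bar>)) \<le> 2 * exp (2 * Rb * t)"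
proof -
  let ?S = "W_sum W t f n"
  have [measurable]: "?S \<in> borel_measurable M" by (intro wspan_measurable W_sum_wspan)
  have g: "integrable M (\<lambda>s. exp (c * ?S s)) \<and> expectation (\<lambda>s. exp (c * ?S s)) \<le> exp (2 * Rb * t)" if "c\<^sup>2 = 4" for c
  proof -
    \<comment> \<open>Used for c = 2 and c = -2. The variance of c times the sum is at most 4 Rb t,
      and the Laplace transform takes half of it.\<close>
    note w = wspan_scale[OF W_sum_wspan[of t f n], of c]
    have "expectation (\<lambda>s. (c * ?S s)\<^sup>2) / 2 = 2 * expectation (\<lambda>s. (?S s)\<^sup>2)"
      using that by (simp add: power_mult_distrib)
    also have "\<dots> \<le> 2 * Rb * t" using W_sum_second_moment_le[OF assms, of f n] by simp
    finally show ?thesis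
      using centered_gaussian(3,4)[OF wspan_gaussian[OF w] wspan_centered(2)[OF w]] by simp
  qed
  have le: "exp (2 * \<bar>x\<bar>) \<le> exp (2 * x) + exp (- 2 * x)" for x :: real
    by (cases "0 \<le> x") auto
  have i: "integrable M (\<lambda>s. exp (2 * ?S s) + exp (- 2 * ?S s))" using g[of 2] g[of "-2"] by simp
  show "integrable M (\<lambda>s. exp (2 * \<bar>?S s\<bar>))"
    by (rule Bochner_Integration.integrable_bound[OF i]) (use le in \<open>auto intro: order_trans[OF _ abs_ge_self]\<close>)
  have "expectation (\<lambda>s. exp (2 * \<bar>?S s\<bar>)) \<le> expectation (\<lambda>s. exp (2 * ?S s) + exp (- 2 * ?S s))"
    using i le by (intro integral_mono') (auto intro: add_nonneg_nonneg)
  also have "\<dots> \<le> 2 * exp (2 * Rb * t)" using g[of 2] g[of "-2"] by simp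
  finally show "expectation (\<lambda>s. exp (2 * \<bar>?S s\<bar>)) \<le> 2 * exp (2 * Rb * t)" .
qed

text \<open>The covariance form of the integrals of W along the paths, with coefficients in front.
  The normalised integrals of the potential will be shown to have the same limiting form.\<close>

definition limit_var :: "real \<Rightarrow> (real \<times> (real \<Rightarrow> real)) list \<Rightarrow> real" where
  "limit_var t L = (\<Sum>p\<leftarrow>L. \<Sum>q\<leftarrow>L. fst p * fst q * (\<integral>r. indicator {0..t} r * R (snd p r - snd q r) \<partial>lborel))"

lemma W_sum_char_tendsto:
  assumes t: "0 \<le> t" and L: "\<And>p. p \<in> set L \<Longrightarrow> continuous_on {0..} (snd p)"
  shows "(\<lambda>n. expectation (\<lambda>s. iexp (\<Sum>p\<leftarrow>L. fst p * W_sum W t (snd p) n s))) \<longlonglongrightarrow> exp (- limit_var t L / 2)"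
proof -
  let ?S = "\<lambda>n s. \<Sum>p\<leftarrow>L. fst p * W_sum W t (snd p) n s"
  have w: "?S n \<in> wspan" for n by (intro wspan_sum_list wspan_scale W_sum_wspan)
  have i: "integrable M (\<lambda>s. fst p * fst q * (W_sum W t (snd p) n s * W_sum W t (snd q) n s))" for p q :: "real \<times> (real \<Rightarrow> real)" and n
    by (intro integrable_mult_right wspan_product_integrable W_sum_wspan)
  have "expectation (\<lambda>s. (?S n s)\<^sup>2) = (\<Sum>p\<leftarrow>L. \<Sum>q\<leftarrow>L. fst p * fst q * expectation (\<lambda>s. W_sum W t (snd p) n s * W_sum W t (snd q) n s))" for n
  proof -
    have "(?S n s)\<^sup>2 = (\<Sum>p\<leftarrow>L. \<Sum>q\<leftarrow>L. fst p * fst q * (W_sum W t (snd p) n s * W_sum W t (snd q) n s))" for s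
      unfolding power2_eq_square sum_list_mult by (simp add: mult_ac)
    then have "expectation (\<lambda>s. (?S n s)\<^sup>2) = expectation (\<lambda>s. \<Sum>p\<leftarrow>L. \<Sum>q\<leftarrow>L. fst p * fst q * (W_sum W t (snd p) n s * W_sum W t (snd q) n s))"
      by simp
    also have "\<dots> = (\<Sum>p\<leftarrow>L. \<Sum>q\<leftarrow>L. expectation (\<lambda>s. fst p * fst q * (W_sum W t (snd p) n s * W_sum W t (snd q) n s)))"
      by (subst integral_sum_list(2), intro integral_sum_list(1) i, subst integral_sum_list(2), intro i, simp)
    finally show ?thesis by simp
  qed
  moreover have "(\<lambda>n. \<Sum>p\<leftarrow>L. \<Sum>q\<leftarrow>L. fst p * fst q * expectation (\<lambda>s. W_sum W t (snd p) n s * W_sum W t (snd q) n s)) \<longlonglongrightarrow> limit_var t L"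
    unfolding limit_var_def
    by (intro tendsto_sum_list tendsto_mult_left W_sum_cov_tendsto t L filterlim_ident)
  ultimately have v: "(\<lambda>n. expectation (\<lambda>s. (?S n s)\<^sup>2)) \<longlonglongrightarrow> limit_var t L" by simp
  have "(\<lambda>n. complex_of_real (exp (- expectation (\<lambda>s. (?S n s)\<^sup>2) / 2))) \<longlonglongrightarrow> complex_of_real (exp (- limit_var t L / 2))"
    by (intro tendsto_intros v) auto
  then show ?thesis
    unfolding centered_gaussian(2)[OF wspan_gaussian[OF w] wspan_centered(2)[OF w]] by simp
qed

text \<open>Convergence in probability carries over the Gaussian characteristic functions of the
  dyadic sums. The integrals are indexed by abstract labels rather than by paths, because the
  jointly measurable version selected later depends on the sample point of the Brownian
  motion.\<close>

lemma W_integral_char: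
  fixes L :: "(real \<times> 'b) list" and f :: "'b \<Rightarrow> real \<Rightarrow> real" and J :: "'b \<Rightarrow> 's \<Rightarrow> real"
  assumes t: "0 \<le> t" and L: "\<And>p. p \<in> set L \<Longrightarrow> continuous_on {0..} (f (snd p))"
    and J: "\<And>p. p \<in> set L \<Longrightarrow> is_W_integral M W t (f (snd p)) (J (snd p))"
  shows "expectation (\<lambda>s. iexp (\<Sum>p\<leftarrow>L. fst p * J (snd p) s)) = exp (- limit_var t (map (\<lambda>p. (fst p, f (snd p))) L) / 2)"
proof -
  let ?S = "\<lambda>n s. \<Sum>p\<leftarrow>L. fst p * W_sum W t (f (snd p)) n s" and ?J = "\<lambda>s. \<Sum>p\<leftarrow>L. fst p * J (snd p) s"
  have Sm[measurable]: "?S n \<in> borel_measurable M" for n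
    by (intro wspan_measurable wspan_sum_list wspan_scale W_sum_wspan)
  have Jm[measurable]: "J (snd p) \<in> borel_measurable M" if "p \<in> set L" for p
    using J[OF that] by (simp add: is_W_integral_def)
  have [measurable]: "?J \<in> borel_measurable M"
    using Jm by (induction L) auto
  have Wm[measurable]: "W_sum W t g n \<in> borel_measurable M" for g n
    by (intro wspan_measurable W_sum_wspan)
  have "(\<lambda>n. expectation (\<lambda>s. iexp (?S n s))) \<longlonglongrightarrow> expectation (\<lambda>s. iexp (?J s))"
  proof (rule tendsto_uniform_approx)
    fix e :: real assume e: "0 < e"
    define a where "a = (\<Sum>p\<leftarrow>L. \<bar>fst p\<bar>)"
    have a: "0 \<le> a" by (auto simp: a_def intro!: sum_list_nonneg)
    \<comment> \<open>Off the exceptional events the Lipschitz bound gives a \<eta> \<le> e/2. On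
      them the difference is at most 2, and their total probability will be below e/4.\<close>
    define \<eta> where "\<eta> = e / (2 * (1 + a))"
    have \<eta>: "0 < \<eta>" "a * \<eta> \<le> e / 2"
    proof -
      show "0 < \<eta>" using e a by (simp add: \<eta>_def)
      then have "a * \<eta> \<le> (1 + a) * \<eta>" by simp
      also have "\<dots> = e / 2" using a by (simp add: \<eta>_def field_simps)
      finally show "a * \<eta> \<le> e / 2" .
    qed
    define bad where "bad n p = {s\<in>space M. \<eta> < \<bar>W_sum W t (f (snd p)) n s - J (snd p) s\<bar>}" for n and p :: "real \<times> 'b"
    have bm: "bad n p \<in> sets M" if "p \<in> set L" for n p
      using Jm[OF that] unfolding bad_def by measurable
    have bound: "norm (expectation (\<lambda>s. iexp (?S n s)) - expectation (\<lambda>s. iexp (?J s))) \<le> a * \<eta> + 2 * (\<Sum>p\<leftarrow>L. prob (bad n p))" for n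
    proof -
      have "norm (expectation (\<lambda>s. iexp (?S n s)) - expectation (\<lambda>s. iexp (?J s))) = norm (expectation (\<lambda>s. iexp (?S n s) - iexp (?J s)))"
        by (subst Bochner_Integration.integral_diff) (auto intro!: integrable_iexp)
      also have "\<dots> \<le> expectation (\<lambda>s. norm (iexp (?S n s) - iexp (?J s)))" by (rule integral_norm_bound)
      also have "\<dots> \<le> expectation (\<lambda>s. a * \<eta> + (\<Sum>p\<leftarrow>L. 2 * indicator (bad n p) s))"
      proof (rule integral_mono')
        show "integrable M (\<lambda>s. a * \<eta> + (\<Sum>p\<leftarrow>L. 2 * indicator (bad n p) s :: real))"
          using bm by (intro Bochner_Integration.integrable_add integral_sum_list(1)) (auto simp: integrable_real_indicator emeasure_eq_measure)
        fix s assume s: "s \<in> space M"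
        show "norm (iexp (?S n s) - iexp (?J s)) \<le> a * \<eta> + (\<Sum>p\<leftarrow>L. 2 * indicator (bad n p) s)"
        proof (cases "\<exists>p\<in>set L. s \<in> bad n p")
          case True
          then obtain p where p: "p \<in> set L" "s \<in> bad n p" by blast
          have "norm (iexp (?S n s) - iexp (?J s)) \<le> 2"
            using norm_triangle_ineq4[of "iexp (?S n s)" "iexp (?J s)"] by simp
          also have "2 \<le> (\<Sum>p\<leftarrow>L. 2 * indicator (bad n p) s :: real)"
          proof (rule member_le_sum_list)
            show "2 \<in> set (map (\<lambda>p. 2 * indicator (bad n p) s :: real) L)"
              using p by (auto intro!: image_eqI[of _ _ p])
          qed auto
          finally show ?thesis using a \<eta> by (smt (verit) mult_nonneg_nonneg)
        next
          case False
          then have *: "\<bar>W_sum W t (f (snd p)) n s - J (snd p) s\<bar> \<le> \<eta>" if "p \<in> set L" for p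
            using that s by (auto simp: bad_def not_less)
          have "norm (iexp (?S n s) - iexp (?J s)) \<le> \<bar>?S n s - ?J s\<bar>" by (rule norm_iexp_diff_le)
          also have "?S n s - ?J s = (\<Sum>p\<leftarrow>L. fst p * (W_sum W t (f (snd p)) n s - J (snd p) s))"
            by (simp add: right_diff_distrib sum_list_subtractf)
          also have "\<bar>\<dots>\<bar> \<le> (\<Sum>p\<leftarrow>L. \<bar>fst p * (W_sum W t (f (snd p)) n s - J (snd p) s)\<bar>)"
            using sum_list_abs[of "map (\<lambda>p. fst p * (W_sum W t (f (snd p)) n s - J (snd p) s)) L"] by (simp add: comp_def)
          also have "\<dots> \<le> (\<Sum>p\<leftarrow>L. \<bar>fst p\<bar> * \<eta>)"
            using * by (intro sum_list_mono) (auto simp: abs_mult intro!: mult_left_mono)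
          also have "\<dots> = a * \<eta>" by (simp add: a_def sum_list_mult_const)
          also have "\<dots> \<le> a * \<eta> + (\<Sum>p\<leftarrow>L. 2 * indicator (bad n p) s)" by (auto intro!: sum_list_nonneg)
          finally show ?thesis .
        qed
      qed (use a \<eta> in \<open>auto intro!: add_nonneg_nonneg sum_list_nonneg\<close>)
      also have "\<dots> = a * \<eta> + (\<Sum>p\<leftarrow>L. expectation (\<lambda>s. 2 * indicator (bad n p) s))"
      proof -
        have "integrable M (\<lambda>s. 2 * indicator (bad n p) s :: real)" if "p \<in> set L" for p
          using bm[OF that] by (auto simp: integrable_real_indicator emeasure_eq_measure)
        from integral_sum_list[of L, OF this] show ?thesis by (simp add: prob_space)
      qed
      also have "(\<Sum>p\<leftarrow>L. expectation (\<lambda>s. 2 * indicator (bad n p) s)) = 2 * (\<Sum>p\<leftarrow>L. prob (bad n p))"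
        unfolding sum_list_const_mult[symmetric] using bm by (intro arg_cong[of _ _ sum_list] map_cong) auto
      finally show ?thesis .
    qed
    have "(\<lambda>n. \<Sum>p\<leftarrow>L. prob (bad n p)) \<longlonglongrightarrow> (\<Sum>p\<leftarrow>L. 0)"
      unfolding bad_def using J \<eta> by (intro tendsto_sum_list conv_in_probD) (auto simp: is_W_integral_def)
    then have "(\<lambda>n. \<Sum>p\<leftarrow>L. prob (bad n p)) \<longlonglongrightarrow> 0" by simp
    then have "\<forall>\<^sub>F n in sequentially. (\<Sum>p\<leftarrow>L. prob (bad n p)) < e / 4" using e by (intro order_tendstoD(2)) auto
    then have "\<forall>\<^sub>F n in sequentially. norm (expectation (\<lambda>s. iexp (?S n s)) - expectation (\<lambda>s. iexp (?J s))) \<le> e"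
    proof eventually_elim
      case (elim n)
      then show ?case using bound[of n] \<eta>(2) by linarith
    qed
    then show "\<exists>y y'. y \<longlonglongrightarrow> y' \<and> (\<forall>\<^sub>F n in sequentially. norm (expectation (\<lambda>s. iexp (?S n s)) - y n) \<le> e) \<and> norm (expectation (\<lambda>s. iexp (?J s)) - y') \<le> e"
      using e by (intro exI[of _ "\<lambda>_. expectation (\<lambda>s. iexp (?J s))"] exI[of _ "expectation (\<lambda>s. iexp (?J s))"]) auto
  qed
  moreover have "(\<lambda>n. expectation (\<lambda>s. iexp (?S n s))) \<longlonglongrightarrow> exp (- limit_var t (map (\<lambda>p. (fst p, f (snd p))) L) / 2)"
  proof -
    have "continuous_on {0..} (snd p)" if "p \<in> set (map (\<lambda>p. (fst p, f (snd p))) L)" for p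
      using that L by fastforce
    from W_sum_char_tendsto[OF t, of "map (\<lambda>p. (fst p, f (snd p))) L", OF this] show ?thesis by (simp add: comp_def)
  qed
  ultimately show ?thesis by (rule LIMSEQ_unique)
qed

text \<open>Convergence in probability does not by itself transfer moments, so exp(2|J|) is first
  truncated at A. Where the dyadic sum is within 1 of J the factor exp 2 suffices; elsewhere the
  loss is A times a vanishing probability. Monotone convergence removes A.\<close>

lemma W_integral_exp_moment:
  assumes t: "0 \<le> t" and J: "is_W_integral M W t f J"
  shows "integrable M (\<lambda>s. exp (2 * \<bar>J s\<bar>))"
    and "expectation (\<lambda>s. exp (2 * \<bar>J s\<bar>)) \<le> exp 2 * (2 * exp (2 * Rb * t))"
proof -
  have [measurable]: "J \<in> borel_measurable M" using J by (simp add: is_W_integral_def)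
  have [measurable]: "W_sum W t f n \<in> borel_measurable M" for n by (intro wspan_measurable W_sum_wspan)
  let ?c = "exp 2 * (2 * exp (2 * Rb * t))"
  have trunc: "expectation (\<lambda>s. min (exp (2 * \<bar>J s\<bar>)) A) \<le> ?c" if A: "0 \<le> A" for A :: real
  proof -
    define bad where "bad n = {s\<in>space M. 1 < \<bar>W_sum W t f n s - J s\<bar>}" for n
    have [measurable]: "bad n \<in> sets M" for n unfolding bad_def by measurable
    have "expectation (\<lambda>s. min (exp (2 * \<bar>J s\<bar>)) A) \<le> ?c + A * prob (bad n)" for n
    proof -
      have "expectation (\<lambda>s. min (exp (2 * \<bar>J s\<bar>)) A) \<le> expectation (\<lambda>s. exp 2 * exp (2 * \<bar>W_sum W t f n s\<bar>) + A * indicator (bad n) s)"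
      proof (rule integral_mono')
        show "integrable M (\<lambda>s. exp 2 * exp (2 * \<bar>W_sum W t f n s\<bar>) + A * indicator (bad n) s)"
          using W_sum_exp_moment(1)[OF t] by (auto simp: integrable_real_indicator emeasure_eq_measure)
        fix s assume s: "s \<in> space M"
        show "min (exp (2 * \<bar>J s\<bar>)) A \<le> exp 2 * exp (2 * \<bar>W_sum W t f n s\<bar>) + A * indicator (bad n) s"
        proof (cases "s \<in> bad n")
          case True
          then show ?thesis by (auto intro: order_trans[OF min.cobounded2])
        next
          case False
          then have "\<bar>W_sum W t f n s - J s\<bar> \<le> 1" using s by (auto simp: bad_def)
          then have "exp (2 * \<bar>J s\<bar>) \<le> exp (2 + 2 * \<bar>W_sum W t f n s\<bar>)" by auto
          then show ?thesis using False by (simp add: exp_add min.coboundedI1)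
        qed
      qed (use A in auto)
      also have "\<dots> = exp 2 * expectation (\<lambda>s. exp (2 * \<bar>W_sum W t f n s\<bar>)) + A * prob (bad n)"
        using W_sum_exp_moment(1)[OF t] by (simp add: integrable_real_indicator emeasure_eq_measure)
      also have "\<dots> \<le> ?c + A * prob (bad n)"
        using W_sum_exp_moment(2)[OF t] by (intro add_right_mono mult_left_mono) auto
      finally show ?thesis .
    qed
    moreover have "(\<lambda>n. ?c + A * prob (bad n)) \<longlonglongrightarrow> ?c + A * 0"
      unfolding bad_def using J by (intro tendsto_intros conv_in_probD) (auto simp: is_W_integral_def)
    ultimately show ?thesis by (intro LIMSEQ_le_const[where X = "\<lambda>n. ?c + A * prob (bad n)"]) auto
  qed
  have "(\<integral>\<^sup>+s. ennreal (exp (2 * \<bar>J s\<bar>)) \<partial>M) = (\<integral>\<^sup>+s. (SUP n. ennreal (min (exp (2 * \<bar>J s\<bar>)) (real n))) \<partial>M)"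
  proof (rule nn_integral_cong)
    fix s
    have "(\<lambda>n. ennreal (min (exp (2 * \<bar>J s\<bar>)) (real n))) \<longlonglongrightarrow> ennreal (exp (2 * \<bar>J s\<bar>))"
    proof (rule tendsto_ennrealI, rule tendsto_eventually)
      obtain n0 :: nat where "exp (2 * \<bar>J s\<bar>) \<le> n0" using real_arch_simple by blast
      then show "\<forall>\<^sub>F n in sequentially. min (exp (2 * \<bar>J s\<bar>)) (real n) = exp (2 * \<bar>J s\<bar>)"
        by (intro eventually_sequentiallyI[of n0]) auto
    qed
    moreover have "incseq (\<lambda>n. ennreal (min (exp (2 * \<bar>J s\<bar>)) (real n)))"
      by (intro incseq_SucI ennreal_leI) (auto simp: min_def)
    ultimately show "ennreal (exp (2 * \<bar>J s\<bar>)) = (SUP n. ennreal (min (exp (2 * \<bar>J s\<bar>)) (real n)))"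
      using LIMSEQ_SUP LIMSEQ_unique by blast
  qed
  also have "\<dots> = (SUP n. \<integral>\<^sup>+s. ennreal (min (exp (2 * \<bar>J s\<bar>)) (real n)) \<partial>M)"
    by (rule nn_integral_monotone_convergence_SUP) (auto intro!: incseq_SucI ennreal_leI simp: le_fun_def min_def)
  also have "\<dots> \<le> ennreal ?c"
  proof (rule SUP_least)
    fix n
    have "(\<integral>\<^sup>+s. ennreal (min (exp (2 * \<bar>J s\<bar>)) (real n)) \<partial>M) = ennreal (expectation (\<lambda>s. min (exp (2 * \<bar>J s\<bar>)) (real n)))"
      by (rule nn_integral_eq_integral) (auto intro!: integrable_const_bound[where B = "real n"])
    also have "\<dots> \<le> ennreal ?c" using trunc[of "real n"] by (intro ennreal_leI) auto
    finally show "(\<integral>\<^sup>+s. ennreal (min (exp (2 * \<bar>J s\<bar>)) (real n)) \<partial>M) \<le> ennreal ?c" .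
  qed
  finally have nn: "(\<integral>\<^sup>+s. ennreal (exp (2 * \<bar>J s\<bar>)) \<partial>M) \<le> ennreal ?c" .
  show i: "integrable M (\<lambda>s. exp (2 * \<bar>J s\<bar>))"
    using nn by (intro integrableI_bounded) (auto intro: le_less_trans)
  show "expectation (\<lambda>s. exp (2 * \<bar>J s\<bar>)) \<le> ?c"
    using nn nn_integral_eq_integral[OF i] by (simp add: ennreal_le_iff)
qed

end

section \<open>A jointly measurable integral along random paths\<close>

text \<open>Selecting a limit separately for each path would not give joint measurability. The
  dyadic sums are therefore shown to be Cauchy in L1 of the product space, and an almost everywhere
  convergent subsequence supplies J. For almost every path the whole sequence is then compared with
  this subsequence through second moments.\<close>

lemma (in gaussian_noise) W_integral_exists:
  fixes Om :: "'w measure" and p :: "real \<Rightarrow> 'w \<Rightarrow> real"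
  assumes "prob_space Om" and t: "0 \<le> t"
    and p_meas: "\<And>r. 0 \<le> r \<Longrightarrow> p r \<in> borel_measurable Om"
    and p_cont: "\<And>w. w \<in> space Om \<Longrightarrow> continuous_on {0..} (\<lambda>r. p r w)"
  shows "\<exists>J\<in>borel_measurable (M \<Otimes>\<^sub>M Om). AE w in Om. is_W_integral M W t (\<lambda>r. p r w) (\<lambda>s. J (s, w))"
proof -
  interpret O: prob_space Om by fact
  interpret OM: pair_sigma_finite Om M ..
  define S where "S n x = W_sum W t (\<lambda>r. p r (fst x)) n (snd x)" for n :: nat and x :: "'w \<times> 's"
  have Wm: "(\<lambda>x. W r (p q (fst x)) (snd x)) \<in> borel_measurable (Om \<Otimes>\<^sub>M M)" if "0 \<le> r" "0 \<le> q" for r q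
  proof -
    have "(\<lambda>(y, s). W r y s) \<in> borel_measurable (borel \<Otimes>\<^sub>M M)"
    proof (rule Caratheodory_measurable)
      fix s assume s: "s \<in> space M"
      have "continuous_on UNIV (\<lambda>y. (\<lambda>(t, x). W t x s) (r, y))"
        by (rule continuous_on_compose2[OF W_cont[OF s]]) (use that in \<open>auto intro!: continuous_intros\<close>)
      then show "continuous_on UNIV (\<lambda>y. W r y s)" by simp
    qed (use that W_measurable in auto)
    moreover have "(\<lambda>x. (p q (fst x), snd x)) \<in> measurable (Om \<Otimes>\<^sub>M M) (borel \<Otimes>\<^sub>M M)"
      using p_meas[OF that(2)] by measurable
    ultimately show ?thesis using measurable_compose by fastforce
  qed
  have S_meas[measurable]: "S n \<in> borel_measurable (Om \<Otimes>\<^sub>M M)" for n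
    unfolding S_def[abs_def] W_sum_def
    by (intro borel_measurable_sum borel_measurable_diff Wm) auto
  have Sw: "(\<lambda>s. S n (w, s)) \<in> wspan" for n w
    unfolding S_def using W_sum_wspan by simp
  note Sw_meas[measurable] = wspan_measurable[OF Sw]
  \<comment> \<open>Squared L2 distance of two levels for a fixed path. It is bounded uniformly in
    the path and tends to 0, so its square root can be integrated by dominated convergence.\<close>
  define d where "d i j w = expectation (\<lambda>s. (S i (w, s) - S j (w, s))\<^sup>2)" for i j w
  have Rb: "0 \<le> Rb" using R_bound[of 0] by linarith
  have i2: "integrable M (\<lambda>s. (S i (w, s) - S j (w, s))\<^sup>2)" for i j w
    by (rule wspan_centered(3)) (intro wspan_diff Sw)
  have ii: "integrable M (\<lambda>s. S i (w, s) * S j (w, s))" for i j w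
    by (intro wspan_product_integrable Sw)
  have d_eq: "d i j w = expectation (\<lambda>s. S i (w, s) * S i (w, s)) + expectation (\<lambda>s. S j (w, s) * S j (w, s)) - 2 * expectation (\<lambda>s. S i (w, s) * S j (w, s))" for i j w
  proof -
    have "d i j w = expectation (\<lambda>s. S i (w, s) * S i (w, s) + S j (w, s) * S j (w, s) - 2 * (S i (w, s) * S j (w, s)))"
      unfolding d_def by (simp add: power2_eq_square algebra_simps)
    then show ?thesis using ii by simp
  qed
  have d_le: "d i j w \<le> 4 * Rb * t" for i j w
  proof -
    have "d i j w \<le> expectation (\<lambda>s. 2 * (S i (w, s))\<^sup>2 + 2 * (S j (w, s))\<^sup>2)"
      unfolding d_def
    proof (rule integral_mono')
      show "integrable M (\<lambda>s. 2 * (S i (w, s))\<^sup>2 + 2 * (S j (w, s))\<^sup>2)"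
        using wspan_centered(3)[OF Sw] by simp
      show "(S i (w, s) - S j (w, s))\<^sup>2 \<le> 2 * (S i (w, s))\<^sup>2 + 2 * (S j (w, s))\<^sup>2" for s
        using zero_le_power2[of "S i (w, s) + S j (w, s)"] by (simp add: power2_eq_square algebra_simps)
    qed auto
    also have "\<dots> = 2 * expectation (\<lambda>s. (S i (w, s))\<^sup>2) + 2 * expectation (\<lambda>s. (S j (w, s))\<^sup>2)"
      using wspan_centered(3)[OF Sw] by simp
    also have "\<dots> \<le> 4 * Rb * t"
      using W_sum_second_moment_le[OF t, of "\<lambda>r. p r w" i] W_sum_second_moment_le[OF t, of "\<lambda>r. p r w" j]
      unfolding S_def by simp
    finally show ?thesis .
  qed
  have d0: "0 \<le> d i j w" for i j w unfolding d_def by simp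
  have d_lim: "(\<lambda>k. d (N k) (N' k) w) \<longlonglongrightarrow> 0"
    if w: "w \<in> space Om" and N: "filterlim N at_top sequentially" "filterlim N' at_top sequentially" for w N N'
  proof -
    let ?L = "\<integral>r. indicator {0..t} r * R (p r w - p r w) \<partial>lborel"
    have "(\<lambda>k. expectation (\<lambda>s. S (L k) (w, s) * S (L' k) (w, s))) \<longlonglongrightarrow> ?L"
      if "filterlim L at_top sequentially" "filterlim L' at_top sequentially" for L L'
      using W_sum_cov_tendsto[OF t p_cont[OF w] p_cont[OF w] that] unfolding S_def by simp
    note lim = this
    \<comment> \<open>The two variances and the covariance have the same limit and cancel.\<close>
    have "(\<lambda>k. d (N k) (N' k) w) \<longlonglongrightarrow> ?L + ?L - 2 * ?L"
      unfolding d_eq by (intro tendsto_intros lim N)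
    then show ?thesis by simp
  qed
  have d_meas[measurable]: "d i j \<in> borel_measurable Om" for i j
    unfolding d_def[abs_def] by measurable
  have mean_le: "expectation (\<lambda>s. \<bar>S i (w, s) - S j (w, s)\<bar>) \<le> sqrt (d i j w)" for i j w
    unfolding d_def by (rule abs_expectation_le_sqrt) (use i2 in auto)
  have iS: "integrable (Om \<Otimes>\<^sub>M M) (S n)" for n
  proof (rule OM.Fubini_integrable)
    show "AE w in Om. integrable M (\<lambda>s. S n (w, s))" using wspan_centered(1)[OF Sw] by simp
    show "integrable Om (\<lambda>w. \<integral>s. norm (S n (w, s)) \<partial>M)"
    proof (rule O.integrable_const_bound[where B = "sqrt (Rb * t)"])
      have "expectation (\<lambda>s. \<bar>S n (w, s)\<bar>) \<le> sqrt (Rb * t)" for w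
      proof -
        have "expectation (\<lambda>s. \<bar>S n (w, s)\<bar>) \<le> sqrt (expectation (\<lambda>s. (S n (w, s))\<^sup>2))"
          by (rule abs_expectation_le_sqrt) (use wspan_centered(3)[OF Sw] in auto)
        also have "\<dots> \<le> sqrt (Rb * t)"
          using W_sum_second_moment_le[OF t, of "\<lambda>r. p r w" n] unfolding S_def by (simp add: real_sqrt_le_mono)
        finally show ?thesis .
      qed
      then show "AE w in Om. norm (\<integral>s. norm (S n (w, s)) \<partial>M) \<le> sqrt (Rb * t)" by simp
    qed measurable
  qed simp
  have L1: "(LINT x|(Om \<Otimes>\<^sub>M M). norm (S i x - S j x)) \<le> (\<integral>w. sqrt (d i j w) \<partial>Om)" for i j
  proof -
    have i: "integrable (Om \<Otimes>\<^sub>M M) (\<lambda>x. norm (S i x - S j x))" using iS by auto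
    have "(LINT x|(Om \<Otimes>\<^sub>M M). norm (S i x - S j x)) = (\<integral>w. \<integral>s. norm (S i (w, s) - S j (w, s)) \<partial>M \<partial>Om)"
      using OM.integral_fst'[OF i] by simp
    also have "\<dots> \<le> (\<integral>w. sqrt (d i j w) \<partial>Om)"
    proof (rule integral_mono')
      show "integrable Om (\<lambda>w. sqrt (d i j w))"
        by (rule O.integrable_const_bound[where B = "sqrt (4 * Rb * t)"]) (use d_le d0 in auto)
    qed (use mean_le d0 in auto)
    finally show ?thesis .
  qed
  \<comment> \<open>Argued by contradiction: a failure provides two sequences of levels tending to
    infinity, to which dominated convergence for sequences applies.\<close>
  have Cauchy: "\<exists>N. \<forall>i\<ge>N. \<forall>j\<ge>N. (LINT x|(Om \<Otimes>\<^sub>M M). norm (S i x - S j x)) < e" if e: "0 < e" for e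
  proof (rule ccontr)
    assume "\<not> (\<exists>N. \<forall>i\<ge>N. \<forall>j\<ge>N. (LINT x|(Om \<Otimes>\<^sub>M M). norm (S i x - S j x)) < e)"
    then have "\<forall>N. \<exists>i j. N \<le> i \<and> N \<le> j \<and> e \<le> (LINT x|(Om \<Otimes>\<^sub>M M). norm (S i x - S j x))"
      by (meson not_less)
    then obtain I J where IJ: "\<And>N. N \<le> I N" "\<And>N. N \<le> J N" "\<And>N. e \<le> (LINT x|(Om \<Otimes>\<^sub>M M). norm (S (I N) x - S (J N) x))"
      by metis
    have lim: "filterlim I at_top sequentially" "filterlim J at_top sequentially"
      using IJ(1,2) by (auto intro: filterlim_at_top_mono[OF filterlim_ident] always_eventually)
    have "(\<lambda>N. \<integral>w. sqrt (d (I N) (J N) w) \<partial>Om) \<longlonglongrightarrow> (\<integral>w. 0 \<partial>Om)"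
    proof (rule integral_dominated_convergence[where w = "\<lambda>_. sqrt (4 * Rb * t)"])
      show "AE w in Om. (\<lambda>N. sqrt (d (I N) (J N) w)) \<longlonglongrightarrow> 0"
        using tendsto_real_sqrt[OF d_lim[OF _ lim]] by auto
    qed (use d_le d0 in auto)
    then have "\<forall>\<^sub>F N in sequentially. (\<integral>w. sqrt (d (I N) (J N) w) \<partial>Om) < e"
      using e by (intro order_tendstoD(2)) auto
    then obtain N where "(\<integral>w. sqrt (d (I N) (J N) w) \<partial>Om) < e" by (auto simp: eventually_sequentially)
    then show False using IJ(3)[of N] L1[of "I N" "J N"] by linarith
  qed
  obtain r where r: "strict_mono r" "AE x in Om \<Otimes>\<^sub>M M. Cauchy (\<lambda>i. S (r i) x)"
    using cauchy_L1_AE_cauchy_subseq[OF iS Cauchy] by blast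
  \<comment> \<open>\<open>lim\<close> assigns some value where the subsequence diverges; the
    function remains measurable and the exceptional set is null.\<close>
  define J' where "J' x = lim (\<lambda>i. S (r i) x)" for x
  have J'_meas[measurable]: "J' \<in> borel_measurable (Om \<Otimes>\<^sub>M M)" unfolding J'_def[abs_def] by measurable
  define J where "J x = J' (snd x, fst x)" for x
  have J_meas: "J \<in> borel_measurable (M \<Otimes>\<^sub>M Om)" unfolding J_def[abs_def] by measurable
  have "AE x in Om \<Otimes>\<^sub>M M. (\<lambda>i. S (r i) x) \<longlonglongrightarrow> J' x"
    using r(2) by eventually_elim (auto simp: J'_def convergent_LIMSEQ_iff[symmetric] Cauchy_convergent_iff)
  then have "AE w in Om. AE s in M. (\<lambda>i. S (r i) (w, s)) \<longlonglongrightarrow> J' (w, s)" by (rule OM.AE_pair)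
  then have "AE w in Om. is_W_integral M W t (\<lambda>r. p r w) (\<lambda>s. J (s, w))"
    using AE_space
  proof eventually_elim
    case (elim w)
    have [measurable]: "(\<lambda>s. J' (w, s)) \<in> borel_measurable M"
      using measurable_compose[OF measurable_Pair1'[OF elim(2)] J'_meas] .
    have rt: "filterlim r at_top sequentially" using r(1) by (rule filterlim_subseq)
    have "(\<lambda>n. prob {s\<in>space M. \<eta> < \<bar>S n (w, s) - J' (w, s)\<bar>}) \<longlonglongrightarrow> 0" if \<eta>: "0 < \<eta>" for \<eta>
    proof -
      \<comment> \<open>\<open>?A\<close> compares the full sequence with the subsequence by
        Chebyshev's inequality; \<open>?B\<close> compares the subsequence with its almost sure
        limit.\<close>
      let ?A = "\<lambda>n. {s\<in>space M. \<eta> / 2 \<le> \<bar>S n (w, s) - S (r n) (w, s)\<bar>}"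
        and ?B = "\<lambda>n. {s\<in>space M. \<eta> / 2 < \<bar>S (r n) (w, s) - J' (w, s)\<bar>}"
        and ?D = "\<lambda>n. {s\<in>space M. \<eta> < \<bar>S n (w, s) - J' (w, s)\<bar>}"
      have a: "(\<lambda>n. prob (?A n)) \<longlonglongrightarrow> 0"
      proof (rule tendsto_sandwich[OF _ _ tendsto_const])
        show "\<forall>\<^sub>F n in sequentially. prob (?A n) \<le> d n (r n) w / (\<eta> / 2)\<^sup>2"
          unfolding d_def using \<eta> i2 by (intro always_eventually allI second_moment_method) auto
        have "(\<lambda>n. d n (r n) w / (\<eta> / 2)\<^sup>2) \<longlonglongrightarrow> 0 / (\<eta> / 2)\<^sup>2"
          using \<eta> by (intro tendsto_divide tendsto_const d_lim[OF elim(2) filterlim_ident rt]) auto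
        then show "(\<lambda>n. d n (r n) w / (\<eta> / 2)\<^sup>2) \<longlonglongrightarrow> 0" by simp
      qed auto
      have b: "(\<lambda>n. prob (?B n)) \<longlonglongrightarrow> 0"
      proof -
        have "(\<lambda>n. expectation (indicator (?B n) :: 's \<Rightarrow> real)) \<longlonglongrightarrow> expectation (\<lambda>s. 0)"
        proof (rule integral_dominated_convergence[where w = "\<lambda>_. 1"])
          show "AE s in M. (\<lambda>n. indicator (?B n) s :: real) \<longlonglongrightarrow> 0"
            using elim(1)
          proof eventually_elim
            case (elim s)
            have "\<forall>\<^sub>F n in sequentially. dist (S (r n) (w, s)) (J' (w, s)) < \<eta> / 2"
              using elim \<eta> by (intro tendstoD) auto
            then show ?case
              by (intro tendsto_eventually) (auto elim!: eventually_mono simp: dist_real_def indicator_def)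
          qed
        qed (auto simp: indicator_def)
        then show ?thesis by simp
      qed
      show ?thesis
      proof (rule tendsto_sandwich[OF _ _ tendsto_const])
        show "\<forall>\<^sub>F n in sequentially. prob (?D n) \<le>
            prob (?A n) + prob (?B n)"
        proof (intro always_eventually allI)
          fix n
          have "prob (?D n) \<le>
            prob (?A n \<union> ?B n)"
          proof (intro finite_measure_mono subsetI)
            fix s assume s: "s \<in> ?D n"
            then have "\<eta> / 2 < \<bar>S (r n) (w, s) - J' (w, s)\<bar> \<or> \<eta> / 2 \<le> \<bar>S n (w, s) - S (r n) (w, s)\<bar>"
              unfolding mem_Collect_eq by linarith
            then show "s \<in> ?A n \<union> ?B n"
              using s by blast
          qed auto
          also have "\<dots> \<le> prob (?A n) + prob (?B n)"
            by (intro measure_Un_le) auto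
          finally show "prob (?D n) \<le>
            prob (?A n) + prob (?B n)" .
        qed
        show "(\<lambda>n. prob (?A n) + prob (?B n)) \<longlonglongrightarrow> 0"
          using tendsto_add[OF a b] by simp
      qed auto
    qed
    then show ?case by (simp add: is_W_integral_def conv_in_prob_def J_def S_def)
  qed
  then show ?thesis using J_meas by blast
qed

text \<open>For t > 0 the law of B_t has a bounded density p, and p |g| \<le> p^2 + g^2 \<le> c p +
  g^2 is integrable. At t = 0 there is no density, but B_0 is almost surely 0.\<close>

lemma (in prob_space) brownian_integrable:
  assumes B: "brownian_motion M B" and t: "0 \<le> t"
    and g2: "integrable lborel (\<lambda>y. (g y)\<^sup>2)" and g: "continuous_on UNIV g"
  shows "integrable M (\<lambda>w. g (x + B t w) :: real)"
proof -
  have [measurable]: "B t \<in> borel_measurable M" "B 0 \<in> borel_measurable M"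
    using B t by (auto simp: brownian_motion_def)
  have [measurable]: "g \<in> borel_measurable borel" using g by (rule borel_measurable_continuous_onI)
  have B0: "AE w in M. B 0 w = 0" using B by (simp add: brownian_motion_def)
  show ?thesis
  proof (cases "t = 0")
    case True
    have "integrable M (\<lambda>w. g (x + B t w)) \<longleftrightarrow> integrable M (\<lambda>w. g x)"
      by (rule integrable_cong_AE) (use B0 True in \<open>auto elim!: eventually_mono\<close>)
    then show ?thesis by simp
  next
    case False
    then have t: "0 < t" using t by simp
    have D: "distributed M lborel (\<lambda>w. B t w - B 0 w) (normal_density 0 (sqrt t))"
      using B t by (auto simp: brownian_motion_def dest: spec[of _ 0])
    have "integrable lborel (\<lambda>y. normal_density 0 (sqrt t) y * g (x + y))"
    proof (rule Bochner_Integration.integrable_bound)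
      \<comment> \<open>The maximum of the normal density.\<close>
      define c where "c = 1 / sqrt (2 * pi * (sqrt t)\<^sup>2)"
      have "integrable lborel (\<lambda>y. (g (x + 1 * y))\<^sup>2)"
        by (rule lborel_integrable_real_affine[OF g2]) simp
      then show "integrable lborel (\<lambda>y. c * normal_density 0 (sqrt t) y + (g (x + y))\<^sup>2)"
        using t by (intro Bochner_Integration.integrable_add integrable_mult_right integrable_normal_density) auto
      show "AE y in lborel. norm (normal_density 0 (sqrt t) y * g (x + y)) \<le> norm (c * normal_density 0 (sqrt t) y + (g (x + y))\<^sup>2)"
      proof (rule AE_I2)
        fix y
        let ?p = "normal_density 0 (sqrt t) y"
        have "?p \<le> c * 1"
          unfolding normal_density_def c_def by (intro mult_left_mono) auto
        then have "?p * ?p \<le> c * ?p" by (intro mult_right_mono) auto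
        moreover have "\<bar>?p * g (x + y)\<bar> \<le> ?p * ?p + (g (x + y))\<^sup>2"
        proof -
          have "0 \<le> (?p - \<bar>g (x + y)\<bar>)\<^sup>2" by simp
          also have "\<dots> = ?p * ?p + (g (x + y))\<^sup>2 - 2 * \<bar>?p * g (x + y)\<bar>"
            by (simp add: abs_mult power2_eq_square algebra_simps)
          finally show ?thesis using abs_ge_zero[of "?p * g (x + y)"] by linarith
        qed
        ultimately show "norm (?p * g (x + y)) \<le> norm (c * ?p + (g (x + y))\<^sup>2)"
          unfolding real_norm_def by (intro order_trans[OF _ abs_ge_self]) linarith
      qed
    qed measurable
    then have "integrable M (\<lambda>w. g (x + (B t w - B 0 w)))"
      using distributed_integrable[OF D, of "\<lambda>y. g (x + y)"] by simp
    moreover have "integrable M (\<lambda>w. g (x + (B t w - B 0 w))) \<longleftrightarrow> integrable M (\<lambda>w. g (x + B t w))"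
      by (rule integrable_cong_AE) (use B0 in \<open>auto elim!: eventually_mono\<close>)
    ultimately show ?thesis by simp
  qed
qed

section \<open>The random potential along paths\<close>

lemma sum_list_measurable:
  assumes "\<And>p. p \<in> set L \<Longrightarrow> f p \<in> borel_measurable N"
  shows "(\<lambda>x. \<Sum>p\<leftarrow>L. f p x :: real) \<in> borel_measurable N"
  using assms by (induction L) auto

lemma abs_sum_list_le:
  assumes "\<And>p. p \<in> set L \<Longrightarrow> \<bar>f p\<bar> \<le> g p"
  shows "\<bar>\<Sum>p\<leftarrow>L. f p :: real\<bar> \<le> (\<Sum>p\<leftarrow>L. g p)"
  using assms by (induction L) (auto intro: order_trans[OF abs_triangle_ineq] add_mono)

lemma path_measurable:
  fixes f :: "real \<Rightarrow> real"
  assumes "continuous_on {0..} f"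
  shows "(\<lambda>r. f (max 0 r)) \<in> borel_measurable borel"
  by (rule borel_measurable_continuous_onI, rule continuous_on_compose2[OF assms]) (auto intro!: continuous_intros)

text \<open>The mixing rate is kept in plain cubic form; the exponent depending on \<theta> is
  compared with 3 once, when the locale is interpreted.\<close>

locale random_potential = prob_space M for M :: "'s measure" +
  fixes c :: "real \<Rightarrow> real \<Rightarrow> 's \<Rightarrow> real" and K \<theta> C0 C :: real
  assumes c_joint: "jointly_measurable_field M c"
    and c_stationary: "stationary_field M c"
    and c_centered: "\<And>t x. 0 \<le> t \<Longrightarrow> expectation (c t x) = 0"
    and c_bound: "\<And>t x s. 0 \<le> t \<Longrightarrow> s \<in> space M \<Longrightarrow> \<bar>c t x s\<bar> \<le> K"
    and Phi_measurable: "(\<lambda>(t, x). cov_fun M c t x) \<in> borel_measurable lborel"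
    and \<theta>_pos: "0 < \<theta>"
    and c_hoelder: "\<And>r. 0 \<le> r \<Longrightarrow> AE s in M. \<forall>y1 y2. \<bar>c r y1 s - c r y2 s\<bar> \<le> C0 * \<bar>y1 - y2\<bar> powr \<theta>"
    and C_nonneg: "0 \<le> C"
    and c_mixing: "\<And>r. 0 \<le> r \<Longrightarrow> alpha_um M c r \<le> C / (1 + r) ^ 3"
begin

lemma K_nonneg: "0 \<le> K"
proof -
  obtain s where "s \<in> space M" using not_empty by auto
  then show ?thesis using c_bound[of 0 s 0] by linarith
qed

text \<open>Joint measurability of the field is relative to the half-line of times, hence the sign
  condition on \<open>k\<close>.\<close>

lemma c_comp:
  assumes "k \<in> borel_measurable N" "\<And>x. x \<in> space N \<Longrightarrow> 0 \<le> k x" "y \<in> borel_measurable N" "z \<in> measurable N M"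
  shows "(\<lambda>x. c (k x) (y x) (z x)) \<in> borel_measurable N"
proof -
  have "(\<lambda>x. (k x, y x, z x)) \<in> measurable N (restrict_space borel {0..} \<Otimes>\<^sub>M (borel \<Otimes>\<^sub>M M))"
    using assms by (intro measurable_Pair measurable_restrict_space2) auto
  from measurable_compose[OF this c_joint[unfolded jointly_measurable_field_def]] show ?thesis by simp
qed

lemma c_measurable: "0 \<le> t \<Longrightarrow> c t x \<in> borel_measurable M"
  using c_comp[of "\<lambda>_. t" M "\<lambda>_. x" "\<lambda>s. s"] by simp

definition generators :: "(real \<times> real) set \<Rightarrow> 's set set" where
  "generators A = {c t x -` D \<inter> space M | t x D. (t, x) \<in> A \<and> D \<in> sets borel}"

text \<open>The sigma-algebra \<open>field_sigma\<close> packaged as a measure, the form in which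
  \<open>subalgebra\<close> and conditional expectations take it.\<close>

definition field_algebra :: "(real \<times> real) set \<Rightarrow> 's measure" where
  "field_algebra A = sigma (space M) (generators A)"

lemma generators_Pow: "generators A \<subseteq> Pow (space M)"
  by (auto simp: generators_def)

lemma sets_field_algebra: "sets (field_algebra A) = field_sigma M c A"
  unfolding field_algebra_def field_sigma_def
  using generators_Pow[of A] by (simp add: sets_measure_of generators_def)

lemma space_field_algebra [simp]: "space (field_algebra A) = space M"
  unfolding field_algebra_def using generators_Pow by (simp add: space_measure_of)

lemma field_algebra_subalgebra: "A \<subseteq> {0..} \<times> UNIV \<Longrightarrow> subalgebra M (field_algebra A)"
  unfolding subalgebra_def
proof (intro conjI)
  assume A: "A \<subseteq> {0..} \<times> UNIV"
  have "generators A \<subseteq> sets M"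
    using A c_measurable by (auto simp: generators_def intro: measurable_sets)
  then show "sets (field_algebra A) \<subseteq> sets M"
    unfolding field_algebra_def using generators_Pow[of A] by (simp add: sets_measure_of sets.sigma_sets_subset)
qed simp

lemma c_field_algebra: "(t, x) \<in> A \<Longrightarrow> c t x \<in> borel_measurable (field_algebra A)"
proof (rule measurableI)
  fix D :: "real set" assume "(t, x) \<in> A" "D \<in> sets borel"
  then have "c t x -` D \<inter> space M \<in> generators A" by (auto simp: generators_def)
  then show "c t x -` D \<inter> space (field_algebra A) \<in> sets (field_algebra A)"
    using generators_Pow[of A] by (simp add: field_algebra_def sets_measure_of)
qed simp

abbreviation past :: "real \<Rightarrow> 's measure" where "past a \<equiv> field_algebra ({0..a} \<times> UNIV)"
abbreviation future :: "real \<Rightarrow> 's measure" where "future b \<equiv> field_algebra ({b..} \<times> UNIV)"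

text \<open>A real \<open>Sup\<close> dominates its members only if the set is bounded above; here
  all members are differences of numbers in [0,1].\<close>

lemma alpha_um_upper:
  assumes "A1 \<subseteq> {0..} \<times> UNIV" "A2 \<subseteq> {0..} \<times> UNIV" "r \<le> setdist A1 A2"
    "S1 \<in> field_sigma M c A1" "S2 \<in> field_sigma M c A2" "prob S2 \<noteq> 0"
  shows "\<bar>prob (S1 \<inter> S2) / prob S2 - prob S1\<bar> \<le> alpha_um M c r"
  unfolding alpha_um_def
proof (rule cSup_upper)
  show "\<bar>prob (S1 \<inter> S2) / prob S2 - prob S1\<bar> \<in> {\<bar>prob (S1 \<inter> S2) / prob S2 - prob S1\<bar> | A1 A2 S1 S2.
      A1 \<subseteq> {0..} \<times> UNIV \<and> A2 \<subseteq> {0..} \<times> UNIV \<and> r \<le> setdist A1 A2 \<and>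
      S1 \<in> field_sigma M c A1 \<and> S2 \<in> field_sigma M c A2 \<and> prob S2 \<noteq> 0}"
    using assms by blast
  show "bdd_above {\<bar>prob (S1 \<inter> S2) / prob S2 - prob S1\<bar> | A1 A2 S1 S2.
      A1 \<subseteq> {0..} \<times> UNIV \<and> A2 \<subseteq> {0..} \<times> UNIV \<and> r \<le> setdist A1 A2 \<and>
      S1 \<in> field_sigma M c A1 \<and> S2 \<in> field_sigma M c A2 \<and> prob S2 \<noteq> 0}"
  proof (rule bdd_aboveI[where M = 1], clarify)
    fix A1 A2 S1 S2
    assume "A2 \<subseteq> {0..} \<times> UNIV" "S2 \<in> field_sigma M c A2" "prob S2 \<noteq> 0"
    then have "S2 \<in> sets M" using field_algebra_subalgebra[of A2] by (auto simp: subalgebra_def sets_field_algebra)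
    then have "prob (S1 \<inter> S2) \<le> prob S2" by (intro finite_measure_mono) auto
    then have "0 \<le> prob (S1 \<inter> S2) / prob S2" "prob (S1 \<inter> S2) / prob S2 \<le> 1" by (auto simp: divide_le_eq_1 less_le)
    then show "\<bar>prob (S1 \<inter> S2) / prob S2 - prob S1\<bar> \<le> 1"
      using prob_le_1[of S1] measure_nonneg[of M S1] by linarith
  qed
qed

text \<open>The conditioning event is the past one, so the future takes the first place in
  \<open>alpha_um\<close>. The two strips are at distance at least b - a already in the time
  coordinate. A null past event satisfies the inequality trivially.\<close>

lemma mixing_past_future:
  assumes "0 \<le> a" "a \<le> b"
  shows "mixing_le (past a) (future b) (C / (1 + (b - a)) ^ 3)"
  unfolding mixing_le_def
proof (intro conjI ballI)
  show "subalgebra M (past a)" "subalgebra M (future b)"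
    using assms by (auto intro!: field_algebra_subalgebra)
  show "0 \<le> C / (1 + (b - a)) ^ 3" using assms C_nonneg by simp
  fix S T assume S: "S \<in> sets (past a)" and T: "T \<in> sets (future b)"
  show "\<bar>prob (S \<inter> T) - prob S * prob T\<bar> \<le> C / (1 + (b - a)) ^ 3 * prob S"
  proof (cases "prob S = 0")
    case True
    have "{0..a} \<times> UNIV \<subseteq> {0..} \<times> (UNIV :: real set)" by auto
    then have "S \<in> sets M" using S field_algebra_subalgebra by (auto simp: subalgebra_def)
    then have "prob (S \<inter> T) \<le> prob S" by (intro finite_measure_mono) auto
    then show ?thesis using True measure_nonneg[of M "S \<inter> T"] by simp
  next
    case False
    have "b - a \<le> setdist ({b..} \<times> UNIV) ({0..a} \<times> (UNIV :: real set))"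
    proof (rule le_setdistI)
      fix x y assume "x \<in> {b..} \<times> (UNIV :: real set)" "y \<in> {0..a} \<times> (UNIV :: real set)"
      then have "b - a \<le> dist (fst x) (fst y)" by (auto simp: dist_real_def)
      also have "\<dots> \<le> dist x y" by (rule dist_fst_le)
      finally show "b - a \<le> dist x y" .
    qed (use assms in auto)
    then have "\<bar>prob (T \<inter> S) / prob S - prob T\<bar> \<le> alpha_um M c (b - a)"
      using assms S T False by (intro alpha_um_upper) (auto simp: sets_field_algebra)
    also have "\<dots> \<le> C / (1 + (b - a)) ^ 3" using assms by (intro c_mixing) auto
    finally have "\<bar>prob (T \<inter> S) / prob S - prob T\<bar> * prob S \<le> C / (1 + (b - a)) ^ 3 * prob S"
      by (intro mult_right_mono) auto
    moreover have "\<bar>prob (T \<inter> S) / prob S - prob T\<bar> * prob S = \<bar>(prob (T \<inter> S) / prob S - prob T) * prob S\<bar>"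
      by (simp add: abs_mult)
    moreover have "(prob (T \<inter> S) / prob S - prob T) * prob S = prob (S \<inter> T) - prob S * prob T"
      using False by (simp add: left_diff_distrib Int_commute[of T] mult.commute[of "prob T"])
    ultimately show ?thesis by simp
  qed
qed

sublocale mixing_filtration M past future C
  by unfold_locales (use C_nonneg mixing_past_future in auto)

lemma c_covariance_le:
  assumes "0 \<le> u" "u \<le> u'"
  shows "\<bar>expectation (\<lambda>s. c u y s * c u' y' s)\<bar> \<le> 2 * K\<^sup>2 * C / (1 + (u' - u)) ^ 3"
proof -
  have "\<bar>expectation (\<lambda>s. c u y s * c u' y' s) - expectation (c u y) * expectation (c u' y')\<bar>
    \<le> 2 * K * (C / (1 + (u' - u)) ^ 3) * expectation (\<lambda>s. \<bar>c u y s\<bar>)"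
    by (rule covariance_real[OF mixing_past_future[of u u'], where b' = K])
       (use assms c_bound K_nonneg in \<open>auto intro!: ae_measurableI c_field_algebra c_measurable\<close>)
  also have "\<dots> \<le> 2 * K * (C / (1 + (u' - u)) ^ 3) * K"
    using assms K_nonneg C_nonneg c_bound c_measurable
    by (intro mult_left_mono integral_le_const integrable_const_bound[where B=K] AE_I2) auto
  finally show ?thesis using c_centered assms by (simp add: power2_eq_square mult_ac)
qed

lemma cov_fun_le: "\<bar>cov_fun M c v x\<bar> \<le> 2 * K\<^sup>2 * C / (1 + \<bar>v\<bar>) ^ 3"
proof (cases "0 \<le> v")
  case True
  then show ?thesis using c_covariance_le[of 0 v 0 x] by (simp add: cov_fun_def)
next
  case False
  then show ?thesis using c_covariance_le[of 0 "- v" x 0] by (simp add: cov_fun_def mult.commute)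
qed

text \<open>Stationarity allows forward time shifts, so the pair is reached from the base point used
  in \<open>cov_fun\<close> by a shift by min u u' in time and by y in space.\<close>

lemma c_stationary_cov:
  assumes "0 \<le> u" "0 \<le> u'"
  shows "expectation (\<lambda>s. c u' y' s * c u y s) = cov_fun M c (u' - u) (y' - y)"
proof -
  define h where "h = min u u'"
  define a where "a = max 0 (- (u' - u))"
  define p where "p = (a, 0::real)"
  define q where "q = (a + (u' - u), y' - y)"
  \<comment> \<open>\<open>p\<close> and \<open>q\<close> may coincide; a function on the set
    \<open>A\<close> handles both cases, since the two coordinates are then equal.\<close>
  define A where "A = {p, q}"
  have ah: "0 \<le> a" "0 \<le> a + (u' - u)" "a + h = u" "a + (u' - u) + h = u'" "0 \<le> h"
    using assms by (auto simp: a_def h_def)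
  have fin: "finite A \<and> A \<subseteq> {0..} \<times> UNIV \<and> 0 \<le> h" using ah by (auto simp: A_def p_def q_def)
  have eq: "distr M (\<Pi>\<^sub>M p\<in>A. borel) (\<lambda>s. \<lambda>p\<in>A. c (fst p + h) (snd p + y) s) =
        distr M (\<Pi>\<^sub>M p\<in>A. borel) (\<lambda>s. \<lambda>p\<in>A. c (fst p) (snd p) s)"
    using c_stationary fin unfolding stationary_field_def by blast
  have pA: "p \<in> A" "q \<in> A" by (auto simp: A_def)
  have m: "(\<lambda>s. \<lambda>p\<in>A. c (fst p + h') (snd p + y') s) \<in> measurable M (\<Pi>\<^sub>M p\<in>A. borel)" if "0 \<le> h'" for h' y'
    using fin that by (intro measurable_restrict c_measurable) (auto intro!: add_nonneg_nonneg)
  have f: "(\<lambda>\<omega>. \<omega> p * \<omega> q :: real) \<in> borel_measurable (\<Pi>\<^sub>M p\<in>A. borel)"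
    using pA by measurable
  have "(\<integral>\<omega>. \<omega> p * \<omega> q \<partial>distr M (\<Pi>\<^sub>M p\<in>A. borel) (\<lambda>s. \<lambda>p\<in>A. c (fst p + h) (snd p + y) s)) = expectation (\<lambda>s. c u y s * c u' y' s)"
    using integral_distr[OF m[OF ah(5), of y] f] pA by (simp add: p_def q_def ah(3) ah(4))
  moreover have "(\<integral>\<omega>. \<omega> p * \<omega> q \<partial>distr M (\<Pi>\<^sub>M p\<in>A. borel) (\<lambda>s. \<lambda>p\<in>A. c (fst p) (snd p) s)) = cov_fun M c (u' - u) (y' - y)"
    using integral_distr[OF m[of 0 0] f] pA by (simp add: p_def q_def cov_fun_def a_def)
  ultimately show ?thesis unfolding eq by (simp add: mult.commute)
qed

text \<open>The modulus of continuity is uniform in the time lag v. Together with the cubic bound it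
  gives continuity of the limiting covariance and lets the path positions at two nearby times be
  identified in the limit. The absolute value covers a constant of either sign.\<close>

lemma cov_fun_hoelder: "\<bar>cov_fun M c v x - cov_fun M c v y\<bar> \<le> K * (\<bar>C0\<bar> * \<bar>x - y\<bar> powr \<theta>)"
proof -
  define a where "a = max 0 (- v)"
  have a: "0 \<le> a" "0 \<le> a + v" by (auto simp: a_def)
  note [measurable] = c_measurable[OF a(1)] c_measurable[OF a(2)]
  have i: "integrable M (\<lambda>s. c a 0 s * c (a + v) z s)" for z
    using c_bound[OF a(1)] c_bound[OF a(2)] K_nonneg
    by (intro integrable_const_bound[where B = "K * K"] AE_I2) (auto simp: abs_mult intro!: mult_mono)
  have b: "integrable M (\<lambda>s. \<bar>c a 0 s * (c (a + v) x s - c (a + v) y s)\<bar>)"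
    using i[of x] i[of y] by (simp add: right_diff_distrib)
  have eq: "cov_fun M c v x - cov_fun M c v y = expectation (\<lambda>s. c a 0 s * (c (a + v) x s - c (a + v) y s))"
    unfolding cov_fun_def a_def[symmetric] right_diff_distrib by (simp add: i)
  have "\<bar>cov_fun M c v x - cov_fun M c v y\<bar> \<le> expectation (\<lambda>s. \<bar>c a 0 s * (c (a + v) x s - c (a + v) y s)\<bar>)"
    unfolding eq by (rule integral_abs_bound)
  also have "\<dots> \<le> K * (\<bar>C0\<bar> * \<bar>x - y\<bar> powr \<theta>)"
  proof (rule integral_le_const[OF b])
    show "AE s in M. \<bar>c a 0 s * (c (a + v) x s - c (a + v) y s)\<bar> \<le> K * (\<bar>C0\<bar> * \<bar>x - y\<bar> powr \<theta>)"
      using c_hoelder[OF a(2)] AE_space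
    proof eventually_elim
      case (elim s)
      have "\<bar>c (a + v) x s - c (a + v) y s\<bar> \<le> C0 * \<bar>x - y\<bar> powr \<theta>" using elim(1) by blast
      also have "\<dots> \<le> \<bar>C0\<bar> * \<bar>x - y\<bar> powr \<theta>" by (intro mult_right_mono) auto
      finally show ?case unfolding abs_mult using c_bound[OF a(1) elim(2), of 0] K_nonneg by (intro mult_mono) auto
    qed
  qed
  finally show ?thesis .
qed

lemma cov_fun_tendsto:
  assumes "(g \<longlongrightarrow> y) F"
  shows "((\<lambda>n. cov_fun M c v (g n)) \<longlongrightarrow> cov_fun M c v y) F"
proof -
  have z: "0 powr \<theta> = 0" by simp
  have "((\<lambda>n. \<bar>g n - y\<bar> powr \<theta>) \<longlongrightarrow> 0 powr \<theta>) F"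
    using \<theta>_pos by (intro tendsto_powr'[OF tendsto_rabs_zero[OF LIM_zero[OF assms]] tendsto_const]) auto
  from tendsto_mult_left[OF tendsto_mult_left[OF this], of K "\<bar>C0\<bar>"]
  have "((\<lambda>n. K * (\<bar>C0\<bar> * \<bar>g n - y\<bar> powr \<theta>)) \<longlongrightarrow> 0) F"
    unfolding z mult_zero_right .
  moreover have "\<forall>\<^sub>F n in F. norm (cov_fun M c v (g n) - cov_fun M c v y) \<le> K * (\<bar>C0\<bar> * \<bar>g n - y\<bar> powr \<theta>)"
    unfolding real_norm_def by (intro always_eventually allI cov_fun_hoelder)
  ultimately have "((\<lambda>n. cov_fun M c v (g n) - cov_fun M c v y) \<longlongrightarrow> 0) F"
    by (rule Lim_null_comparison[rotated])
  then show ?thesis by (rule LIM_zero_cancel)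
qed

lemma cov_fun_measurable [measurable]:
  assumes "k \<in> borel_measurable N" "y \<in> borel_measurable N"
  shows "(\<lambda>x. cov_fun M c (k x) (y x)) \<in> borel_measurable N"
proof -
  have "(\<lambda>x. (k x, y x)) \<in> measurable N (borel :: (real \<times> real) measure)"
    using assms by (intro borel_measurable_Pair)
  from measurable_compose[OF this, of "\<lambda>(t, x). cov_fun M c t x" borel] show ?thesis
    using Phi_measurable by simp
qed

abbreviation "kernel_bound \<equiv> \<lambda>v::real. 2 * K\<^sup>2 * C * (1 / (1 + \<bar>v\<bar>) ^ 3)"

lemma kernel_bound: "integrable lborel kernel_bound" "(\<integral>v. kernel_bound v \<partial>lborel) = 2 * K\<^sup>2 * C"
  "\<bar>cov_fun M c v x\<bar> \<le> kernel_bound v"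
proof -
  have "integrable lborel (\<lambda>v. 1 / (1 + \<bar>v\<bar>) ^ 3 :: real)" "(\<integral>v. 1 / (1 + \<bar>v\<bar>) ^ 3 \<partial>lborel) = (1::real)"
    using integrable_tail_cube[of 0] by auto
  then show "integrable lborel kernel_bound" "(\<integral>v. kernel_bound v \<partial>lborel) = 2 * K\<^sup>2 * C"
    by (auto intro!: integrable_mult_right simp del: times_divide_eq_right)
  show "\<bar>cov_fun M c v x\<bar> \<le> kernel_bound v" using cov_fun_le[of v x] by simp
qed

lemma cov_fun_integrable: "integrable lborel (\<lambda>v. cov_fun M c v x)"
proof (rule Bochner_Integration.integrable_bound[OF kernel_bound(1)])
  show "AE v in lborel. norm (cov_fun M c v x) \<le> norm (kernel_bound v)"
    unfolding real_norm_def by (intro AE_I2 order_trans[OF kernel_bound(3) abs_ge_self])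
qed simp

lemma limit_cov_bound: "\<bar>limit_cov M c x\<bar> \<le> 2 * K\<^sup>2 * C"
  unfolding limit_cov_def using abs_integral_le[OF kernel_bound(1), of "\<lambda>v. cov_fun M c v x"] kernel_bound(2,3) by simp

lemma limit_cov_continuous: "continuous_on UNIV (limit_cov M c)"
proof (intro continuous_at_imp_continuous_on ballI continuous_at_sequentiallyI)
  fix x :: real and u :: "nat \<Rightarrow> real" assume u: "u \<longlonglongrightarrow> x"
  show "(\<lambda>n. limit_cov M c (u n)) \<longlonglongrightarrow> limit_cov M c x"
    unfolding limit_cov_def
    by (rule integral_dominated_convergence[OF _ _ kernel_bound(1)])
       (use kernel_bound(3) cov_fun_tendsto[OF u] in auto)
qed

text \<open>The potential seen along finitely many paths, in fast time \<open>u = r / \<epsilon>\<close>.\<close>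

definition h_path :: "(real \<times> (real \<Rightarrow> real)) list \<Rightarrow> real \<Rightarrow> real \<Rightarrow> real \<Rightarrow> 's \<Rightarrow> real" where
  "h_path L \<epsilon> a u s = a * (\<Sum>p\<leftarrow>L. fst p * c (max 0 u) (snd p (max 0 (\<epsilon> * u))) s)"

text \<open>For the path x + B this is the exponent in \<open>u_eps\<close>.\<close>

definition X_path :: "real \<Rightarrow> real \<Rightarrow> (real \<Rightarrow> real) \<Rightarrow> 's \<Rightarrow> real" where
  "X_path t \<epsilon> f s = \<epsilon> powr (-1/2) * (LINT r:{0..t}|lborel. c (r / \<epsilon>) (f r) s)"

text \<open>The sigma-algebras contain the field at all points of space, so the potential along
  several paths, combined linearly, is again a single mixing process with the same rate. Joint laws
  along several paths are thereby reduced to scalar estimates, in the manner of Cramer and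
  Wold.\<close>

lemma h_path_process:
  assumes L: "\<And>p. p \<in> set L \<Longrightarrow> continuous_on {0..} (snd p)"
    and K': "\<bar>a\<bar> * (K * (\<Sum>p\<leftarrow>L. \<bar>fst p\<bar>)) \<le> K'"
  shows "mixing_process M past future C (h_path L \<epsilon> a) K'"
proof unfold_locales
  show "(\<lambda>(u, s). h_path L \<epsilon> a u s) \<in> borel_measurable (borel \<Otimes>\<^sub>M M)"
  proof -
    have "(\<lambda>x. snd p (max 0 (\<epsilon> * fst x))) \<in> borel_measurable (borel \<Otimes>\<^sub>M M)" if "p \<in> set L" for p
      by (rule measurable_compose[OF _ path_measurable[OF L[OF that]]]) measurable
    then show ?thesis
      unfolding h_path_def case_prod_beta'
      by (intro borel_measurable_times borel_measurable_const sum_list_measurable c_comp) auto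
  qed
  fix r :: real and s assume s: "s \<in> space M"
  have "\<bar>\<Sum>p\<leftarrow>L. fst p * c (max 0 r) (snd p (max 0 (\<epsilon> * r))) s\<bar> \<le> (\<Sum>p\<leftarrow>L. \<bar>fst p * c (max 0 r) (snd p (max 0 (\<epsilon> * r))) s\<bar>)"
    using sum_list_abs[of "map (\<lambda>p. fst p * c (max 0 r) (snd p (max 0 (\<epsilon> * r))) s) L"] by (simp add: comp_def)
  also have "\<dots> \<le> (\<Sum>p\<leftarrow>L. K * \<bar>fst p\<bar>)"
    using c_bound[OF _ s] by (intro sum_list_mono) (simp add: abs_mult mult.commute[of K] mult_left_mono)
  finally have "\<bar>h_path L \<epsilon> a r s\<bar> \<le> \<bar>a\<bar> * (K * (\<Sum>p\<leftarrow>L. \<bar>fst p\<bar>))"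
    unfolding h_path_def abs_mult by (intro mult_left_mono) (auto simp: sum_list_const_mult)
  then show "\<bar>h_path L \<epsilon> a r s\<bar> \<le> K'" using K' by linarith
next
  have "0 \<le> \<bar>a\<bar> * (K * (\<Sum>p\<leftarrow>L. \<bar>fst p\<bar>))"
    using K_nonneg by (intro mult_nonneg_nonneg sum_list_nonneg) auto
  then show "0 \<le> K'" using K' by linarith
next
  fix r :: real assume r: "0 \<le> r"
  have i: "integrable M (\<lambda>s. fst p * c (max 0 r) (snd p (max 0 (\<epsilon> * r))) s)" for p :: "real \<times> (real \<Rightarrow> real)"
    using c_bound c_measurable by (intro integrable_mult_right integrable_const_bound[where B=K]) auto
  show "expectation (h_path L \<epsilon> a r) = 0"
    unfolding h_path_def using c_centered by (simp add: integral_sum_list(2)[OF i])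
next
  fix r b :: real assume "0 \<le> r" "r \<le> b"
  then show "h_path L \<epsilon> a r \<in> borel_measurable (past b)"
    unfolding h_path_def by (intro borel_measurable_times borel_measurable_const sum_list_measurable c_field_algebra) auto
next
  fix r b :: real assume "0 \<le> b" "b \<le> r"
  then show "h_path L \<epsilon> a r \<in> borel_measurable (future b)"
    unfolding h_path_def by (intro borel_measurable_times borel_measurable_const sum_list_measurable c_field_algebra) auto
qed

text \<open>The substitution r = \<epsilon> u leaves the factor sqrt \<epsilon> = sqrt
  t/sqrt(t/\<epsilon>). Hence the amplitude sqrt t and the normalisation by the square root of the
  length t/\<epsilon>, as the block estimates require.\<close>

lemma X_path_fast_time:
  assumes L: "\<And>p. p \<in> set L \<Longrightarrow> continuous_on {0..} (snd p)"
    and t: "0 < t" and \<epsilon>: "0 < \<epsilon>" and s: "s \<in> space M"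
  shows "(\<Sum>p\<leftarrow>L. fst p * X_path t \<epsilon> (snd p) s) =
    (\<integral>u. indicator {0..<t / \<epsilon>} u * h_path L \<epsilon> (sqrt t) u s \<partial>lborel) / sqrt (t / \<epsilon>)"
proof -
  let ?A = "{0..<t / \<epsilon>}"
  let ?k = "\<lambda>p u. indicator ?A u * c (max 0 u) (snd p (max 0 (\<epsilon> * u))) s"
  have meas: "?k p \<in> borel_measurable lborel" if "p \<in> set L" for p
  proof -
    have "(\<lambda>u. snd p (max 0 (\<epsilon> * u))) \<in> borel_measurable lborel"
      by (rule measurable_compose[OF _ path_measurable[OF L[OF that]]]) measurable
    then have "(\<lambda>u. c (max 0 u) (snd p (max 0 (\<epsilon> * u))) s) \<in> borel_measurable lborel"
      using s by (intro c_comp) auto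
    then show ?thesis by measurable
  qed
  have int: "integrable lborel (?k p)" if "p \<in> set L" for p
  proof (rule Bochner_Integration.integrable_bound[OF _ meas[OF that]])
    show "integrable lborel (\<lambda>u. K * indicator ?A u :: real)"
      using t \<epsilon> by (intro integrable_mult_right integrable_real_indicator) auto
  qed (use c_bound s K_nonneg in \<open>auto simp: indicator_def\<close>)
  have X: "X_path t \<epsilon> (snd p) s = sqrt \<epsilon> * (\<integral>u. ?k p u \<partial>lborel)" if p: "p \<in> set L" for p
  proof -
    have "(LINT r:{0..t}|lborel. c (r / \<epsilon>) (snd p r) s) = (\<integral>r. indicator {0..t} r * c (r / \<epsilon>) (snd p r) s \<partial>lborel)"
      by (simp add: set_lebesgue_integral_def)
    also have "\<dots> = \<epsilon> * (\<integral>u. indicator {0..t} (\<epsilon> * u) * c ((\<epsilon> * u) / \<epsilon>) (snd p (\<epsilon> * u)) s \<partial>lborel)"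
      using lborel_integral_real_affine[of \<epsilon> "\<lambda>r. indicator {0..t} r * c (r / \<epsilon>) (snd p r) s" 0] \<epsilon> by simp
    also have "(\<integral>u. indicator {0..t} (\<epsilon> * u) * c ((\<epsilon> * u) / \<epsilon>) (snd p (\<epsilon> * u)) s \<partial>lborel) = (\<integral>u. ?k p u \<partial>lborel)"
    proof -
      have e: "indicator {0..t} (\<epsilon> * u) * c ((\<epsilon> * u) / \<epsilon>) (snd p (\<epsilon> * u)) s
        = indicator {0..t / \<epsilon>} u * c (max 0 u) (snd p (max 0 (\<epsilon> * u))) s" for u
        using \<epsilon> by (auto simp: indicator_def field_simps max_absorb2 zero_le_mult_iff)
      have "AE u in lborel. u \<noteq> t / \<epsilon>" by (rule AE_lborel_singleton)
      then have "AE u in lborel. indicator {0..t / \<epsilon>} u * c (max 0 u) (snd p (max 0 (\<epsilon> * u))) s = ?k p u"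
        by eventually_elim (auto simp: indicator_def)
      moreover have "(\<lambda>u. indicator {0..t / \<epsilon>} u * c (max 0 u) (snd p (max 0 (\<epsilon> * u))) s) \<in> borel_measurable lborel"
      proof -
        have "(\<lambda>u. snd p (max 0 (\<epsilon> * u))) \<in> borel_measurable lborel"
          by (rule measurable_compose[OF _ path_measurable[OF L[OF p]]]) measurable
        then have "(\<lambda>u. c (max 0 u) (snd p (max 0 (\<epsilon> * u))) s) \<in> borel_measurable lborel"
          using s by (intro c_comp) auto
        then show ?thesis by measurable
      qed
      ultimately show ?thesis unfolding e using meas[OF p] by (intro integral_cong_AE)
    qed
    finally have "X_path t \<epsilon> (snd p) s = (\<epsilon> powr (-1/2) * \<epsilon>) * (\<integral>u. ?k p u \<partial>lborel)"
      by (simp add: X_path_def)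
    also have "\<epsilon> powr (-1/2) * \<epsilon> = sqrt \<epsilon>"
      using \<epsilon> powr_add[of \<epsilon> "-1/2" 1] by (simp add: powr_half_sqrt)
    finally show ?thesis .
  qed
  have "(\<integral>u. indicator ?A u * h_path L \<epsilon> (sqrt t) u s \<partial>lborel) = (\<integral>u. sqrt t * (\<Sum>p\<leftarrow>L. fst p * ?k p u) \<partial>lborel)"
    unfolding h_path_def sum_list_const_mult[symmetric] by (simp add: mult_ac)
  also have "\<dots> = sqrt t * (\<Sum>p\<leftarrow>L. fst p * (\<integral>u. ?k p u \<partial>lborel))"
  proof -
    have "integrable lborel (\<lambda>u. fst p * ?k p u)" if "p \<in> set L" for p
      using int[OF that] by (rule integrable_mult_right)
    from integral_sum_list(2)[of L lborel "\<lambda>p u. fst p * ?k p u", OF this] show ?thesis by simp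
  qed
  finally have "(\<integral>u. indicator ?A u * h_path L \<epsilon> (sqrt t) u s \<partial>lborel) / sqrt (t / \<epsilon>)
    = sqrt \<epsilon> * (\<Sum>p\<leftarrow>L. fst p * (\<integral>u. ?k p u \<partial>lborel))"
    using t by (simp add: real_sqrt_divide)
  also have "\<dots> = (\<Sum>p\<leftarrow>L. fst p * X_path t \<epsilon> (snd p) s)"
    unfolding sum_list_const_mult[symmetric] using X
    by (intro arg_cong[of _ _ sum_list] map_cong) (auto simp: mult_ac)
  finally show ?thesis ..
qed

end

context random_potential
begin

lemma X_path_0: "X_path 0 \<epsilon> f s = 0"
proof -
  have "AE r in lborel. r \<noteq> (0::real)" by (rule AE_lborel_singleton)
  then have "AE r in lborel. indicator {0..0} r *\<^sub>R c (r / \<epsilon>) (f r) s = 0"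
    by eventually_elim auto
  then have "(LINT r:{0..0}|lborel. c (r / \<epsilon>) (f r) s) = 0"
    unfolding set_lebesgue_integral_def by (rule integral_eq_zero_AE)
  then show ?thesis by (simp add: X_path_def)
qed

text \<open>Applied to 2 and -2 times the exponent, which explains K * 2 in K' and the leading 2 in
  q. The added 1 secures K' \<ge> 1, and \<epsilon> \<le> t secures length at least 1, both required
  by \<open>exponential_moment\<close>.\<close>

lemma X_path_exp_moment:
  assumes f: "continuous_on {0..} f" and t: "0 \<le> t" "t = 0 \<or> \<epsilon> \<le> t" and \<epsilon>: "0 < \<epsilon>"
  defines "K' \<equiv> sqrt t * (K * 2) + 1"
  defines "q \<equiv> 2 * exp (2 * (2 * K'\<^sup>2 * C) + 768 * C * K' ^ 4)"
  shows "integrable M (\<lambda>s. exp (2 * \<bar>X_path t \<epsilon> f s\<bar>)) \<and> expectation (\<lambda>s. exp (2 * \<bar>X_path t \<epsilon> f s\<bar>)) \<le> q"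
proof (cases "t = 0")
  case True
  have "1 \<le> exp (2 * (2 * K'\<^sup>2 * C) + 768 * C * K' ^ 4)" using C_nonneg by simp
  then have "1 \<le> q" unfolding q_def by linarith
  then show ?thesis by (simp add: True X_path_0 prob_space)
next
  case False
  then have t0: "0 < t" and T: "1 \<le> t / \<epsilon>" using t \<epsilon> by auto
  have K': "1 \<le> K'" using K_nonneg t by (simp add: K'_def)
  have part: "integrable M (\<lambda>s. exp (b * X_path t \<epsilon> f s)) \<and> (\<lambda>s. b * X_path t \<epsilon> f s) \<in> borel_measurable M \<and>
      expectation (\<lambda>s. exp (b * X_path t \<epsilon> f s)) \<le> exp (2 * (2 * K'\<^sup>2 * C) + 768 * C * K' ^ 4)"
    if b: "\<bar>b\<bar> = 2" for b
  proof -
    interpret H: mixing_process M past future C "h_path [(b, f)] \<epsilon> (sqrt t)" K'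
      by (rule h_path_process) (use f b t in \<open>auto simp: K'_def\<close>)
    have eq: "b * X_path t \<epsilon> f s = H.I {0..<t / \<epsilon>} s / sqrt (t / \<epsilon>)" if "s \<in> space M" for s
      using X_path_fast_time[of "[(b, f)]" t \<epsilon> s] f t0 \<epsilon> that by (simp add: H.I_def)
    have bnd: "\<bar>H.I {0..<t / \<epsilon>} s / sqrt (t / \<epsilon>)\<bar> \<le> K' * (t / \<epsilon>) / sqrt (t / \<epsilon>)" if "s \<in> space M" for s
    proof -
      have "{0..<t / \<epsilon>} \<subseteq> {0..t / \<epsilon>}" by auto
      then have "\<bar>H.I {0..<t / \<epsilon>} s\<bar> \<le> K' * (t / \<epsilon>)" using that T by (intro H.I_bound') auto
      then have "\<bar>H.I {0..<t / \<epsilon>} s\<bar> / sqrt (t / \<epsilon>) \<le> K' * (t / \<epsilon>) / sqrt (t / \<epsilon>)"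
        using T by (intro divide_right_mono) auto
      moreover have "\<bar>sqrt (t / \<epsilon>)\<bar> = sqrt (t / \<epsilon>)" using T by simp
      ultimately show ?thesis by (simp only: abs_divide)
    qed
    have "integrable M (\<lambda>s. exp (H.I {0..<t / \<epsilon>} s / sqrt (t / \<epsilon>)))"
    proof (rule integrable_const_bound[where B = "exp (K' * (t / \<epsilon>) / sqrt (t / \<epsilon>))"])
      show "AE s in M. norm (exp (H.I {0..<t / \<epsilon>} s / sqrt (t / \<epsilon>))) \<le> exp (K' * (t / \<epsilon>) / sqrt (t / \<epsilon>))"
        unfolding real_norm_def abs_exp_cancel exp_le_cancel_iff by (rule AE_I2) (rule abs_le_D1[OF bnd])
    qed measurable
    moreover have "(\<lambda>s. H.I {0..<t / \<epsilon>} s / sqrt (t / \<epsilon>)) \<in> borel_measurable M" by measurable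
    moreover note H.exponential_moment[OF T K']
    ultimately show ?thesis
      by (simp add: eq cong: Bochner_Integration.integrable_cong Bochner_Integration.integral_cong measurable_cong)
  qed
  have le: "exp (2 * \<bar>x\<bar>) \<le> exp (2 * x) + exp (- 2 * x)" for x :: real
    by (cases "0 \<le> x") auto
  have i: "integrable M (\<lambda>s. exp (2 * X_path t \<epsilon> f s) + exp (- 2 * X_path t \<epsilon> f s))"
    using part[of 2] part[of "-2"] by simp
  have "(\<lambda>s. 2 * X_path t \<epsilon> f s / 2) \<in> borel_measurable M"
    using part[of 2] by (intro borel_measurable_divide) auto
  then have [measurable]: "X_path t \<epsilon> f \<in> borel_measurable M" by simp
  have "integrable M (\<lambda>s. exp (2 * \<bar>X_path t \<epsilon> f s\<bar>))"
    by (rule Bochner_Integration.integrable_bound[OF i]) (use le in \<open>auto intro: order_trans[OF _ abs_ge_self]\<close>)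
  moreover have "expectation (\<lambda>s. exp (2 * \<bar>X_path t \<epsilon> f s\<bar>)) \<le> expectation (\<lambda>s. exp (2 * X_path t \<epsilon> f s) + exp (- 2 * X_path t \<epsilon> f s))"
    using i le by (intro integral_mono') (auto intro: add_nonneg_nonneg)
  moreover have "\<dots> \<le> q" using part[of 2] part[of "-2"] by (simp add: q_def)
  ultimately show ?thesis by simp
qed

text \<open>Covariance of the combined potential at the slow times r' and r when the fast times
  differ by v. Separating v from r' and r makes the two scales explicit.\<close>

definition path_kernel :: "(real \<times> (real \<Rightarrow> real)) list \<Rightarrow> real \<Rightarrow> real \<Rightarrow> real \<Rightarrow> real" where
  "path_kernel L v r' r = (\<Sum>p\<leftarrow>L. \<Sum>q\<leftarrow>L. fst p * fst q * cov_fun M c v (snd p (max 0 r') - snd q (max 0 r)))"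

lemma path_kernel_bound:
  "\<bar>path_kernel L v r' r\<bar> \<le> (\<Sum>p\<leftarrow>L. \<Sum>q\<leftarrow>L. \<bar>fst p * fst q\<bar>) * kernel_bound v"
proof -
  have "\<bar>path_kernel L v r' r\<bar> \<le> (\<Sum>p\<leftarrow>L. \<Sum>q\<leftarrow>L. \<bar>fst p * fst q\<bar> * kernel_bound v)"
    unfolding path_kernel_def
    by (intro abs_sum_list_le) (unfold abs_mult, intro mult_left_mono kernel_bound(3), auto)
  then show ?thesis by (simp only: sum_list_mult_const)
qed

lemma path_kernel_measurable:
  assumes L: "\<And>p. p \<in> set L \<Longrightarrow> continuous_on {0..} (snd p)"
    and [measurable]: "k \<in> borel_measurable N" "y' \<in> borel_measurable N" "y \<in> borel_measurable N"
  shows "(\<lambda>x. path_kernel L (k x) (y' x) (y x)) \<in> borel_measurable N"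
proof -
  have "(\<lambda>x. snd p (max 0 (z x))) \<in> borel_measurable N" if "p \<in> set L" "z \<in> borel_measurable N" for p z
    by (rule measurable_compose[OF that(2) path_measurable[OF L[OF that(1)]]])
  then show ?thesis unfolding path_kernel_def
    by (intro sum_list_measurable borel_measurable_times borel_measurable_const cov_fun_measurable borel_measurable_diff) auto
qed

lemma path_kernel_tendsto:
  assumes L: "\<And>p. p \<in> set L \<Longrightarrow> continuous_on {0..} (snd p)" and y: "y \<longlonglongrightarrow> r"
  shows "(\<lambda>n. path_kernel L v (y n) r) \<longlonglongrightarrow> path_kernel L v r r"
proof -
  have "(\<lambda>n. snd p (max 0 (y n))) \<longlonglongrightarrow> snd p (max 0 r)" if "p \<in> set L" for p
    by (rule continuous_on_tendsto_compose[OF L[OF that]]) (use y in \<open>auto intro!: tendsto_max\<close>)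
  then show ?thesis unfolding path_kernel_def
    by (intro tendsto_sum_list tendsto_mult_left cov_fun_tendsto tendsto_diff tendsto_const)
qed

text \<open>In the double time integral the inner variable becomes the fast lag v and the outer one
  the slow time r = \<epsilon> u; the powers of \<epsilon> cancel exactly.\<close>

lemma X_path_second_moment:
  assumes L: "\<And>p. p \<in> set L \<Longrightarrow> continuous_on {0..} (snd p)" and t: "0 < t" and \<epsilon>: "0 < \<epsilon>"
  shows "expectation (\<lambda>s. (\<Sum>p\<leftarrow>L. fst p * X_path t \<epsilon> (snd p) s)\<^sup>2) =
    (\<integral>r. indicator {0..<t} r * (\<integral>v. indicator {0..<t / \<epsilon>} (r / \<epsilon> + v) * path_kernel L v (r + \<epsilon> * v) r \<partial>lborel) \<partial>lborel)"
proof -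
  define K' where "K' = sqrt t * (K * (\<Sum>p\<leftarrow>L. \<bar>fst p\<bar>))"
  interpret H: mixing_process M past future C "h_path L \<epsilon> (sqrt t)" K'
    by (rule h_path_process) (use L t in \<open>auto simp: K'_def\<close>)
  let ?T = "t / \<epsilon>"
  let ?A = "{0..<?T}"
  have T: "0 < ?T" using t \<epsilon> by simp
  have A: "?A \<subseteq> {0..?T}" by auto
  have hh: "expectation (\<lambda>s. h_path L \<epsilon> (sqrt t) u' s * h_path L \<epsilon> (sqrt t) u s) = t * path_kernel L (u' - u) (\<epsilon> * u') (\<epsilon> * u)"
    if u: "0 \<le> u" "0 \<le> u'" for u u'
  proof -
    let ?c = "\<lambda>p u s. c u (snd p (max 0 (\<epsilon> * u))) s"
    have i: "integrable M (\<lambda>s. fst p * fst q * (?c p u' s * ?c q u s))" for p q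
      using c_bound u K_nonneg c_measurable
      by (intro integrable_mult_right integrable_const_bound[where B = "K * K"] AE_I2 borel_measurable_times)
         (auto simp: abs_mult intro!: mult_mono)
    have "h_path L \<epsilon> (sqrt t) u' s * h_path L \<epsilon> (sqrt t) u s = t * (\<Sum>p\<leftarrow>L. \<Sum>q\<leftarrow>L. fst p * fst q * (?c p u' s * ?c q u s))" for s
    proof -
      have "h_path L \<epsilon> (sqrt t) u' s * h_path L \<epsilon> (sqrt t) u s
        = (sqrt t * sqrt t) * ((\<Sum>p\<leftarrow>L. fst p * ?c p u' s) * (\<Sum>q\<leftarrow>L. fst q * ?c q u s))"
        unfolding h_path_def using u by (simp add: max_absorb2)
      then show ?thesis unfolding sum_list_mult using t by (simp add: mult_ac)
    qed
    then have "expectation (\<lambda>s. h_path L \<epsilon> (sqrt t) u' s * h_path L \<epsilon> (sqrt t) u s)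
      = t * expectation (\<lambda>s. \<Sum>p\<leftarrow>L. \<Sum>q\<leftarrow>L. fst p * fst q * (?c p u' s * ?c q u s))"
      by simp
    also have "expectation (\<lambda>s. \<Sum>p\<leftarrow>L. \<Sum>q\<leftarrow>L. fst p * fst q * (?c p u' s * ?c q u s))
      = (\<Sum>p\<leftarrow>L. \<Sum>q\<leftarrow>L. expectation (\<lambda>s. fst p * fst q * (?c p u' s * ?c q u s)))"
      by (subst integral_sum_list(2), intro integral_sum_list(1) i, subst integral_sum_list(2), intro i, simp)
    also have "\<dots> = path_kernel L (u' - u) (\<epsilon> * u') (\<epsilon> * u)"
      unfolding path_kernel_def using c_stationary_cov[OF u] by simp
    finally show ?thesis .
  qed
  have inner: "expectation (\<lambda>s. h_path L \<epsilon> (sqrt t) u s * H.I ?A s) =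
     t * (\<integral>v. indicator ?A (u + v) * path_kernel L v (\<epsilon> * (u + v)) (\<epsilon> * u) \<partial>lborel)" if u: "u \<in> ?A" for u
  proof -
    have "expectation (\<lambda>s. h_path L \<epsilon> (sqrt t) u s * H.I ?A s) = expectation (\<lambda>s. H.I ?A s * h_path L \<epsilon> (sqrt t) u s)"
      by (simp add: mult.commute)
    also have "\<dots> = (\<integral>u'. indicator ?A u' * expectation (\<lambda>s. h_path L \<epsilon> (sqrt t) u' s * h_path L \<epsilon> (sqrt t) u s) \<partial>lborel)"
      by (rule H.I_expectation[OF _ _ A, where z = K']) (use H.h_bound H.h_meas in auto)
    also have "\<dots> = (\<integral>u'. indicator ?A u' * (t * path_kernel L (u' - u) (\<epsilon> * u') (\<epsilon> * u)) \<partial>lborel)"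
      using u hh by (intro Bochner_Integration.integral_cong refl) (auto simp: indicator_def)
    also have "\<dots> = (\<integral>v. indicator ?A (u + 1 * v) * (t * path_kernel L ((u + 1 * v) - u) (\<epsilon> * (u + 1 * v)) (\<epsilon> * u)) \<partial>lborel)"
      using lborel_integral_real_affine[of 1 "\<lambda>u'. indicator ?A u' * (t * path_kernel L (u' - u) (\<epsilon> * u') (\<epsilon> * u))" u] by simp
    also have "\<dots> = (\<integral>v. t * (indicator ?A (u + v) * path_kernel L v (\<epsilon> * (u + v)) (\<epsilon> * u)) \<partial>lborel)"
      by (simp add: mult_ac)
    finally show ?thesis by simp
  qed
  let ?G = "\<lambda>u. indicator ?A u * (t * (\<integral>v. indicator ?A (u + v) * path_kernel L v (\<epsilon> * (u + v)) (\<epsilon> * u) \<partial>lborel))"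
  have "expectation (\<lambda>s. H.I ?A s * H.I ?A s) = (\<integral>u. indicator ?A u * expectation (\<lambda>s. h_path L \<epsilon> (sqrt t) u s * H.I ?A s) \<partial>lborel)"
    by (rule H.I_expectation[OF _ _ A, where z = "K' * ?T"]) (use H.I_bound'[OF _ A] T in auto)
  also have "\<dots> = (\<integral>u. ?G u \<partial>lborel)"
    using inner by (intro Bochner_Integration.integral_cong refl) (auto simp: indicator_def)
  also have "\<dots> = (1 / \<epsilon>) * (\<integral>r. ?G (r / \<epsilon>) \<partial>lborel)"
    using lborel_integral_real_affine[of "1 / \<epsilon>" ?G 0] \<epsilon> by simp
  also have "(\<integral>r. ?G (r / \<epsilon>) \<partial>lborel) = t * (\<integral>r. indicator {0..<t} r * (\<integral>v. indicator ?A (r / \<epsilon> + v) * path_kernel L v (r + \<epsilon> * v) r \<partial>lborel) \<partial>lborel)"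
  proof -
    have "?G (r / \<epsilon>) = t * (indicator {0..<t} r * (\<integral>v. indicator ?A (r / \<epsilon> + v) * path_kernel L v (r + \<epsilon> * v) r \<partial>lborel))" for r
    proof -
      have "indicator ?A (r / \<epsilon>) = (indicator {0..<t} r :: real)"
        using \<epsilon> by (auto simp: indicator_def zero_le_divide_iff divide_less_cancel)
      moreover have "\<epsilon> * (r / \<epsilon> + v) = r + \<epsilon> * v" "\<epsilon> * (r / \<epsilon>) = r" for v using \<epsilon> by (auto simp: distrib_left)
      ultimately show ?thesis by simp
    qed
    then show ?thesis by (simp only: integral_mult_right_zero)
  qed
  finally have II: "expectation (\<lambda>s. H.I ?A s * H.I ?A s) = ?T * (\<integral>r. indicator {0..<t} r * (\<integral>v. indicator ?A (r / \<epsilon> + v) * path_kernel L v (r + \<epsilon> * v) r \<partial>lborel) \<partial>lborel)"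
    by simp
  have "expectation (\<lambda>s. (\<Sum>p\<leftarrow>L. fst p * X_path t \<epsilon> (snd p) s)\<^sup>2) = expectation (\<lambda>s. (H.I ?A s * H.I ?A s) / ?T)"
  proof (rule Bochner_Integration.integral_cong[OF refl])
    fix s assume s: "s \<in> space M"
    have "(\<Sum>p\<leftarrow>L. fst p * X_path t \<epsilon> (snd p) s) = H.I ?A s / sqrt ?T"
      using X_path_fast_time[OF L t \<epsilon> s] by (simp only: H.I_def)
    then show "(\<Sum>p\<leftarrow>L. fst p * X_path t \<epsilon> (snd p) s)\<^sup>2 = (H.I ?A s * H.I ?A s) / ?T"
      using T by (simp only: power_divide real_sqrt_pow2 less_imp_le) (simp only: power2_eq_square)
  qed
  also have "\<dots> = expectation (\<lambda>s. H.I ?A s * H.I ?A s) / ?T" by (rule integral_divide_zero)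
  finally show ?thesis unfolding II using T by simp
qed

text \<open>For 0 < r < t the window of admissible lags grows to the whole line, while the positions
  at r + \<epsilon> v and r merge. The cubic kernel dominates in v, and integrating the covariance
  over all lags produces \<open>limit_cov\<close>.\<close>

lemma X_path_second_moment_tendsto:
  assumes L: "\<And>p. p \<in> set L \<Longrightarrow> continuous_on {0..} (snd p)" and t: "0 < t"
    and e: "\<And>n. 0 < e n" "e \<longlonglongrightarrow> 0"
  shows "(\<lambda>n. expectation (\<lambda>s. (\<Sum>p\<leftarrow>L. fst p * X_path t (e n) (snd p) s)\<^sup>2)) \<longlonglongrightarrow>
    (\<Sum>p\<leftarrow>L. \<Sum>q\<leftarrow>L. fst p * fst q * (\<integral>r. indicator {0..t} r * limit_cov M c (snd p r - snd q r) \<partial>lborel))"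
proof -
  let ?k = "\<lambda>n r v. indicator {0..<t / e n} (r / e n + v) * path_kernel L v (r + e n * v) r"
  let ?v = "\<Sum>p\<leftarrow>L. \<Sum>q\<leftarrow>L. fst p * fst q * (\<integral>r. indicator {0..t} r * limit_cov M c (snd p r - snd q r) \<partial>lborel)"
  define a where "a = (\<Sum>p\<leftarrow>L. \<Sum>q\<leftarrow>L. \<bar>fst p * fst q\<bar>)"
  have a: "0 \<le> a" by (auto simp: a_def intro!: sum_list_nonneg)
  note kb = path_kernel_bound[of L, folded a_def]
  have ib: "integrable lborel (\<lambda>v. a * kernel_bound v)" by (rule integrable_mult_right[OF kernel_bound(1)])
  let ?B = "a * (2 * K\<^sup>2 * C)"
  have B: "(\<integral>v. a * kernel_bound v \<partial>lborel) = ?B"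
    using kernel_bound(2) by (simp only: integral_mult_right_zero)
  have mk: "(\<lambda>v. indicator {0..<t / \<epsilon>} (r / \<epsilon> + v) * path_kernel L v (r + \<epsilon> * v) r) \<in> borel_measurable lborel" for r \<epsilon>
    by (intro borel_measurable_times path_kernel_measurable L) measurable
  let ?F = "\<lambda>n r. \<integral>v. ?k n r v \<partial>lborel"
  have Fb: "\<bar>?F n r\<bar> \<le> ?B" for n r
    unfolding B[symmetric]
  proof (rule abs_integral_le[OF ib])
    fix v
    show "\<bar>?k n r v\<bar> \<le> a * kernel_bound v"
      using kb[of v "r + e n * v" r] by (auto simp: indicator_def intro: order_trans[OF abs_ge_zero])
  qed
  have Flim: "(\<lambda>n. ?F n r) \<longlonglongrightarrow> (\<integral>v. path_kernel L v r r \<partial>lborel)" if r: "0 < r" "r < t" for r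
  proof (rule integral_dominated_convergence[OF _ mk ib])
    show "(\<lambda>v. path_kernel L v r r) \<in> borel_measurable lborel" by (intro path_kernel_measurable L) auto
    show "AE v in lborel. (\<lambda>n. ?k n r v) \<longlonglongrightarrow> path_kernel L v r r"
    proof (rule AE_I2)
      fix v
      have inv: "filterlim (\<lambda>n. b / e n) at_top sequentially" if "0 < b" for b
      proof -
        have "filterlim e (at_right 0) sequentially"
          using e by (auto simp: filterlim_at less_imp_neq[OF e(1), symmetric])
        then have "filterlim (\<lambda>n. inverse (e n)) at_top sequentially"
          by (rule filterlim_compose[OF filterlim_inverse_at_top_right])
        then have "filterlim (\<lambda>n. b * inverse (e n)) at_top sequentially"
          using that by (intro filterlim_tendsto_pos_mult_at_top[OF tendsto_const])
        then show ?thesis by (simp add: divide_inverse)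
      qed
      have "\<forall>\<^sub>F n in sequentially. - v \<le> r / e n"
        using inv[of r] r by (simp add: filterlim_at_top)
      moreover have "\<forall>\<^sub>F n in sequentially. v < (t - r) / e n"
        using inv[of "t - r"] r by (simp add: filterlim_at_top_dense)
      ultimately have "\<forall>\<^sub>F n in sequentially. path_kernel L v (r + e n * v) r = ?k n r v"
      proof eventually_elim
        case (elim n)
        then have "r / e n + v \<in> {0..<t / e n}" by (auto simp: diff_divide_distrib)
        then show ?case by simp
      qed
      moreover have "(\<lambda>n. path_kernel L v (r + e n * v) r) \<longlonglongrightarrow> path_kernel L v r r"
      proof (rule path_kernel_tendsto[OF L])
        have "(\<lambda>n. r + e n * v) \<longlonglongrightarrow> r + 0 * v" by (intro tendsto_intros e)
        then show "(\<lambda>n. r + e n * v) \<longlonglongrightarrow> r" by simp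
      qed
      ultimately show "(\<lambda>n. ?k n r v) \<longlonglongrightarrow> path_kernel L v r r"
        by (rule Lim_transform_eventually[rotated])
    qed
    show "AE v in lborel. norm (?k n r v) \<le> a * kernel_bound v" for n
    proof (rule AE_I2)
      fix v
      show "norm (?k n r v) \<le> a * kernel_bound v"
        using kb[of v "r + e n * v" r] by (auto simp: indicator_def intro: order_trans[OF abs_ge_zero])
    qed
  qed
  have Fm: "?F n \<in> borel_measurable lborel" for n
  proof (rule lborel.borel_measurable_lebesgue_integral)
    show "(\<lambda>(r, v). ?k n r v) \<in> borel_measurable (lborel \<Otimes>\<^sub>M lborel)"
      unfolding case_prod_beta' by (intro borel_measurable_times path_kernel_measurable L) measurable
  qed
  have F'm: "(\<lambda>r. \<integral>v. path_kernel L v r r \<partial>lborel) \<in> borel_measurable lborel"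
  proof (rule lborel.borel_measurable_lebesgue_integral)
    show "(\<lambda>(r, v). path_kernel L v r r) \<in> borel_measurable (lborel \<Otimes>\<^sub>M lborel)"
      unfolding case_prod_beta' by (intro path_kernel_measurable L) measurable
  qed
  have "(\<lambda>n. \<integral>r. indicator {0..<t} r * ?F n r \<partial>lborel) \<longlonglongrightarrow> (\<integral>r. indicator {0..<t} r * (\<integral>v. path_kernel L v r r \<partial>lborel) \<partial>lborel)"
  proof (rule integral_dominated_convergence[where w = "\<lambda>r. ?B * indicator {0..<t} r"])
    show "integrable lborel (\<lambda>r. ?B * indicator {0..<t} r :: real)"
      using t by (intro integrable_mult_right integrable_real_indicator) auto
    \<comment> \<open>At r = 0 only nonnegative lags are admissible for every \<epsilon>, so the
      limit there would be a one-sided integral.\<close>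
    have "AE r in lborel. r \<noteq> (0::real)" by (rule AE_lborel_singleton)
    then show "AE r in lborel. (\<lambda>n. indicator {0..<t} r * ?F n r) \<longlonglongrightarrow> indicator {0..<t} r * (\<integral>v. path_kernel L v r r \<partial>lborel)"
    proof eventually_elim
      case (elim r)
      show ?case
      proof (cases "r \<in> {0..<t}")
        case True
        then show ?thesis using elim by (intro tendsto_mult_left Flim) auto
      qed simp
    qed
    show "AE r in lborel. norm (indicator {0..<t} r * ?F n r) \<le> ?B * indicator {0..<t} r" for n
    proof (rule AE_I2)
      fix r show "norm (indicator {0..<t} r * ?F n r) \<le> ?B * indicator {0..<t} r"
        using Fb[of n r] by (simp add: indicator_def)
    qed
  qed (use Fm F'm in \<open>auto intro!: borel_measurable_times\<close>)
  also have "(\<integral>r. indicator {0..<t} r * (\<integral>v. path_kernel L v r r \<partial>lborel) \<partial>lborel)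
    = ?v"
  proof -
    have k: "(\<integral>v. path_kernel L v r r \<partial>lborel) = (\<Sum>p\<leftarrow>L. \<Sum>q\<leftarrow>L. fst p * fst q * limit_cov M c (snd p (max 0 r) - snd q (max 0 r)))" for r
    proof -
      have i: "integrable lborel (\<lambda>v. fst p * fst q * cov_fun M c v x)" for p q :: "real \<times> (real \<Rightarrow> real)" and x
        by (intro integrable_mult_right cov_fun_integrable)
      have "(\<integral>v. path_kernel L v r r \<partial>lborel) = (\<Sum>p\<leftarrow>L. \<Sum>q\<leftarrow>L. \<integral>v. fst p * fst q * cov_fun M c v (snd p (max 0 r) - snd q (max 0 r)) \<partial>lborel)"
        unfolding path_kernel_def
        by (subst integral_sum_list(2), intro integral_sum_list(1) i, subst integral_sum_list(2), intro i, simp)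
      then show ?thesis by (simp add: limit_cov_def)
    qed
    have Rm: "limit_cov M c \<in> borel_measurable borel" using limit_cov_continuous by (rule borel_measurable_continuous_onI)
    let ?R = "\<lambda>p q r. limit_cov M c (snd p (max 0 r) - snd q (max 0 r))"
    have mR: "?R p q \<in> borel_measurable lborel" if "p \<in> set L" "q \<in> set L" for p q
      using path_measurable[OF L[OF that(1)]] path_measurable[OF L[OF that(2)]]
      by (intro measurable_compose[OF _ Rm]) auto
    have i: "integrable lborel (\<lambda>r. fst p * fst q * (indicator {0..<t} r * ?R p q r))" if "p \<in> set L" "q \<in> set L" for p q
    proof (intro integrable_mult_right, rule Bochner_Integration.integrable_bound)
      show "integrable lborel (\<lambda>r. (2 * K\<^sup>2 * C) * indicator {0..<t} r :: real)"
        using t by (intro integrable_mult_right integrable_real_indicator) auto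
      show "(\<lambda>r. indicator {0..<t} r * ?R p q r) \<in> borel_measurable lborel"
        using mR[OF that] by (intro borel_measurable_times) auto
      show "AE r in lborel. norm (indicator {0..<t} r * ?R p q r) \<le> norm ((2 * K\<^sup>2 * C) * indicator {0..<t} r :: real)"
        using limit_cov_bound by (intro AE_I2) (auto simp: indicator_def intro: order_trans[OF _ abs_ge_self])
    qed
    have "(\<integral>r. indicator {0..<t} r * (\<integral>v. path_kernel L v r r \<partial>lborel) \<partial>lborel)
      = (\<integral>r. (\<Sum>p\<leftarrow>L. \<Sum>q\<leftarrow>L. fst p * fst q * (indicator {0..<t} r * ?R p q r)) \<partial>lborel)"
      unfolding k sum_list_const_mult[symmetric] by (simp add: mult_ac)
    also have "\<dots> = (\<Sum>p\<leftarrow>L. \<integral>r. (\<Sum>q\<leftarrow>L. fst p * fst q * (indicator {0..<t} r * ?R p q r)) \<partial>lborel)"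
      by (intro integral_sum_list(2) integral_sum_list(1) i)
    also have "\<dots> = (\<Sum>p\<leftarrow>L. \<Sum>q\<leftarrow>L. \<integral>r. fst p * fst q * (indicator {0..<t} r * ?R p q r) \<partial>lborel)"
      using i by (intro arg_cong[of _ _ sum_list] map_cong refl integral_sum_list(2)) auto
    also have "\<dots> = ?v"
    proof (intro arg_cong[of _ _ sum_list] map_cong refl)
      fix p q assume pq: "p \<in> set L" "q \<in> set L"
      have "AE r in lborel. r \<noteq> t" by (rule AE_lborel_singleton)
      then have "AE r in lborel. indicator {0..<t} r * ?R p q r = indicator {0..t} r * ?R p q r"
        by eventually_elim (auto simp: indicator_def)
      then have "(\<integral>r. indicator {0..<t} r * ?R p q r \<partial>lborel) = (\<integral>r. indicator {0..t} r * ?R p q r \<partial>lborel)"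
        using mR[OF pq] by (intro integral_cong_AE) auto
      also have "\<dots> = (\<integral>r. indicator {0..t} r * limit_cov M c (snd p r - snd q r) \<partial>lborel)"
        by (intro Bochner_Integration.integral_cong) (auto simp: indicator_def max_absorb2)
      finally show "(\<integral>r. fst p * fst q * (indicator {0..<t} r * ?R p q r) \<partial>lborel) = fst p * fst q * (\<integral>r. indicator {0..t} r * limit_cov M c (snd p r - snd q r) \<partial>lborel)"
        by simp
    qed
    finally show ?thesis .
  qed
  finally have "(\<lambda>n. \<integral>r. indicator {0..<t} r * ?F n r \<partial>lborel) \<longlonglongrightarrow> ?v" .
  moreover have "expectation (\<lambda>s. (\<Sum>p\<leftarrow>L. fst p * X_path t (e n) (snd p) s)\<^sup>2) = (\<integral>r. indicator {0..<t} r * ?F n r \<partial>lborel)" for n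
    by (rule X_path_second_moment[OF L t e(1)])
  ultimately show ?thesis by (simp only:)
qed

text \<open>The block estimate makes the characteristic function asymptotically Gaussian with the
  actual variance, and the variance converges separately. For t = 0 the fast time interval does not
  grow, but all exponents vanish.\<close>

lemma X_path_char_tendsto:
  assumes L: "\<And>p. p \<in> set L \<Longrightarrow> continuous_on {0..} (snd p)" and t: "0 \<le> t"
    and e: "\<And>n. 0 < e n" "e \<longlonglongrightarrow> 0"
  shows "(\<lambda>n. expectation (\<lambda>s. iexp (\<Sum>p\<leftarrow>L. fst p * X_path t (e n) (snd p) s))) \<longlonglongrightarrow>
    complex_of_real (exp (- (\<Sum>p\<leftarrow>L. \<Sum>q\<leftarrow>L. fst p * fst q * (\<integral>r. indicator {0..t} r * limit_cov M c (snd p r - snd q r) \<partial>lborel)) / 2))"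
proof (cases "t = 0")
  case True
  have z: "(\<integral>r. indicator {0..0} r * (f r :: real) \<partial>lborel) = 0" for f :: "real \<Rightarrow> real"
  proof (rule integral_eq_zero_AE)
    have "AE r in lborel. r \<noteq> (0::real)" by (rule AE_lborel_singleton)
    then show "AE r in lborel. indicator {0..0} r * f r = 0" by eventually_elim auto
  qed
  show ?thesis unfolding True X_path_0 z by (simp add: prob_space)
next
  case False
  then have t: "0 < t" using t by simp
  define T where "T n = t / e n" for n
  have T_lim: "filterlim T at_top sequentially"
  proof -
    have "filterlim e (at_right 0) sequentially" using e by (auto simp: filterlim_at less_imp_neq[OF e(1), symmetric])
    then have "filterlim (\<lambda>n. inverse (e n)) at_top sequentially"
      by (rule filterlim_compose[OF filterlim_inverse_at_top_right])
    then have "filterlim (\<lambda>n. t * inverse (e n)) at_top sequentially"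
      using t by (intro filterlim_tendsto_pos_mult_at_top[OF tendsto_const])
    then show ?thesis by (simp add: T_def[abs_def] divide_inverse)
  qed
  define K' where "K' = sqrt t * (K * (\<Sum>p\<leftarrow>L. \<bar>fst p\<bar>))"
  define D where "D = 2 * K'\<^sup>2 * C"
  define S where "S n s = (\<Sum>p\<leftarrow>L. fst p * X_path t (e n) (snd p) s)" for n s
  define V where "V n = expectation (\<lambda>s. (S n s)\<^sup>2)" for n
  \<comment> \<open>The exponents are those of \<open>clt_error_tendsto_0\<close>; the gap fits into
    a block eventually, since 0.3 < 1 - 0.6.\<close>
  let ?n = "\<lambda>T::real. nat \<lceil>T powr 0.6\<rceil>" and ?g = "\<lambda>T::real. T powr 0.3"
  let ?err = "\<lambda>T. sqrt (D * (real (?n T) * ?g T / T)) + real (?n T) * (8 * (C / (1 + ?g T) ^ 3))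
      + K' * sqrt T / real (?n T) * D + D\<^sup>2 / real (?n T) + D * (real (?n T) * ?g T / T + 1 / (1 + ?g T)\<^sup>2)"
  have "\<forall>\<^sub>F T::real in at_top. 0 < T \<and> 0 < ?n T \<and> ?g T < T / ?n T"
  proof -
    have "\<forall>\<^sub>F T::real in at_top. ?g T < T / ?n T" by real_asymp
    moreover have "\<forall>\<^sub>F T::real in at_top. 0 < T powr 0.6" by real_asymp
    ultimately show ?thesis using eventually_gt_at_top[of 0] by eventually_elim simp
  qed
  from eventually_compose_filterlim[OF this T_lim]
  have "\<forall>\<^sub>F n in sequentially. norm (expectation (\<lambda>s. iexp (S n s)) - complex_of_real (exp (- V n / 2))) \<le> ?err (T n)"
  proof eventually_elim
    case (elim n)
    interpret H: mixing_process M past future C "h_path L (e n) (sqrt t)" K'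
      by (rule h_path_process) (use L t in \<open>auto simp: K'_def\<close>)
    have eq: "S n s = H.I {0..<T n} s / sqrt (T n)" if "s \<in> space M" for s
      using X_path_fast_time[OF L t e(1) that] unfolding S_def T_def H.I_def by simp
    have "norm (expectation (\<lambda>s. iexp (H.I {0..<T n} s / sqrt (T n))) - complex_of_real (exp (- expectation (\<lambda>s. (H.I {0..<T n} s / sqrt (T n))\<^sup>2) / 2))) \<le> ?err (T n)"
      using H.clt_bound[of "T n" "?n (T n)" "?g (T n)"] elim unfolding D_def by simp
    moreover have "expectation (\<lambda>s. iexp (S n s)) = expectation (\<lambda>s. iexp (H.I {0..<T n} s / sqrt (T n)))"
      by (intro Bochner_Integration.integral_cong) (simp_all add: eq)
    moreover have "V n = expectation (\<lambda>s. (H.I {0..<T n} s / sqrt (T n))\<^sup>2)"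
      unfolding V_def by (intro Bochner_Integration.integral_cong) (simp_all add: eq)
    ultimately show ?case by simp
  qed
  moreover have "(\<lambda>n. ?err (T n)) \<longlonglongrightarrow> 0"
    unfolding D_def by (rule clt_error_tendsto_0[OF T_lim])
  ultimately have d: "(\<lambda>n. expectation (\<lambda>s. iexp (S n s)) - complex_of_real (exp (- V n / 2))) \<longlonglongrightarrow> 0"
    by (rule Lim_null_comparison)
  have "V \<longlonglongrightarrow> (\<Sum>p\<leftarrow>L. \<Sum>q\<leftarrow>L. fst p * fst q * (\<integral>r. indicator {0..t} r * limit_cov M c (snd p r - snd q r) \<partial>lborel))" (is "_ \<longlonglongrightarrow> ?v")
    unfolding V_def[abs_def] S_def by (rule X_path_second_moment_tendsto[OF L t e])
  then have "(\<lambda>n. complex_of_real (exp (- V n / 2))) \<longlonglongrightarrow> complex_of_real (exp (- ?v / 2))"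
    by (intro tendsto_intros) auto
  from tendsto_add[OF d this] show ?thesis by (simp add: S_def)
qed

end

section \<open>Convergence of the Feynman-Kac averages\<close>

text \<open>For \<theta> \<le> 1/3 the index is the integer part of 1/\<theta>. The intervals in the
  definition are disjoint, so the definite description is justified before it is evaluated.\<close>

lemma mixing_exponent_ge_3:
  assumes "0 < \<theta>"
  shows "3 \<le> mixing_exponent \<theta>"
proof (cases "\<theta> > 1/3")
  case True
  then show ?thesis by (simp add: mixing_exponent_def)
next
  case False
  define k where "k = nat \<lfloor>1 / \<theta>\<rfloor>"
  have ge: "3 \<le> 1 / \<theta>" using False assms by (simp add: field_simps)
  then have "3 \<le> \<lfloor>1 / \<theta>\<rfloor>" by (simp add: le_floor_iff)
  then have k: "3 \<le> k" "real k \<le> 1 / \<theta>" "1 / \<theta> < real k + 1" by (auto simp: k_def) linarith+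
  have iff: "1 / (real m + 1) < \<theta> \<and> \<theta> \<le> 1 / real m \<longleftrightarrow> real m \<le> 1 / \<theta> \<and> 1 / \<theta> < real m + 1" if "3 \<le> m" for m :: nat
    using that assms by (auto simp: field_simps)
  have "(THE k::nat. 3 \<le> k \<and> 1 / (real k + 1) < \<theta> \<and> \<theta> \<le> 1 / real k) = k"
  proof (rule the_equality)
    show "3 \<le> k \<and> 1 / (real k + 1) < \<theta> \<and> \<theta> \<le> 1 / real k" using k iff[of k] by blast
    fix m :: nat assume m: "3 \<le> m \<and> 1 / (real m + 1) < \<theta> \<and> \<theta> \<le> 1 / real m"
    then have "real m \<le> 1 / \<theta>" "1 / \<theta> < real m + 1" using iff[of m] by blast+
    then show "m = k" using k by linarith
  qed
  then show ?thesis using False k by (simp add: mixing_exponent_def)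
qed

text \<open>Existence of one jointly measurable version is what makes the choice by
  \<open>SOME\<close> meaningful.\<close>

lemma W_integral_BM_spec:
  fixes M :: "'s measure" and Om :: "'w measure"
  assumes "gaussian_noise M W R Rb" "prob_space Om" "brownian_motion Om B" "0 \<le> t"
  shows "W_integral_BM M Om W B t x \<in> borel_measurable (M \<Otimes>\<^sub>M Om)"
    and "AE w in Om. is_W_integral M W t (\<lambda>r. x + B r w) (\<lambda>s. W_integral_BM M Om W B t x (s, w))"
proof -
  have "\<exists>J\<in>borel_measurable (M \<Otimes>\<^sub>M Om). AE w in Om. is_W_integral M W t (\<lambda>r. x + B r w) (\<lambda>s. J (s, w))"
  proof (rule gaussian_noise.W_integral_exists[OF assms(1,2,4)])
    show "(\<lambda>w. x + B r w) \<in> borel_measurable Om" if "0 \<le> r" for r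
      using assms(3) that by (auto simp: brownian_motion_def)
    show "continuous_on {0..} (\<lambda>r. x + B r w)" if "w \<in> space Om" for w
      using assms(3) that by (intro continuous_on_add continuous_on_const) (auto simp: brownian_motion_def)
  qed
  then have "\<exists>J. J \<in> borel_measurable (M \<Otimes>\<^sub>M Om) \<and>
      (AE w in Om. is_W_integral M W t (\<lambda>r. x + B r w) (\<lambda>s. J (s, w)))" by blast
  from someI_ex[OF this]
  show "W_integral_BM M Om W B t x \<in> borel_measurable (M \<Otimes>\<^sub>M Om)"
    and "AE w in Om. is_W_integral M W t (\<lambda>r. x + B r w) (\<lambda>s. W_integral_BM M Om W B t x (s, w))"
    unfolding W_integral_BM_def by blast+
qed

text \<open>Brownian motion is jointly measurable by continuity of its paths. Freezing times at 0
  makes all compositions total and leaves the integral over {0..t} unchanged.\<close>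

lemma (in random_potential) X_path_BM_measurable:
  fixes Om :: "'w measure"
  assumes "prob_space Om" "brownian_motion Om B" "0 < \<epsilon>"
  shows "(\<lambda>(w, s). X_path t \<epsilon> (\<lambda>r. x + B r w) s) \<in> borel_measurable (Om \<Otimes>\<^sub>M M)"
proof -
  have B: "(\<lambda>(r, w). B (max 0 r) w) \<in> borel_measurable (borel \<Otimes>\<^sub>M Om)"
  proof (rule Caratheodory_measurable)
    show "B (max 0 r) \<in> borel_measurable Om" for r
      using assms(2) by (simp add: brownian_motion_def)
    show "continuous_on UNIV (\<lambda>r. B (max 0 r) w)" if "w \<in> space Om" for w
    proof (rule continuous_on_compose2[of "{0..}" "\<lambda>r. B r w" UNIV "max 0"])
      show "continuous_on {0..} (\<lambda>r. B r w)" using assms(2) that by (simp add: brownian_motion_def)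
      show "continuous_on UNIV (max (0::real))" by (intro continuous_on_max continuous_on_const continuous_on_id)
    qed auto
  qed
  have m: "(\<lambda>(z, r). indicator {0..t} r *\<^sub>R c (max 0 (r / \<epsilon>)) (x + B (max 0 r) (fst z)) (snd z)) \<in> borel_measurable ((Om \<Otimes>\<^sub>M M) \<Otimes>\<^sub>M lborel)"
    unfolding case_prod_beta'
  proof (intro borel_measurable_scaleR c_comp)
    have "(\<lambda>z. (snd z, fst (fst z))) \<in> measurable ((Om \<Otimes>\<^sub>M M) \<Otimes>\<^sub>M lborel) (borel \<Otimes>\<^sub>M Om)" by measurable
    from measurable_compose[OF this B] show "(\<lambda>z. x + B (max 0 (snd z)) (fst (fst z))) \<in> borel_measurable ((Om \<Otimes>\<^sub>M M) \<Otimes>\<^sub>M lborel)"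
      by simp
  qed auto
  have meas: "(\<lambda>z. \<epsilon> powr (-1/2) * (\<integral>r. indicator {0..t} r *\<^sub>R c (max 0 (r / \<epsilon>)) (x + B (max 0 r) (fst z)) (snd z) \<partial>lborel)) \<in> borel_measurable (Om \<Otimes>\<^sub>M M)"
    by (intro borel_measurable_times borel_measurable_const lborel.borel_measurable_lebesgue_integral m)
  have eq: "(\<integral>r. indicator {0..t} r *\<^sub>R c (max 0 (r / \<epsilon>)) (x + B (max 0 r) w) s \<partial>lborel) = (LINT r:{0..t}|lborel. c (r / \<epsilon>) (x + B r w) s)" for w s
    unfolding set_lebesgue_integral_def using assms(3)
    by (intro Bochner_Integration.integral_cong) (auto simp: indicator_def max_absorb2)
  show ?thesis using meas unfolding X_path_def eq case_prod_beta' .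
qed

theorem theorem5p13:
  fixes M :: "'s measure" and Om :: "'w measure"
    and B :: "real \<Rightarrow> 'w \<Rightarrow> real"
    and c W :: "real \<Rightarrow> real \<Rightarrow> 's \<Rightarrow> real"
    and g :: "real \<Rightarrow> real"
    and \<theta> C0 C \<delta> t x :: real
  assumes "prob_space M" and "prob_space Om"
    and "brownian_motion Om B"
    and "jointly_measurable_field M c" and "stationary_field M c"
    and centered: "\<And>t x. 0 \<le> t \<Longrightarrow> (\<integral>s. c t x s \<partial>M) = 0"
    and bounded: "\<exists>K. \<forall>t\<ge>0. \<forall>x. \<forall>s\<in>space M. \<bar>c t x s\<bar> \<le> K"
    and Phi_L1: "integrable lborel (\<lambda>(t, x). cov_fun M c t x)"
    and "0 < \<theta>"
    and hoelder: "\<And>r. 0 \<le> r \<Longrightarrow>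
          AE s in M. \<forall>y1 y2. \<bar>c r y1 s - c r y2 s\<bar> \<le> C0 * \<bar>y1 - y2\<bar> powr \<theta>"
    and "0 < C" and "0 < \<delta>"
    and mixing: "\<And>r. 0 \<le> r \<Longrightarrow> alpha_um M c r \<le> C * (1 + r) powr (- (mixing_exponent \<theta> + \<delta>))"
    and g_L2: "integrable lborel (\<lambda>y. (g y)\<^sup>2)" and g_cont: "continuous_on UNIV g"
    and W_cont: "\<And>s. s \<in> space M \<Longrightarrow> continuous_on ({0..} \<times> UNIV) (\<lambda>(t, x). W t x s)"
    and W_gaussian: "gaussian_field M W"
    and W_centered: "\<And>t x. 0 \<le> t \<Longrightarrow> (\<integral>s. W t x s \<partial>M) = 0"
    and W_cov: "\<And>t t' x x'. 0 \<le> t \<Longrightarrow> 0 \<le> t' \<Longrightarrow>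
          (\<integral>s. W t x s * W t' x' s \<partial>M) = min t t' * limit_cov M c (x - x')"
    and "0 \<le> t"
  shows "\<forall>e :: nat \<Rightarrow> real. (\<forall>n. 0 < e n) \<and> e \<longlonglongrightarrow> 0 \<longrightarrow>
           weak_conv_m (\<lambda>n. distr M borel (u_eps Om B c g (e n) t x))
                       (distr M borel (u_lim M Om W B g t x))"
proof (intro allI impI)
  fix e :: "nat \<Rightarrow> real" assume e: "(\<forall>n. 0 < e n) \<and> e \<longlonglongrightarrow> 0"
  then have e0: "\<And>n. 0 < e n" and e_lim: "e \<longlonglongrightarrow> 0" by auto
  obtain K where K: "\<And>t x s. 0 \<le> t \<Longrightarrow> s \<in> space M \<Longrightarrow> \<bar>c t x s\<bar> \<le> K" using bounded by blast
  interpret S: prob_space M by fact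
  interpret O: prob_space Om by fact
  \<comment> \<open>The base 1 + r is at least 1, so the larger decay exponent may be lowered to
    3.\<close>
  have mix3: "alpha_um M c r \<le> C / (1 + r) ^ 3" if r: "0 \<le> r" for r
  proof -
    have "alpha_um M c r \<le> C * (1 + r) powr (- (mixing_exponent \<theta> + \<delta>))" by (rule mixing[OF r])
    also have "\<dots> \<le> C * (1 + r) powr (- 3)"
      using mixing_exponent_ge_3[OF \<open>0 < \<theta>\<close>] \<open>0 < C\<close> \<open>0 < \<delta>\<close> r by (intro mult_left_mono powr_mono) auto
    also have "(1 + r) powr (- 3) = 1 / (1 + r) ^ 3"
      using r powr_realpow[of "1 + r" 3] by (simp add: powr_minus_divide)
    finally show ?thesis by simp
  qed
  interpret P: random_potential M c K \<theta> C0 C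
    by unfold_locales
       (use assms(4,5) centered K Phi_L1 \<open>0 < \<theta>\<close> hoelder \<open>0 < C\<close> mix3 in \<open>auto dest: borel_measurable_integrable\<close>)
  interpret N: gaussian_noise M W "limit_cov M c" "2 * K\<^sup>2 * C"
    by unfold_locales
       (use W_cont W_gaussian W_centered W_cov P.limit_cov_continuous P.limit_cov_bound in auto)
  define J where "J = W_integral_BM M Om W B t x"
  note J = W_integral_BM_spec[OF N.gaussian_noise_axioms \<open>prob_space Om\<close> \<open>brownian_motion Om B\<close> \<open>0 \<le> t\<close>, of x, folded J_def]
  define path where "path w = (\<lambda>r. x + B r w)" for w
  have path_cont: "continuous_on {0..} (path w)" if "w \<in> space Om" for w
    unfolding path_def using \<open>brownian_motion Om B\<close> that
    by (intro continuous_on_add continuous_on_const) (auto simp: brownian_motion_def)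
  \<comment> \<open>The paths along which the chosen J is a version of the noise integral;
    continuity of the path holds at every sample point.\<close>
  define good where "good = {w \<in> space Om. is_W_integral M W t (path w) (\<lambda>s. J (s, w))}"
  define G where "G w = g (x + B t w)" for w
  interpret A: random_functionals M Om G good
  proof unfold_locales
    show "integrable Om G" unfolding G_def
      by (rule O.brownian_integrable[OF \<open>brownian_motion Om B\<close> \<open>0 \<le> t\<close> g_L2 g_cont])
    show "AE w in Om. w \<in> good" using J(2) AE_space by eventually_elim (simp add: good_def path_def)
  qed (auto simp: good_def)
  define X where "X n w s = P.X_path t (e n) (path w) s" for n w s
  \<comment> \<open>\<open>q1\<close> bounds the prelimit exponents through
    \<open>X_path_exp_moment\<close>, \<open>q2\<close> the limiting ones through
    \<open>W_integral_exp_moment\<close> with the bound 2 K^2 C on the limiting covariance.\<close>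
  define q1 where "q1 = 2 * exp (2 * (2 * (sqrt t * (K * 2) + 1)\<^sup>2 * C) + 768 * C * (sqrt t * (K * 2) + 1) ^ 4)"
  define q2 where "q2 = exp 2 * (2 * exp (2 * (2 * K\<^sup>2 * C) * t))"
  have "weak_conv_m (\<lambda>n. distr M borel (\<lambda>s. \<integral>w. G w * exp (X n w s) \<partial>Om)) (distr M borel (\<lambda>s. \<integral>w. G w * exp (J (s, w)) \<partial>Om))"
  proof (rule A.exp_avg_weak_conv[where q = "max q1 q2"])
    show "(\<lambda>(w, s). X n w s) \<in> borel_measurable (Om \<Otimes>\<^sub>M M)" for n
      unfolding X_def path_def by (rule P.X_path_BM_measurable[OF \<open>prob_space Om\<close> \<open>brownian_motion Om B\<close> e0])
    show "(\<lambda>(w, s). J (s, w)) \<in> borel_measurable (Om \<Otimes>\<^sub>M M)"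
      using measurable_compose[OF measurable_pair_swap' J(1)] by (simp add: case_prod_beta')
    show "(\<lambda>n. \<integral>s. iexp (A.lin L (X n) s) \<partial>M) \<longlonglongrightarrow> (\<integral>s. iexp (A.lin L (\<lambda>w s. J (s, w)) s) \<partial>M)"
      if L: "snd ` set L \<subseteq> good" for L
    proof -
      let ?L = "map (\<lambda>p. (fst p, path (snd p))) L"
      have cont: "continuous_on {0..} (path (snd p))" if "p \<in> set L" for p
        using that L by (intro path_cont) (auto simp: good_def)
      then have cont': "continuous_on {0..} (snd p)" if "p \<in> set ?L" for p using that by auto
      \<comment> \<open>The noise and the potential meet here: both characteristic functions are
        governed by the same \<open>limit_var\<close>.\<close>
      have "(\<integral>s. iexp (\<Sum>p\<leftarrow>L. fst p * J (s, snd p)) \<partial>M) = exp (- N.limit_var t ?L / 2)"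
        by (rule N.W_integral_char[where J = "\<lambda>w s. J (s, w)" and f = path])
           (use \<open>0 \<le> t\<close> cont L in \<open>auto simp: good_def\<close>)
      moreover have "(\<lambda>n. \<integral>s. iexp (\<Sum>p\<leftarrow>?L. fst p * P.X_path t (e n) (snd p) s) \<partial>M) \<longlonglongrightarrow> exp (- N.limit_var t ?L / 2)"
        unfolding N.limit_var_def by (rule P.X_path_char_tendsto[OF cont' \<open>0 \<le> t\<close> e0 e_lim])
      ultimately show ?thesis by (simp add: A.lin_def X_def comp_def)
    qed
    have "\<forall>\<^sub>F n in sequentially. t = 0 \<or> e n \<le> t"
    \<comment> \<open>The exponential bound needs fast time at least 1, which holds for small
      \<epsilon> when t > 0; for t = 0 the exponent is identically 0.\<close>
    proof (cases "t = 0")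
      case False
      then have "\<forall>\<^sub>F n in sequentially. e n < t" using \<open>0 \<le> t\<close> e_lim by (intro order_tendstoD(2)) auto
      then show ?thesis by eventually_elim simp
    qed simp
    then show "\<forall>\<^sub>F n in sequentially. \<forall>w\<in>good. integrable M (\<lambda>s. exp (2 * \<bar>X n w s\<bar>)) \<and> (\<integral>s. exp (2 * \<bar>X n w s\<bar>) \<partial>M) \<le> max q1 q2"
    proof eventually_elim
      case (elim n)
      show ?case
      proof
        fix w assume "w \<in> good"
        then have "continuous_on {0..} (path w)" by (intro path_cont) (auto simp: good_def)
        from P.X_path_exp_moment[OF this \<open>0 \<le> t\<close> elim e0]
        show "integrable M (\<lambda>s. exp (2 * \<bar>X n w s\<bar>)) \<and> (\<integral>s. exp (2 * \<bar>X n w s\<bar>) \<partial>M) \<le> max q1 q2"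
          unfolding X_def q1_def by (auto intro: max.coboundedI1)
      qed
    qed
    fix w assume "w \<in> good"
    then have "is_W_integral M W t (path w) (\<lambda>s. J (s, w))" by (simp add: good_def)
    from N.W_integral_exp_moment[OF \<open>0 \<le> t\<close> this]
    show "integrable M (\<lambda>s. exp (2 * \<bar>J (s, w)\<bar>))" "(\<integral>s. exp (2 * \<bar>J (s, w)\<bar>) \<partial>M) \<le> max q1 q2"
      unfolding q2_def by (auto intro: max.coboundedI2)
  qed
  moreover have "(\<lambda>s. \<integral>w. G w * exp (X n w s) \<partial>Om) = u_eps Om B c g (e n) t x" for n
    by (simp add: fun_eq_iff u_eps_def G_def X_def P.X_path_def path_def)
  moreover have "(\<lambda>s. \<integral>w. G w * exp (J (s, w)) \<partial>Om) = u_lim M Om W B g t x"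
    by (simp add: fun_eq_iff u_lim_def G_def J_def)
  ultimately show "weak_conv_m (\<lambda>n. distr M borel (u_eps Om B c g (e n) t x)) (distr M borel (u_lim M Om W B g t x))"
    by simp
qed

end
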